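(* Let $k$ be a commutative ring with identity, let $\mathcal{C}$ be a small category, let $\mathcal{J}$ be a Grothendieck topology on $\mathcal{C}$, and let $\mathfrak{R}:\mathcal{C}^{\mathrm{op}}\to k\text{-}\mathrm{Alg}$ be a sheaf of unital $k$-algebras on the site $\mathbf{C}=(\mathcal{C},\mathcal{J})$. Then there is an equivalence of categories $$\mathfrak{M}od\text{-}\mathfrak{R}\;\simeq\;\mathrm{Tors}(Gr(\mathfrak{R}),\mathcal{J}')^{\perp}$$ for some linear Grothendieck topology $\mathcal{J}'$ on the linear Grothendieck construction $Gr(\mathfrak{R})$ of $\mathfrak{R}$. Here $\mathfrak{M}od\text{-}\mathfrak{R}$ is the category of sheaves of right $\mathfrak{R}$-modules on $\mathbf{C}$, $\mathrm{Tors}(Gr(\mathfrak{R}),\mathcal{J}')$ is the full subcategory of torsion modules in the category $\mathrm{Mod}\text{-}Gr(\mathfrak{R})$ of right $Gr(\mathfrak{R})$-modules, and $(-)^{\perp}$ is the right perpendicular category formed in $\mathrm{Mod}\text{-}Gr(\mathfrak{R})$.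
   Context: $k\text{-}\mathrm{Alg}$ is the category of unital associative $k$-algebras and unital $k$-algebra homomorphisms. All modules are right modules. Sheaves of modules. A presheaf of $\mathfrak{R}$-modules is a presheaf $\mathfrak{M}$ of $k$-modules on $\mathcal{C}$ such that each $\mathfrak{M}(x)$ is a right $\mathfrak{R}(x)$-module, with action maps natural in $x$; morphisms are morphisms of presheaves of $k$-modules compatible with the actions. A sheaf of $\mathfrak{R}$-modules is a presheaf of $\mathfrak{R}$-modules whose underlying presheaf is a sheaf for $\mathcal{J}$; morphisms are those of presheaves of $\mathfrak{R}$-modules. A presheaf with algebraic structure is a sheaf if its underlying presheaf of sets is. Linear Grothendieck construction. $Gr(\mathfrak{R})$ is the preadditive category with objects $\mathrm{Ob}\,\mathcal{C}$; with $\mathrm{Hom}_{Gr(\mathfrak{R})}(x,y)=\bigoplus_{f\in \mathrm{Hom}_{\mathcal{C}}(x,y)}\mathfrak{R}(x)$, elements written $(r_f)_f$, with componentwise addition; and with composition, for $(r_f)_f: x\to y$ and $(s_g)_g: y\to z$, $$(s_g)_g\circ (r_f)_f=\Big(\sum_{gf=h}\mathfrak{R}(f)(s_g)\,r_f\Big)_{h\in \mathrm{Hom}_{\mathcal{C}}(x,z)}.$$ Modules over a preadditive category. For a small preadditive category $\mathcal{A}$ (each Hom set is an abelian group and composition is bilinear), a right $\mathcal{A}$-module is an additive functor $\mathcal{A}^{\mathrm{op}}\to\mathbf{Ab}$; the category of these is $\mathrm{Mod}\text{-}\mathcal{A}$. Linear Grothendieck topology. A linear Grothendieck topology $\mathcal{J}'$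 on $\mathcal{A}$ assigns to each object $x$ a collection $\mathcal{J}'(x)$ of subfunctors of $\mathrm{Hom}_{\mathcal{A}}(-,x)$ in $\mathrm{Mod}\text{-}\mathcal{A}$ such that: (1) $\mathrm{Hom}_{\mathcal{A}}(-,x)\in\mathcal{J}'(x)$; (2) if $S\in\mathcal{J}'(x)$ and $f:y\to x$, then the pullback $f^{*}S$ of $S$ along $\mathrm{Hom}_{\mathcal{A}}(-,y)\to\mathrm{Hom}_{\mathcal{A}}(-,x)$ lies in $\mathcal{J}'(y)$; (3) if $S_1\in\mathcal{J}'(x)$ and $S_2$ is a subfunctor of $\mathrm{Hom}_{\mathcal{A}}(-,x)$ in $\mathrm{Mod}\text{-}\mathcal{A}$ with $f^{*}S_2\in\mathcal{J}'(y)$ for every $f:y\to x$ in $S_1$, then $S_2\in\mathcal{J}'(x)$. Torsion modules. $\mathfrak{F}\in\mathrm{Mod}\text{-}\mathcal{A}$ is torsion (with respect to $\mathcal{J}'$) if for every object $x$ and every morphism $\alpha:\mathrm{Hom}_{\mathcal{A}}(-,x)\to\mathfrak{F}$ there is $S\in\mathcal{J}'(x)$ with $\alpha|_S=0$. $\mathrm{Tors}(\mathcal{A},\mathcal{J}')\subseteq\mathrm{Mod}\text{-}\mathcal{A}$ is the full subcategory of torsion modules. Right perpendicular category. For a full subcategory $\mathcal{B}$ of a Grothendieck abelian category $\mathcal{G}$, $\mathcal{B}^{\perp}$ is the full subcategory of objects $a\in\mathcal{G}$ with $\mathrm{Hom}_{\mathcal{G}}(b,a)=0=\mathrm{Ext}^1_{\mathcal{G}}(b,a)$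 for all $b\in\mathcal{B}$. *)

theory Defs
  imports "HOL-Algebra.Module" "HOL-Algebra.Product_Groups" "HOL-Library.Equipollence"
begin

section \<open>Categories, functors, equivalences\<close>

text \<open>
  The sets \<open>Hom C x y\<close> need not be pairwise disjoint (in a linear Grothendieck construction the
  zero morphisms of different empty direct sums coincide as functions), so composition carries the
  three objects as arguments: \<open>comp C x y z g f\<close> is the composite of \<open>f : x \<rightarrow> y\<close>
  and \<open>g : y \<rightarrow> z\<close>. Nothing is required of these operations outside the objects and
  Hom sets.
\<close>

record ('o, 'a) category =
  Obj :: "'o set"
  Hom :: "'o \<Rightarrow> 'o \<Rightarrow> 'a set"
  ident :: "'o \<Rightarrow> 'a"
  comp :: "'o \<Rightarrow> 'o \<Rightarrow> 'o \<Rightarrow> 'a \<Rightarrow> 'a \<Rightarrow> 'a"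

locale category =
  fixes C :: "('o, 'a, 'z) category_scheme"
  assumes ident_in_Hom: "x \<in> Obj C \<Longrightarrow> ident C x \<in> Hom C x x"
    and comp_in_Hom: "\<lbrakk>x \<in> Obj C; y \<in> Obj C; z \<in> Obj C; f \<in> Hom C x y; g \<in> Hom C y z\<rbrakk>
      \<Longrightarrow> comp C x y z g f \<in> Hom C x z"
    and comp_ident_left: "\<lbrakk>x \<in> Obj C; y \<in> Obj C; f \<in> Hom C x y\<rbrakk>
      \<Longrightarrow> comp C x y y (ident C y) f = f"
    and comp_ident_right: "\<lbrakk>x \<in> Obj C; y \<in> Obj C; f \<in> Hom C x y\<rbrakk>
      \<Longrightarrow> comp C x x y f (ident C x) = f"
    and comp_assoc: "\<lbrakk>w \<in> Obj C; x \<in> Obj C; y \<in> Obj C; z \<in> Obj C;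
        f \<in> Hom C w x; g \<in> Hom C x y; h \<in> Hom C y z\<rbrakk>
      \<Longrightarrow> comp C w y z h (comp C w x y g f) = comp C w x z (comp C x y z h g) f"

definition opp :: "('o, 'a, 'z) category_scheme \<Rightarrow> ('o, 'a, 'z) category_scheme" where
  "opp C = C\<lparr>Hom := (\<lambda>x y. Hom C y x), comp := (\<lambda>x y z g f. comp C z y x f g)\<rparr>"

definition full_subcategory ::
  "('o, 'a, 'z) category_scheme \<Rightarrow> ('o \<Rightarrow> bool) \<Rightarrow> ('o, 'a, 'z) category_scheme" where
  "full_subcategory C P = C\<lparr>Obj := {x \<in> Obj C. P x}\<rparr>"

definition is_iso :: "('o, 'a, 'z) category_scheme \<Rightarrow> 'o \<Rightarrow> 'o \<Rightarrow> 'a \<Rightarrow> bool" where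
  "is_iso C x y f \<longleftrightarrow> f \<in> Hom C x y \<and>
    (\<exists>g \<in> Hom C y x. comp C x y x g f = ident C x \<and> comp C y x y f g = ident C y)"

text \<open>The image of \<open>f : x \<rightarrow> y\<close> under the functor \<open>F\<close> is \<open>FArr F x y f\<close>.\<close>

record ('o, 'a, 'p, 'b) cfunctor =
  FObj :: "'o \<Rightarrow> 'p"
  FArr :: "'o \<Rightarrow> 'o \<Rightarrow> 'a \<Rightarrow> 'b"

locale cfunctor =
  fixes C :: "('o, 'a, 'y) category_scheme"
    and D :: "('p, 'b, 'z) category_scheme"
    and F :: "('o, 'a, 'p, 'b, 'w) cfunctor_scheme"
  assumes FObj_in_Obj: "x \<in> Obj C \<Longrightarrow> FObj F x \<in> Obj D"
    and FArr_in_Hom: "\<lbrakk>x \<in> Obj C; y \<in> Obj C; f \<in> Hom C x y\<rbrakk>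
      \<Longrightarrow> FArr F x y f \<in> Hom D (FObj F x) (FObj F y)"
    and FArr_ident: "x \<in> Obj C \<Longrightarrow> FArr F x x (ident C x) = ident D (FObj F x)"
    and FArr_comp: "\<lbrakk>x \<in> Obj C; y \<in> Obj C; z \<in> Obj C; f \<in> Hom C x y; g \<in> Hom C y z\<rbrakk>
      \<Longrightarrow> FArr F x z (comp C x y z g f)
          = comp D (FObj F x) (FObj F y) (FObj F z) (FArr F y z g) (FArr F x y f)"

definition id_functor :: "('o, 'a, 'o, 'a) cfunctor" where
  "id_functor = \<lparr>FObj = (\<lambda>x. x), FArr = (\<lambda>x y f. f)\<rparr>"

definition comp_functor ::
  "('p, 'b, 'q, 'c) cfunctor \<Rightarrow> ('o, 'a, 'p, 'b) cfunctor \<Rightarrow> ('o, 'a, 'q, 'c) cfunctor" where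
  "comp_functor G F = \<lparr>FObj = (\<lambda>x. FObj G (FObj F x)),
    FArr = (\<lambda>x y f. FArr G (FObj F x) (FObj F y) (FArr F x y f))\<rparr>"

definition nat_transformations ::
  "('o, 'a, 'y) category_scheme \<Rightarrow> ('p, 'b, 'z) category_scheme \<Rightarrow>
   ('o, 'a, 'p, 'b, 'v) cfunctor_scheme \<Rightarrow> ('o, 'a, 'p, 'b, 'w) cfunctor_scheme \<Rightarrow> ('o \<Rightarrow> 'b) set"
  where
  "nat_transformations C D F G =
    {\<eta> \<in> (\<Pi>\<^sub>E x \<in> Obj C. Hom D (FObj F x) (FObj G x)).
      \<forall>x \<in> Obj C. \<forall>y \<in> Obj C. \<forall>f \<in> Hom C x y.
        comp D (FObj F x) (FObj F y) (FObj G y) (\<eta> y) (FArr F x y f)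
        = comp D (FObj F x) (FObj G x) (FObj G y) (FArr G x y f) (\<eta> x)}"

definition naturally_isomorphic ::
  "('o, 'a, 'y) category_scheme \<Rightarrow> ('p, 'b, 'z) category_scheme \<Rightarrow>
   ('o, 'a, 'p, 'b, 'v) cfunctor_scheme \<Rightarrow> ('o, 'a, 'p, 'b, 'w) cfunctor_scheme \<Rightarrow> bool" where
  "naturally_isomorphic C D F G \<longleftrightarrow>
    (\<exists>\<eta> \<in> nat_transformations C D F G. \<forall>x \<in> Obj C. is_iso D (FObj F x) (FObj G x) (\<eta> x))"

definition equivalent_categories ::
  "('o, 'a, 'y) category_scheme \<Rightarrow> ('p, 'b, 'z) category_scheme \<Rightarrow> bool" where
  "equivalent_categories C D \<longleftrightarrow> category C \<and> category D \<and>
    (\<exists>(F :: ('o, 'a, 'p, 'b) cfunctor) (G :: ('p, 'b, 'o, 'a) cfunctor).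
      cfunctor C D F \<and> cfunctor D C G \<and>
      naturally_isomorphic C C id_functor (comp_functor G F) \<and>
      naturally_isomorphic D D (comp_functor F G) id_functor)"


section \<open>Smallness\<close>

text \<open>
  \<open>U\<close> plays the role of the universe: its elements are the carriers that modules may have. It is
  only asked to contain an infinite set and to be closed under passing to sets of at most the same
  cardinality. Both \<open>UNIV :: 'm set set\<close> for an infinite type \<open>'m\<close> and
  \<open>{A. A \<prec> B}\<close> for an uncountable set \<open>B\<close> (for instance, of inaccessible cardinality)
  are admitted. No closure under power sets is required, since HOL does not prove that
  a type with such a \<open>U\<close> exists.
\<close>

definition size_universe :: "'m set set \<Rightarrow> bool" where
  "size_universe U \<longleftrightarrow> (\<exists>A \<in> U. infinite A) \<and> (\<forall>A \<in> U. \<forall>B. B \<lesssim> A \<longrightarrow> B \<in> U)"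

definition small :: "'m set set \<Rightarrow> 'x set \<Rightarrow> bool" where
  "small U X \<longleftrightarrow> (\<exists>A \<in> U. X \<lesssim> A)"

definition small_category :: "'m set set \<Rightarrow> ('o, 'a, 'z) category_scheme \<Rightarrow> bool" where
  "small_category U C \<longleftrightarrow> category C \<and> small U (Obj C) \<and>
    (\<forall>x \<in> Obj C. \<forall>y \<in> Obj C. small U (Hom C x y))"


section \<open>Sieves, Grothendieck topologies, sheaves\<close>

text \<open>A sieve on \<open>x\<close> is given by its sets \<open>S y\<close> of morphisms \<open>y \<rightarrow> x\<close>.\<close>

definition sieve :: "('o, 'a, 'z) category_scheme \<Rightarrow> 'o \<Rightarrow> ('o \<Rightarrow> 'a set) \<Rightarrow> bool" where
  "sieve C x S \<longleftrightarrow>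
    (\<forall>y. y \<notin> Obj C \<longrightarrow> S y = {}) \<and> (\<forall>y \<in> Obj C. S y \<subseteq> Hom C y x) \<and>
    (\<forall>y \<in> Obj C. \<forall>z \<in> Obj C. \<forall>f \<in> S y. \<forall>g \<in> Hom C z y. comp C z y x f g \<in> S z)"

definition max_sieve :: "('o, 'a, 'z) category_scheme \<Rightarrow> 'o \<Rightarrow> 'o \<Rightarrow> 'a set" where
  "max_sieve C x = (\<lambda>y. if y \<in> Obj C then Hom C y x else {})"

text \<open>The pullback of a sieve \<open>S\<close> on \<open>x\<close> along \<open>f : y \<rightarrow> x\<close>.\<close>

definition pullback_sieve ::
  "('o, 'a, 'z) category_scheme \<Rightarrow> 'o \<Rightarrow> 'o \<Rightarrow> 'a \<Rightarrow> ('o \<Rightarrow> 'a set) \<Rightarrow> 'o \<Rightarrow> 'a set" where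
  "pullback_sieve C y x f S =
    (\<lambda>z. if z \<in> Obj C then {g \<in> Hom C z y. comp C z y x f g \<in> S z} else {})"

locale grothendieck_topology = category C
  for C :: "('o, 'a, 'z) category_scheme" +
  fixes J :: "'o \<Rightarrow> ('o \<Rightarrow> 'a set) set"
  assumes covering_sieve: "\<lbrakk>x \<in> Obj C; S \<in> J x\<rbrakk> \<Longrightarrow> sieve C x S"
    and max_sieve_covering: "x \<in> Obj C \<Longrightarrow> max_sieve C x \<in> J x"
    and stable: "\<lbrakk>x \<in> Obj C; y \<in> Obj C; S \<in> J x; f \<in> Hom C y x\<rbrakk>
      \<Longrightarrow> pullback_sieve C y x f S \<in> J y"
    and transitive: "\<lbrakk>x \<in> Obj C; S \<in> J x; sieve C x T;
        \<And>y f. \<lbrakk>y \<in> Obj C; f \<in> S y\<rbrakk> \<Longrightarrow> pullback_sieve C y x f T \<in> J y\<rbrakk>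
      \<Longrightarrow> T \<in> J x"

text \<open>
  Presheaves are functors on \<open>opp C\<close>: for \<open>f : y \<rightarrow> x\<close> in \<open>C\<close> the restriction map is
  \<open>\<rho> x y f\<close> from \<open>X x\<close> to \<open>X y\<close>.
\<close>

definition matching_family ::
  "('o, 'a, 'z) category_scheme \<Rightarrow> ('o \<Rightarrow> 's set) \<Rightarrow> ('o \<Rightarrow> 'o \<Rightarrow> 'a \<Rightarrow> 's \<Rightarrow> 's) \<Rightarrow>
   'o \<Rightarrow> ('o \<Rightarrow> 'a set) \<Rightarrow> ('o \<Rightarrow> 'a \<Rightarrow> 's) \<Rightarrow> bool" where
  "matching_family C X \<rho> x S s \<longleftrightarrow>
    (\<forall>y \<in> Obj C. \<forall>f \<in> S y. s y f \<in> X y) \<and>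
    (\<forall>y \<in> Obj C. \<forall>z \<in> Obj C. \<forall>f \<in> S y. \<forall>g \<in> Hom C z y.
      \<rho> y z g (s y f) = s z (comp C z y x f g))"

definition set_sheaf ::
  "('o, 'a, 'z) category_scheme \<Rightarrow> ('o \<Rightarrow> ('o \<Rightarrow> 'a set) set) \<Rightarrow>
   ('o \<Rightarrow> 's set) \<Rightarrow> ('o \<Rightarrow> 'o \<Rightarrow> 'a \<Rightarrow> 's \<Rightarrow> 's) \<Rightarrow> bool" where
  "set_sheaf C J X \<rho> \<longleftrightarrow>
    (\<forall>x \<in> Obj C. \<forall>S \<in> J x. \<forall>s. matching_family C X \<rho> x S s \<longrightarrow>
      (\<exists>!m. m \<in> X x \<and> (\<forall>y \<in> Obj C. \<forall>f \<in> S y. \<rho> x y f m = s y f)))"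


section \<open>Sheaves of algebras and sheaves of modules\<close>

text \<open>
  The library's \<open>algebra\<close> is commutative. Functions between carriers are taken extensional, so that
  equality of morphisms is equality of functions on the carriers.
  The ring multiplication fields of an object of \<open>KMod\<close> carry no information, as always for the
  library's \<open>module\<close>; no morphism refers to them.
\<close>

definition k_algebra :: "('k, 'z) ring_scheme \<Rightarrow> ('k, 'r, 'w) module_scheme \<Rightarrow> bool" where
  "k_algebra K A \<longleftrightarrow> module K A \<and> ring A \<and>
    (\<forall>c \<in> carrier K. \<forall>a \<in> carrier A. \<forall>b \<in> carrier A.
      (c \<odot>\<^bsub>A\<^esub> a) \<otimes>\<^bsub>A\<^esub> b = c \<odot>\<^bsub>A\<^esub> (a \<otimes>\<^bsub>A\<^esub> b) \<and>
      a \<otimes>\<^bsub>A\<^esub> (c \<odot>\<^bsub>A\<^esub> b) = c \<odot>\<^bsub>A\<^esub> (a \<otimes>\<^bsub>A\<^esub> b))"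

definition KAlg :: "('k, 'z) ring_scheme \<Rightarrow> (('k, 'r) module, 'r \<Rightarrow> 'r) category" where
  "KAlg K = \<lparr>
    Obj = {A. k_algebra K A},
    Hom = (\<lambda>A B. {f \<in> ring_hom A B \<inter> extensional (carrier A).
      \<forall>c \<in> carrier K. \<forall>a \<in> carrier A. f (c \<odot>\<^bsub>A\<^esub> a) = c \<odot>\<^bsub>B\<^esub> f a}),
    ident = (\<lambda>A. \<lambda>a \<in> carrier A. a),
    comp = (\<lambda>A B D g f. compose (carrier A) g f)\<rparr>"

definition KMod :: "'m set set \<Rightarrow> ('k, 'z) ring_scheme \<Rightarrow> (('k, 'm) module, 'm \<Rightarrow> 'm) category"
  where
  "KMod U K = \<lparr>
    Obj = {M. module K M \<and> carrier M \<in> U},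
    Hom = (\<lambda>M N. {f \<in> hom (add_monoid M) (add_monoid N) \<inter> extensional (carrier M).
      \<forall>c \<in> carrier K. \<forall>m \<in> carrier M. f (c \<odot>\<^bsub>M\<^esub> m) = c \<odot>\<^bsub>N\<^esub> f m}),
    ident = (\<lambda>M. \<lambda>m \<in> carrier M. m),
    comp = (\<lambda>M N L g f. compose (carrier M) g f)\<rparr>"

definition sheaf_of_algebras ::
  "('k, 'z) ring_scheme \<Rightarrow> ('o, 'a) category \<Rightarrow> ('o \<Rightarrow> ('o \<Rightarrow> 'a set) set) \<Rightarrow>
   ('o, 'a, ('k, 'r) module, 'r \<Rightarrow> 'r) cfunctor \<Rightarrow> bool" where
  "sheaf_of_algebras K C J R \<longleftrightarrow> cfunctor (opp C) (KAlg K) R \<and>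
    set_sheaf C J (\<lambda>x. carrier (FObj R x)) (FArr R)"

text \<open>
  A right module structure over the algebra \<open>A\<close> on the \<open>K\<close>-module \<open>M\<close>; the last condition is
  the usual compatibility of the actions of \<open>A\<close> and \<open>K\<close>.
\<close>

definition right_module ::
  "('k, 'z) ring_scheme \<Rightarrow> ('k, 'r) module \<Rightarrow> ('k, 'm) module \<Rightarrow> ('m \<Rightarrow> 'r \<Rightarrow> 'm) \<Rightarrow> bool" where
  "right_module K A M act \<longleftrightarrow> module K M \<and>
    (\<forall>m \<in> carrier M. \<forall>a \<in> carrier A. act m a \<in> carrier M) \<and>
    (\<forall>m \<in> carrier M. \<forall>n \<in> carrier M. \<forall>a \<in> carrier A.
      act (m \<oplus>\<^bsub>M\<^esub> n) a = act m a \<oplus>\<^bsub>M\<^esub> act n a) \<and>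
    (\<forall>m \<in> carrier M. \<forall>a \<in> carrier A. \<forall>b \<in> carrier A.
      act m (a \<oplus>\<^bsub>A\<^esub> b) = act m a \<oplus>\<^bsub>M\<^esub> act m b \<and>
      act m (a \<otimes>\<^bsub>A\<^esub> b) = act (act m a) b) \<and>
    (\<forall>m \<in> carrier M. act m \<one>\<^bsub>A\<^esub> = m) \<and>
    (\<forall>c \<in> carrier K. \<forall>m \<in> carrier M. \<forall>a \<in> carrier A.
      act (c \<odot>\<^bsub>M\<^esub> m) a = c \<odot>\<^bsub>M\<^esub> act m a \<and> act m (c \<odot>\<^bsub>A\<^esub> a) = c \<odot>\<^bsub>M\<^esub> act m a)"

record ('o, 'a, 'k, 'r, 'm) rmodule_data = "('o, 'a, ('k, 'm) module, 'm \<Rightarrow> 'm) cfunctor" +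
  act :: "'o \<Rightarrow> 'm \<Rightarrow> 'r \<Rightarrow> 'm"

definition presheaf_of_modules ::
  "'m set set \<Rightarrow> ('k, 'z) ring_scheme \<Rightarrow> ('o, 'a) category \<Rightarrow>
   ('o, 'a, ('k, 'r) module, 'r \<Rightarrow> 'r) cfunctor \<Rightarrow> ('o, 'a, 'k, 'r, 'm) rmodule_data \<Rightarrow> bool" where
  "presheaf_of_modules U K C R M \<longleftrightarrow> cfunctor (opp C) (KMod U K) M \<and>
    (\<forall>x \<in> Obj C. right_module K (FObj R x) (FObj M x) (act M x)) \<and>
    (\<forall>x \<in> Obj C. \<forall>y \<in> Obj C. \<forall>f \<in> Hom C y x.
      \<forall>m \<in> carrier (FObj M x). \<forall>r \<in> carrier (FObj R x).
        FArr M x y f (act M x m r) = act M y (FArr M x y f m) (FArr R x y f r))"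

definition presheaf_of_modules_hom ::
  "'m set set \<Rightarrow> ('k, 'z) ring_scheme \<Rightarrow> ('o, 'a) category \<Rightarrow>
   ('o, 'a, ('k, 'r) module, 'r \<Rightarrow> 'r) cfunctor \<Rightarrow> ('o, 'a, 'k, 'r, 'm) rmodule_data \<Rightarrow>
   ('o, 'a, 'k, 'r, 'm) rmodule_data \<Rightarrow> ('o \<Rightarrow> 'm \<Rightarrow> 'm) set" where
  "presheaf_of_modules_hom U K C R M N =
    {\<eta> \<in> nat_transformations (opp C) (KMod U K) M N.
      \<forall>x \<in> Obj C. \<forall>m \<in> carrier (FObj M x). \<forall>r \<in> carrier (FObj R x).
        \<eta> x (act M x m r) = act N x (\<eta> x m) r}"

definition ShMod ::
  "'m set set \<Rightarrow> ('k, 'z) ring_scheme \<Rightarrow> ('o, 'a) category \<Rightarrow> ('o \<Rightarrow> ('o \<Rightarrow> 'a set) set) \<Rightarrow>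
   ('o, 'a, ('k, 'r) module, 'r \<Rightarrow> 'r) cfunctor \<Rightarrow>
   (('o, 'a, 'k, 'r, 'm) rmodule_data, 'o \<Rightarrow> 'm \<Rightarrow> 'm) category" where
  "ShMod U K C J R = \<lparr>
    Obj = {M. presheaf_of_modules U K C R M \<and>
      set_sheaf C J (\<lambda>x. carrier (FObj M x)) (FArr M)},
    Hom = presheaf_of_modules_hom U K C R,
    ident = (\<lambda>M. \<lambda>x \<in> Obj C. \<lambda>m \<in> carrier (FObj M x). m),
    comp = (\<lambda>M N L \<theta> \<eta>. \<lambda>x \<in> Obj C. compose (carrier (FObj M x)) (\<theta> x) (\<eta> x))\<rparr>"


section \<open>Preadditive categories and their modules\<close>

text \<open>
  Following the library, abelian groups are \<open>comm_group\<close>s and hence written multiplicatively: the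
  sum of morphisms is \<open>\<otimes>\<^bsub>hgrp A x y\<^esub>\<close> and the zero morphism is \<open>\<one>\<^bsub>hgrp A x y\<^esub>\<close>.
\<close>

record ('o, 'a) preadditive = "('o, 'a) category" +
  hgrp :: "'o \<Rightarrow> 'o \<Rightarrow> 'a monoid"

locale preadditive = category A
  for A :: "('o, 'a, 'z) preadditive_scheme" +
  assumes hgrp_comm_group: "\<lbrakk>x \<in> Obj A; y \<in> Obj A\<rbrakk> \<Longrightarrow> comm_group (hgrp A x y)"
    and carrier_hgrp: "\<lbrakk>x \<in> Obj A; y \<in> Obj A\<rbrakk> \<Longrightarrow> carrier (hgrp A x y) = Hom A x y"
    and comp_add_left: "\<lbrakk>x \<in> Obj A; y \<in> Obj A; z \<in> Obj A; f \<in> Hom A x y;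
        g \<in> Hom A y z; g' \<in> Hom A y z\<rbrakk>
      \<Longrightarrow> comp A x y z (g \<otimes>\<^bsub>hgrp A y z\<^esub> g') f
          = comp A x y z g f \<otimes>\<^bsub>hgrp A x z\<^esub> comp A x y z g' f"
    and comp_add_right: "\<lbrakk>x \<in> Obj A; y \<in> Obj A; z \<in> Obj A; f \<in> Hom A x y; f' \<in> Hom A x y;
        g \<in> Hom A y z\<rbrakk>
      \<Longrightarrow> comp A x y z g (f \<otimes>\<^bsub>hgrp A x y\<^esub> f')
          = comp A x y z g f \<otimes>\<^bsub>hgrp A x z\<^esub> comp A x y z g f'"

definition hzero :: "('o, 'a, 'z) preadditive_scheme \<Rightarrow> 'o \<Rightarrow> 'o \<Rightarrow> 'a" where
  "hzero A x y = \<one>\<^bsub>hgrp A x y\<^esub>"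

definition opp_preadditive ::
  "('o, 'a, 'z) preadditive_scheme \<Rightarrow> ('o, 'a, 'z) preadditive_scheme" where
  "opp_preadditive A = (opp A)\<lparr>hgrp := (\<lambda>x y. hgrp A y x)\<rparr>"

locale additive_functor = cfunctor A B F
  for A :: "('o, 'a, 'y) preadditive_scheme"
    and B :: "('p, 'b, 'z) preadditive_scheme"
    and F :: "('o, 'a, 'p, 'b, 'w) cfunctor_scheme" +
  assumes FArr_hom: "\<lbrakk>x \<in> Obj A; y \<in> Obj A\<rbrakk>
    \<Longrightarrow> FArr F x y \<in> hom (hgrp A x y) (hgrp B (FObj F x) (FObj F y))"

definition group_maps :: "('p, 'y) monoid_scheme \<Rightarrow> ('q, 'z) monoid_scheme \<Rightarrow> ('p \<Rightarrow> 'q) set" where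
  "group_maps G H = hom G H \<inter> extensional (carrier G)"

definition Ab :: "'m set set \<Rightarrow> ('m monoid, 'm \<Rightarrow> 'm) preadditive" where
  "Ab U = \<lparr>
    Obj = {G. comm_group G \<and> carrier G \<in> U},
    Hom = group_maps,
    ident = (\<lambda>G. \<lambda>a \<in> carrier G. a),
    comp = (\<lambda>G H L g f. compose (carrier G) g f),
    hgrp = (\<lambda>G H. \<lparr>carrier = group_maps G H,
      monoid.mult = (\<lambda>f g. \<lambda>a \<in> carrier G. f a \<otimes>\<^bsub>H\<^esub> g a),
      one = (\<lambda>a \<in> carrier G. \<one>\<^bsub>H\<^esub>)\<rparr>)\<rparr>"

text \<open>
  Natural transformations between contravariant functors to abelian groups. The carriers of the two
  functors may lie in different types, as is the case for \<open>representable A x\<close> and a module.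
\<close>

definition module_maps ::
  "('o, 'a, 'z) preadditive_scheme \<Rightarrow> ('o, 'a, 'p monoid, 'p \<Rightarrow> 'p) cfunctor \<Rightarrow>
   ('o, 'a, 'q monoid, 'q \<Rightarrow> 'q) cfunctor \<Rightarrow> ('o \<Rightarrow> 'p \<Rightarrow> 'q) set" where
  "module_maps A F G =
    {\<eta> \<in> (\<Pi>\<^sub>E x \<in> Obj A. group_maps (FObj F x) (FObj G x)).
      \<forall>x \<in> Obj A. \<forall>y \<in> Obj A. \<forall>f \<in> Hom A y x. \<forall>m \<in> carrier (FObj F x).
        \<eta> y (FArr F x y f m) = FArr G x y f (\<eta> x m)}"

definition ModCat ::
  "'m set set \<Rightarrow> ('o, 'a, 'z) preadditive_scheme \<Rightarrow>
   (('o, 'a, 'm monoid, 'm \<Rightarrow> 'm) cfunctor, 'o \<Rightarrow> 'm \<Rightarrow> 'm) preadditive" where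
  "ModCat U A = \<lparr>
    Obj = {F. additive_functor (opp_preadditive A) (Ab U) F},
    Hom = module_maps A,
    ident = (\<lambda>F. \<lambda>x \<in> Obj A. \<lambda>m \<in> carrier (FObj F x). m),
    comp = (\<lambda>F G H \<theta> \<eta>. \<lambda>x \<in> Obj A. compose (carrier (FObj F x)) (\<theta> x) (\<eta> x)),
    hgrp = (\<lambda>F G. \<lparr>carrier = module_maps A F G,
      monoid.mult = (\<lambda>\<eta> \<theta>. \<lambda>x \<in> Obj A. \<lambda>m \<in> carrier (FObj F x). \<eta> x m \<otimes>\<^bsub>FObj G x\<^esub> \<theta> x m),
      one = (\<lambda>x \<in> Obj A. \<lambda>m \<in> carrier (FObj F x). \<one>\<^bsub>FObj G x\<^esub>)\<rparr>)\<rparr>"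

definition representable ::
  "('o, 'a, 'z) preadditive_scheme \<Rightarrow> 'o \<Rightarrow> ('o, 'a, 'a monoid, 'a \<Rightarrow> 'a) cfunctor" where
  "representable A x = \<lparr>
    FObj = (\<lambda>y. hgrp A y x),
    FArr = (\<lambda>y z g. \<lambda>f \<in> Hom A y x. comp A z y x f g)\<rparr>"


section \<open>Linear Grothendieck topologies and torsion modules\<close>

text \<open>Subfunctors of \<open>representable A x\<close> in the category of modules.\<close>

definition linear_sieve :: "('o, 'a, 'z) preadditive_scheme \<Rightarrow> 'o \<Rightarrow> ('o \<Rightarrow> 'a set) \<Rightarrow> bool" where
  "linear_sieve A x S \<longleftrightarrow> sieve A x S \<and> (\<forall>y \<in> Obj A. subgroup (S y) (hgrp A y x))"

locale linear_topology = preadditive A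
  for A :: "('o, 'a, 'z) preadditive_scheme" +
  fixes J :: "'o \<Rightarrow> ('o \<Rightarrow> 'a set) set"
  assumes covering_linear_sieve: "\<lbrakk>x \<in> Obj A; S \<in> J x\<rbrakk> \<Longrightarrow> linear_sieve A x S"
    and max_sieve_covering: "x \<in> Obj A \<Longrightarrow> max_sieve A x \<in> J x"
    and stable: "\<lbrakk>x \<in> Obj A; y \<in> Obj A; S \<in> J x; f \<in> Hom A y x\<rbrakk>
      \<Longrightarrow> pullback_sieve A y x f S \<in> J y"
    and transitive: "\<lbrakk>x \<in> Obj A; S \<in> J x; linear_sieve A x T;
        \<And>y f. \<lbrakk>y \<in> Obj A; f \<in> S y\<rbrakk> \<Longrightarrow> pullback_sieve A y x f T \<in> J y\<rbrakk>
      \<Longrightarrow> T \<in> J x"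

definition torsion ::
  "('o, 'a, 'z) preadditive_scheme \<Rightarrow> ('o \<Rightarrow> ('o \<Rightarrow> 'a set) set) \<Rightarrow>
   ('o, 'a, 'm monoid, 'm \<Rightarrow> 'm) cfunctor \<Rightarrow> bool" where
  "torsion A J F \<longleftrightarrow>
    (\<forall>x \<in> Obj A. \<forall>\<alpha> \<in> module_maps A (representable A x) F.
      \<exists>S \<in> J x. \<forall>y \<in> Obj A. \<forall>f \<in> S y. \<alpha> y f = \<one>\<^bsub>FObj F y\<^esub>)"

definition Tors ::
  "'m set set \<Rightarrow> ('o, 'a, 'z) preadditive_scheme \<Rightarrow> ('o \<Rightarrow> ('o \<Rightarrow> 'a set) set) \<Rightarrow>
   (('o, 'a, 'm monoid, 'm \<Rightarrow> 'm) cfunctor, 'o \<Rightarrow> 'm \<Rightarrow> 'm) preadditive" where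
  "Tors U A J = full_subcategory (ModCat U A) (torsion A J)"


section \<open>The first Ext group and right perpendicular categories\<close>

definition is_kernel ::
  "('o, 'a, 'z) preadditive_scheme \<Rightarrow> 'o \<Rightarrow> 'o \<Rightarrow> 'o \<Rightarrow> 'a \<Rightarrow> 'a \<Rightarrow> bool" where
  "is_kernel G a e b i p \<longleftrightarrow> i \<in> Hom G a e \<and> p \<in> Hom G e b \<and> comp G a e b p i = hzero G a b \<and>
    (\<forall>w \<in> Obj G. \<forall>f \<in> Hom G w e. comp G w e b p f = hzero G w b \<longrightarrow>
      (\<exists>!g. g \<in> Hom G w a \<and> comp G w a e i g = f))"

definition is_cokernel ::
  "('o, 'a, 'z) preadditive_scheme \<Rightarrow> 'o \<Rightarrow> 'o \<Rightarrow> 'o \<Rightarrow> 'a \<Rightarrow> 'a \<Rightarrow> bool" where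
  "is_cokernel G a e b i p \<longleftrightarrow> i \<in> Hom G a e \<and> p \<in> Hom G e b \<and> comp G a e b p i = hzero G a b \<and>
    (\<forall>w \<in> Obj G. \<forall>f \<in> Hom G e w. comp G a e w f i = hzero G a w \<longrightarrow>
      (\<exists>!g. g \<in> Hom G b w \<and> comp G e b w g p = f))"

text \<open>Short exact sequences \<open>0 \<rightarrow> a \<rightarrow> e \<rightarrow> b \<rightarrow> 0\<close> in an abelian category.\<close>

definition extensions ::
  "('o, 'a, 'z) preadditive_scheme \<Rightarrow> 'o \<Rightarrow> 'o \<Rightarrow> ('o \<times> 'a \<times> 'a) set" where
  "extensions G b a = {(e, i, p). e \<in> Obj G \<and> is_kernel G a e b i p \<and> is_cokernel G a e b i p}"

definition extension_equiv ::
  "('o, 'a, 'z) preadditive_scheme \<Rightarrow> 'o \<Rightarrow> 'o \<Rightarrow> (('o \<times> 'a \<times> 'a) \<times> ('o \<times> 'a \<times> 'a)) set" where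
  "extension_equiv G b a =
    {((e, i, p), (e', i', p')). (e, i, p) \<in> extensions G b a \<and> (e', i', p') \<in> extensions G b a \<and>
      (\<exists>\<phi>. is_iso G e e' \<phi> \<and> comp G a e e' \<phi> i = i' \<and> comp G e e' b p' \<phi> = p)}"

text \<open>
  The Yoneda description of \<open>Ext\<^sup>1(b, a)\<close>: equivalence classes of extensions, with the class of
  the split extensions as zero element.
\<close>

definition Ext1 ::
  "('o, 'a, 'z) preadditive_scheme \<Rightarrow> 'o \<Rightarrow> 'o \<Rightarrow> ('o \<times> 'a \<times> 'a) set set" where
  "Ext1 G b a = extensions G b a // extension_equiv G b a"

definition Ext1_zero :: "('o, 'a, 'z) preadditive_scheme \<Rightarrow> 'o \<Rightarrow> 'o \<Rightarrow> ('o \<times> 'a \<times> 'a) set" where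
  "Ext1_zero G b a =
    {(e, i, p) \<in> extensions G b a. \<exists>s \<in> Hom G b e. comp G b e b p s = ident G b}"

definition right_perp ::
  "('o, 'a, 'z) preadditive_scheme \<Rightarrow> ('o, 'a, 'y) preadditive_scheme \<Rightarrow>
   ('o, 'a, 'z) preadditive_scheme" where
  "right_perp G B = full_subcategory G
    (\<lambda>a. \<forall>b \<in> Obj B. Hom G b a = {hzero G b a} \<and> Ext1 G b a = {Ext1_zero G b a})"


section \<open>The linear Grothendieck construction\<close>

text \<open>
  \<open>Hom x y\<close> is the library's direct sum of copies of the additive group of \<open>R(x)\<close> indexed by the
  morphisms \<open>x \<rightarrow> y\<close>, i.e. the finitely supported extensional families \<open>r\<close> with
  \<open>r f \<in> R(x)\<close>. The sum defining the composite is taken over the pairs of indices in the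
  supports; all other terms vanish, and \<open>finsum\<close> over an infinite index set would be zero.
\<close>

definition Gr ::
  "('o, 'a) category \<Rightarrow> ('o, 'a, ('k, 'r) module, 'r \<Rightarrow> 'r) cfunctor \<Rightarrow>
   ('o, 'a \<Rightarrow> 'r) preadditive" where
  "Gr C R = \<lparr>
    Obj = Obj C,
    Hom = (\<lambda>x y. carrier (sum_group (Hom C x y) (\<lambda>f. add_monoid (FObj R x)))),
    ident = (\<lambda>x. \<lambda>f \<in> Hom C x x. if f = ident C x then \<one>\<^bsub>FObj R x\<^esub> else \<zero>\<^bsub>FObj R x\<^esub>),
    comp = (\<lambda>x y z s r. \<lambda>h \<in> Hom C x z.
      finsum (FObj R x) (\<lambda>(f, g). FArr R y x f (s g) \<otimes>\<^bsub>FObj R x\<^esub> r f)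
        {(f, g). f \<in> Hom C x y \<and> g \<in> Hom C y z \<and> comp C x y z g f = h \<and>
          r f \<noteq> \<zero>\<^bsub>FObj R x\<^esub> \<and> s g \<noteq> \<zero>\<^bsub>FObj R y\<^esub>}),
    hgrp = (\<lambda>x y. sum_group (Hom C x y) (\<lambda>f. add_monoid (FObj R x)))\<rparr>"

end

theory Submission
  imports Defs "HOL-Algebra.Free_Abelian_Groups"
begin

text \<open>
  A presheaf \<open>M\<close> of right modules over \<open>R\<close> is the same thing as a right module over the linear
  Grothendieck construction: a family \<open>(r\<^sub>f)\<close> of elements of \<open>R(y)\<close>, indexed by \<open>f : y \<rightarrow> x\<close>, sends
  \<open>m \<in> M(x)\<close> to the sum of the \<open>(m|\<^sub>f) r\<^sub>f\<close>, and conversely restriction along \<open>f\<close> and multiplication by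
  \<open>r\<close> are the actions of the families with the single entry \<open>1\<close> at \<open>f\<close> or \<open>r\<close> at the identity
  (\<open>to_gr\<close>, \<open>from_gr\<close>). The two translations do not change the underlying sets and maps. So all that
  has to be shown is that, for a suitable linear topology, a module is right perpendicular to the
  torsion modules exactly if its presheaf is a sheaf.

  The topology declares a linear sieve on \<open>x\<close> to be covering if the morphisms of \<open>C\<close> that lie in it
  form a covering sieve (\<open>lintop\<close>). Stability holds because a morphism of the linear Grothendieck
  construction has only finitely many components, so that it pulls a cover back to something
  containing a finite intersection of covers (\<open>covering_pullback_Gr\<close>). By the Yoneda lemma, a module
  is torsion exactly if each of its elements restricts to zero on some cover (\<open>torsion_iff\<close>).

  Let \<open>F\<close> be a sheaf. An element of \<open>F\<close> that vanishes on a cover is zero, so there are no nonzero maps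
  from torsion modules to \<open>F\<close>. In an extension \<open>E\<close> of a torsion module by \<open>F\<close>, every element lies in
  \<open>F\<close> locally, and the local elements glue; hence \<open>E\<close> is the direct sum of \<open>F\<close> and its own torsion
  submodule, and the extension splits (\<open>sheaf_torsion_extension_splits\<close>).

  Conversely, let \<open>F\<close> be right perpendicular. Its torsion submodule is included in it by a zero map,
  which gives the uniqueness of gluings (\<open>right_perp_torsion_free\<close>). A matching family on a cover \<open>T\<close>
  of \<open>x\<close> is a map \<open>\<sigma>\<close> to \<open>F\<close> from the linear sieve \<open>N\<close> generated by \<open>T\<close>. The pushout of \<open>\<sigma>\<close> and the
  inclusion of \<open>N\<close> into \<open>Hom(-, x)\<close> is an extension of the torsion module \<open>Hom(-, x)/N\<close> by \<open>F\<close>; a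
  splitting extends \<open>\<sigma>\<close> to \<open>Hom(-, x)\<close>, and the image of the identity is the glued element
  (\<open>right_perp_glue\<close>).

  Two things need care. Extensions are given by kernels and cokernels in the categorical sense, inside
  a category of modules whose carriers are sets of a prescribed size. Kernels can be tested on
  submodules, which are available (\<open>kernel_pointwise\<close>), and the splitting of extensions is treated by
  computations in an arbitrary preadditive category. Products and quotients, on the other hand, have
  carriers of the wrong type and are moved into the universe along an injection
  (\<open>quotient_in_universe\<close>).

  Identities between morphisms of the linear Grothendieck construction and their actions are reduced
  to families with a single entry by additivity (\<open>Gr_induct\<close>).
\<close>

section \<open>Small sets\<close>

lemma small_lepoll: "small U X \<Longrightarrow> Y \<lesssim> X \<Longrightarrow> small U Y"
  unfolding small_def by (meson lepoll_trans)

lemma small_in_universe: "A \<in> U \<Longrightarrow> small U A"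
  unfolding small_def by blast

text \<open>Cardinals are comparable, so the largest of the two bounds and an infinite member of the universe
  bounds both sets. An infinite bound absorbs products and finite powers.\<close>

lemma small_common_bound:
  assumes U: "size_universe U" and X: "small U X" and Y: "small U Y"
  obtains Z where "Z \<in> U" "infinite Z" "X \<lesssim> Z" "Y \<lesssim> Z"
proof -
  obtain A B I where *: "A \<in> U" "X \<lesssim> A" "B \<in> U" "Y \<lesssim> B" "I \<in> U" "infinite I"
    using assms unfolding size_universe_def small_def by blast
  have lin: "S \<lesssim> T \<or> T \<lesssim> S" for S T :: "'a set"
    using ordLeq_total[OF card_of_Well_order card_of_Well_order, of S T]
    by (auto simp: lepoll_def card_of_ordLeq)
  \<comment> \<open>the largest of the three sets\<close>
  obtain Z where Z: "Z \<in> {A, B, I}" "A \<lesssim> Z" "B \<lesssim> Z" "I \<lesssim> Z"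
    using lin[of A B] lin[of A I] lin[of B I] lepoll_refl
    by (metis insertCI lepoll_trans)
  have "infinite Z"
    using \<open>infinite I\<close> Z(4) by (meson finite_lepoll_infinite infinite_le_lepoll lepoll_trans)
  moreover have "Z \<in> U" using Z(1) * by blast
  moreover have "X \<lesssim> Z" "Y \<lesssim> Z"
    using lepoll_trans[OF *(2) Z(2)] lepoll_trans[OF *(4) Z(3)] .
  ultimately show ?thesis using that by blast
qed

lemma small_Times:
  assumes U: "size_universe U" and X: "small U X" and Y: "small U Y"
  shows "small U (X \<times> Y)"
proof -
  obtain Z where Z: "Z \<in> U" "infinite Z" "X \<lesssim> Z" "Y \<lesssim> Z"
    using small_common_bound[OF assms] .
  have "Z \<times> Z \<approx> Z"
    using card_of_Times_same_infinite[OF Z(2)] by (simp add: eqpoll_iff_card_of_ordIso)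
  then have "X \<times> Y \<lesssim> Z"
    using times_lepoll_mono[OF Z(3,4)] lepoll_trans2 by blast
  with Z(1) show ?thesis unfolding small_def by blast
qed

lemma small_Fpow:
  assumes U: "size_universe U" and X: "small U X"
  shows "small U (Fpow X)"
proof -
  obtain Z where Z: "Z \<in> U" "infinite Z" "X \<lesssim> Z"
    using small_common_bound[OF U X X] .
  obtain h where h: "inj_on h X" "h ` X \<subseteq> Z"
    using Z(3) unfolding lepoll_def by blast
  have "inj_on ((`) h) (Fpow X)"
    using h(1) by (auto simp: inj_on_def Fpow_def dest!: inj_on_image_eq_iff[OF h(1), THEN iffD1, rotated 2])
  moreover have "((`) h) ` Fpow X \<subseteq> Fpow Z"
    using h(2) by (auto simp: Fpow_def)
  ultimately have "Fpow X \<lesssim> Fpow Z"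
    unfolding lepoll_def by blast
  then have "Fpow X \<lesssim> Z"
    using eqpoll_Fpow[OF Z(2)] lepoll_trans2 by blast
  with Z(1) show ?thesis unfolding small_def by blast
qed

section \<open>Direct sums\<close>

definition single :: "'i set \<Rightarrow> ('i \<Rightarrow> ('b, 'c) monoid_scheme) \<Rightarrow> 'i \<Rightarrow> 'b \<Rightarrow> 'i \<Rightarrow> 'b" where
  "single I G i a = (\<lambda>j \<in> I. if j = i then a else \<one>\<^bsub>G j\<^esub>)"

lemma single_carrier:
  assumes "\<And>i. i \<in> I \<Longrightarrow> group (G i)" "i \<in> I" "a \<in> carrier (G i)"
  shows "single I G i a \<in> carrier (sum_group I G)"
proof -
  have "finite {j \<in> I. single I G i a j \<noteq> \<one>\<^bsub>G j\<^esub>}"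
    by (rule finite_subset[of _ "{i}"]) (auto simp: single_def)
  then show ?thesis
    using assms by (auto simp: carrier_sum_group single_def group.is_monoid)
qed

lemma single_mult:
  assumes "\<And>i. i \<in> I \<Longrightarrow> group (G i)"
  shows "single I G i a \<otimes>\<^bsub>sum_group I G\<^esub> single I G i b = single I G i (a \<otimes>\<^bsub>G i\<^esub> b)"
  using assms by (auto simp: single_def group.is_monoid)

text \<open>A finitely supported family is the sum of its own components. That the second case only speaks of
  the nontrivial components of \<open>x\<close> itself allows one to treat families supported in a given subset.\<close>

lemma sum_group_induct [consumes 2, case_names one single mult]:
  assumes grp: "\<And>i. i \<in> I \<Longrightarrow> group (G i)" and x: "x \<in> carrier (sum_group I G)"
    and one: "P \<one>\<^bsub>sum_group I G\<^esub>"
    and single: "\<And>i. i \<in> I \<Longrightarrow> x i \<noteq> \<one>\<^bsub>G i\<^esub> \<Longrightarrow> x i \<in> carrier (G i) \<Longrightarrow> P (single I G i (x i))"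
    and mult: "\<And>u v. u \<in> carrier (sum_group I G) \<Longrightarrow> v \<in> carrier (sum_group I G) \<Longrightarrow>
      P u \<Longrightarrow> P v \<Longrightarrow> P (u \<otimes>\<^bsub>sum_group I G\<^esub> v)"
  shows "P x"
proof -
  define supp where "supp = {i \<in> I. x i \<noteq> \<one>\<^bsub>G i\<^esub>}"
  define cut where "cut T = (\<lambda>j \<in> I. if j \<in> T then x j else \<one>\<^bsub>G j\<^esub>)" for T
  have xc: "x \<in> (\<Pi>\<^sub>E i\<in>I. carrier (G i))" and fin: "finite supp"
    using x grp by (auto simp: carrier_sum_group supp_def)
  have "cut T \<in> carrier (sum_group I G) \<and> P (cut T)" if "finite T" "T \<subseteq> supp" for T
    using that
  proof (induction T rule: finite_induct)
    case empty
    have "cut {} = \<one>\<^bsub>sum_group I G\<^esub>" by (auto simp: cut_def)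
    then show ?case
      using one group.is_monoid[OF sum_group[of I G]] grp monoid.one_closed by metis
  next
    case (insert i T)
    then have i: "i \<in> I" "x i \<noteq> \<one>\<^bsub>G i\<^esub>" by (auto simp: supp_def)
    with xc have xi: "x i \<in> carrier (G i)" by auto
    have "single I G i (x i) \<otimes>\<^bsub>sum_group I G\<^esub> cut T = cut (insert i T)"
      using insert(2) xc grp
      by (auto simp: single_def cut_def fun_eq_iff restrict_def PiE_iff group.is_monoid)
    moreover have "single I G i (x i) \<in> carrier (sum_group I G)"
      using grp i(1) xi by (intro single_carrier)
    ultimately show ?case
      using insert mult[OF _ _ single[OF i xi]]
      by (metis grp group.is_monoid insert_subset monoid.m_closed sum_group)
  qed
  moreover have "cut supp = x"
    using xc by (auto simp: cut_def supp_def fun_eq_iff PiE_iff extensional_def)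
  ultimately show ?thesis using fin by force
qed

text \<open>The map out of a direct sum that the universal property attaches to a family of maps \<open>h i\<close>.\<close>

definition sum_lift ::
  "('g, 'z) monoid_scheme \<Rightarrow> ('i \<Rightarrow> 'b \<Rightarrow> 'g) \<Rightarrow> 'i set \<Rightarrow> ('i \<Rightarrow> 'b) \<Rightarrow> 'g" where
  "sum_lift H h I x = gfinprod H (\<lambda>i. h i (x i)) I"

lemma sum_lift_hom:
  assumes "comm_group H" "\<And>i. i \<in> I \<Longrightarrow> group (G i)" "\<And>i. i \<in> I \<Longrightarrow> h i \<in> hom (G i) H"
  shows "sum_lift H h I \<in> hom (sum_group I G) H"
  using comm_group.hom_group_sum[OF assms(1), of I h G] assms(2,3)
  unfolding sum_lift_def[abs_def] by blast

lemma sum_lift_single: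
  assumes "comm_group H" "\<And>i. i \<in> I \<Longrightarrow> group (G i)" "\<And>i. i \<in> I \<Longrightarrow> h i \<in> hom (G i) H"
    "i \<in> I" "a \<in> carrier (G i)"
  shows "sum_lift H h I (single I G i a) = h i a"
proof -
  interpret H: comm_group H by fact
  have h1: "h j \<one>\<^bsub>G j\<^esub> = \<one>\<^bsub>H\<^esub>" if "j \<in> I" for j
    using hom_one[OF assms(3)[OF that] assms(2)[OF that]] H.is_group by blast
  have hc: "h i a \<in> carrier H" using assms hom_carrier by fastforce
  have "sum_lift H h I (single I G i a) = gfinprod H (\<lambda>j. h j (single I G i a j)) {i}"
    unfolding sum_lift_def
    by (rule H.gfinprod_mono_neutral_cong_right) (use assms(4) h1 hc in \<open>auto simp: single_def\<close>)
  also have "\<dots> = h i a"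
    using hc assms(4) by (simp add: single_def)
  finally show ?thesis .
qed

text \<open>A finitely supported family is determined by the finite set of its nontrivial entries.\<close>

lemma small_sum_group:
  assumes U: "size_universe U" and I: "small U I"
    and grp: "group G" and G: "small U (carrier G)"
  shows "small U (carrier (sum_group I (\<lambda>i. G)))"
proof -
  define graph where "graph x = {(i, x i) | i. i \<in> I \<and> x i \<noteq> \<one>\<^bsub>G\<^esub>}" for x
  have "inj_on graph (carrier (sum_group I (\<lambda>i. G)))"
  proof (rule inj_onI)
    fix x y assume x: "x \<in> carrier (sum_group I (\<lambda>i. G))"
      and y: "y \<in> carrier (sum_group I (\<lambda>i. G))" and eq: "graph x = graph y"
    have "x i = y i" if "i \<in> I" for i
    proof -
      have "(i, a) \<in> graph x \<longleftrightarrow> x i = a \<and> a \<noteq> \<one>\<^bsub>G\<^esub>"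
        "(i, a) \<in> graph y \<longleftrightarrow> y i = a \<and> a \<noteq> \<one>\<^bsub>G\<^esub>" for a
        using that by (auto simp: graph_def)
      then show ?thesis using eq by metis
    qed
    moreover have "x \<in> extensional I" "y \<in> extensional I"
      using x y grp by (auto simp: carrier_sum_group PiE_def)
    ultimately show "x = y" by (meson extensionalityI)
  qed
  moreover have "graph ` carrier (sum_group I (\<lambda>i. G)) \<subseteq> Fpow (I \<times> carrier G)"
    using grp by (auto simp: graph_def Fpow_def carrier_sum_group PiE_iff setcompr_eq_image)
  ultimately have "carrier (sum_group I (\<lambda>i. G)) \<lesssim> Fpow (I \<times> carrier G)"
    unfolding lepoll_def by blast
  then show ?thesis
    using small_lepoll small_Fpow[OF U] small_Times[OF U I G] by blast
qed

section \<open>Split extensions in preadditive categories\<close>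

context preadditive
begin

lemma hgrp_group: "x \<in> Obj A \<Longrightarrow> y \<in> Obj A \<Longrightarrow> group (hgrp A x y)"
  using hgrp_comm_group comm_group.axioms(2) by blast

lemma hgrp_facts:
  assumes "x \<in> Obj A" "y \<in> Obj A"
  shows hzero_in_Hom: "hzero A x y \<in> Hom A x y"
    and hadd_in_Hom: "f \<in> Hom A x y \<Longrightarrow> g \<in> Hom A x y \<Longrightarrow> f \<otimes>\<^bsub>hgrp A x y\<^esub> g \<in> Hom A x y"
    and hinv_in_Hom: "f \<in> Hom A x y \<Longrightarrow> inv\<^bsub>hgrp A x y\<^esub> f \<in> Hom A x y"
    and hadd_assoc: "f \<in> Hom A x y \<Longrightarrow> g \<in> Hom A x y \<Longrightarrow> h \<in> Hom A x y \<Longrightarrow>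
      (f \<otimes>\<^bsub>hgrp A x y\<^esub> g) \<otimes>\<^bsub>hgrp A x y\<^esub> h = f \<otimes>\<^bsub>hgrp A x y\<^esub> (g \<otimes>\<^bsub>hgrp A x y\<^esub> h)"
    and hadd_zero: "f \<in> Hom A x y \<Longrightarrow> f \<otimes>\<^bsub>hgrp A x y\<^esub> hzero A x y = f"
    and hadd_zero_left: "f \<in> Hom A x y \<Longrightarrow> hzero A x y \<otimes>\<^bsub>hgrp A x y\<^esub> f = f"
    and hadd_inv: "f \<in> Hom A x y \<Longrightarrow> f \<otimes>\<^bsub>hgrp A x y\<^esub> inv\<^bsub>hgrp A x y\<^esub> f = hzero A x y"
    and hadd_inv_left: "f \<in> Hom A x y \<Longrightarrow> inv\<^bsub>hgrp A x y\<^esub> f \<otimes>\<^bsub>hgrp A x y\<^esub> f = hzero A x y"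
    and hinv_zero: "inv\<^bsub>hgrp A x y\<^esub> (hzero A x y) = hzero A x y"
proof -
  interpret group "hgrp A x y" by (rule hgrp_group[OF assms])
  note c = carrier_hgrp[OF assms]
  show "hzero A x y \<in> Hom A x y"
    "f \<in> Hom A x y \<Longrightarrow> g \<in> Hom A x y \<Longrightarrow> f \<otimes>\<^bsub>hgrp A x y\<^esub> g \<in> Hom A x y"
    "f \<in> Hom A x y \<Longrightarrow> inv\<^bsub>hgrp A x y\<^esub> f \<in> Hom A x y"
    "f \<in> Hom A x y \<Longrightarrow> g \<in> Hom A x y \<Longrightarrow> h \<in> Hom A x y \<Longrightarrow>
      (f \<otimes>\<^bsub>hgrp A x y\<^esub> g) \<otimes>\<^bsub>hgrp A x y\<^esub> h = f \<otimes>\<^bsub>hgrp A x y\<^esub> (g \<otimes>\<^bsub>hgrp A x y\<^esub> h)"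
    "f \<in> Hom A x y \<Longrightarrow> f \<otimes>\<^bsub>hgrp A x y\<^esub> hzero A x y = f"
    "f \<in> Hom A x y \<Longrightarrow> hzero A x y \<otimes>\<^bsub>hgrp A x y\<^esub> f = f"
    "f \<in> Hom A x y \<Longrightarrow> f \<otimes>\<^bsub>hgrp A x y\<^esub> inv\<^bsub>hgrp A x y\<^esub> f = hzero A x y"
    "f \<in> Hom A x y \<Longrightarrow> inv\<^bsub>hgrp A x y\<^esub> f \<otimes>\<^bsub>hgrp A x y\<^esub> f = hzero A x y"
    "inv\<^bsub>hgrp A x y\<^esub> (hzero A x y) = hzero A x y"
    by (auto simp: hzero_def m_assoc simp flip: c)
qed

lemma comp_hom_left:
  assumes "x \<in> Obj A" "y \<in> Obj A" "z \<in> Obj A" "f \<in> Hom A x y"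
  shows "group_hom (hgrp A y z) (hgrp A x z) (\<lambda>g. comp A x y z g f)"
  using assms by (intro group_hom.intro group_hom_axioms.intro homI hgrp_group)
    (simp_all add: carrier_hgrp comp_in_Hom comp_add_left)

lemma comp_hom_right:
  assumes "x \<in> Obj A" "y \<in> Obj A" "z \<in> Obj A" "g \<in> Hom A y z"
  shows "group_hom (hgrp A x y) (hgrp A x z) (comp A x y z g)"
  using assms by (intro group_hom.intro group_hom_axioms.intro homI hgrp_group)
    (simp_all add: carrier_hgrp comp_in_Hom comp_add_right)

lemma comp_zero_inv:
  assumes "x \<in> Obj A" "y \<in> Obj A" "z \<in> Obj A"
  shows comp_zero_left: "f \<in> Hom A x y \<Longrightarrow> comp A x y z (hzero A y z) f = hzero A x z"
    and comp_zero_right: "g \<in> Hom A y z \<Longrightarrow> comp A x y z g (hzero A x y) = hzero A x z"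
    and comp_inv_left: "f \<in> Hom A x y \<Longrightarrow> g \<in> Hom A y z \<Longrightarrow>
      comp A x y z (inv\<^bsub>hgrp A y z\<^esub> g) f = inv\<^bsub>hgrp A x z\<^esub> comp A x y z g f"
    and comp_inv_right: "f \<in> Hom A x y \<Longrightarrow> g \<in> Hom A y z \<Longrightarrow>
      comp A x y z g (inv\<^bsub>hgrp A x y\<^esub> f) = inv\<^bsub>hgrp A x z\<^esub> comp A x y z g f"
  using group_hom.hom_one[OF comp_hom_left[OF assms]] group_hom.hom_one[OF comp_hom_right[OF assms]]
    group_hom.hom_inv[OF comp_hom_left[OF assms]] group_hom.hom_inv[OF comp_hom_right[OF assms]]
  by (simp_all add: hzero_def carrier_hgrp assms)

text \<open>The uniqueness clause in the definition only concerns maps that vanish on \<open>i\<close>; every map of the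
  form \<open>g p\<close> is one.\<close>

lemma cokernel_cancel:
  assumes ob: "a \<in> Obj A" "e \<in> Obj A" "b \<in> Obj A" "w \<in> Obj A"
    and cok: "is_cokernel A a e b i p"
    and g: "g \<in> Hom A b w" "g' \<in> Hom A b w" "comp A e b w g p = comp A e b w g' p"
  shows "g = g'"
proof -
  have ip: "i \<in> Hom A a e" "p \<in> Hom A e b" "comp A a e b p i = hzero A a b"
    using cok by (auto simp: is_cokernel_def)
  have "comp A a e w (comp A e b w g p) i = hzero A a w"
    using comp_assoc[of a e b w i p g] comp_zero_right[of a b w g] ob g ip by simp
  moreover have "comp A e b w g p \<in> Hom A e w"
    using comp_in_Hom[of e b w] ob g ip by simp
  ultimately have "\<exists>!h. h \<in> Hom A b w \<and> comp A e b w h p = comp A e b w g p"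
    using cok ob unfolding is_cokernel_def by simp
  with g show ?thesis by metis
qed

lemma kernel_cancel:
  assumes ob: "a \<in> Obj A" "e \<in> Obj A" "b \<in> Obj A" "w \<in> Obj A"
    and ker: "is_kernel A a e b i p"
    and g: "g \<in> Hom A w a" "g' \<in> Hom A w a" "comp A w a e i g = comp A w a e i g'"
  shows "g = g'"
proof -
  have ip: "i \<in> Hom A a e" "p \<in> Hom A e b" "comp A a e b p i = hzero A a b"
    using ker by (auto simp: is_kernel_def)
  have "comp A w e b p (comp A w a e i g) = hzero A w b"
    using comp_assoc[of w a e b g i p] comp_zero_left[of w a b g] ob g ip by simp
  moreover have "comp A w a e i g \<in> Hom A w e"
    using comp_in_Hom[of w a e] ob g ip by simp
  ultimately have "\<exists>!h. h \<in> Hom A w a \<and> comp A w a e i h = comp A w a e i g"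
    using ker ob unfolding is_kernel_def by simp
  with g show ?thesis by metis
qed

text \<open>The map \<open>1 - i q\<close> vanishes on \<open>i\<close>, hence is \<open>s p\<close> for some \<open>s\<close>. Then \<open>p s p = p - p i q = p\<close>, and
  \<open>p\<close> can be cancelled.\<close>

lemma cokernel_retraction_split:
  assumes ob: "a \<in> Obj A" "e \<in> Obj A" "b \<in> Obj A"
    and cok: "is_cokernel A a e b i p"
    and q: "q \<in> Hom A e a" and qi: "comp A a e a q i = ident A a"
  shows "\<exists>s \<in> Hom A b e. comp A b e b p s = ident A b"
proof -
  have i: "i \<in> Hom A a e" and p: "p \<in> Hom A e b" and pi: "comp A a e b p i = hzero A a b"
    and univ: "\<And>w f. w \<in> Obj A \<Longrightarrow> f \<in> Hom A e w \<Longrightarrow> comp A a e w f i = hzero A a w \<Longrightarrow>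
      \<exists>!g. g \<in> Hom A b w \<and> comp A e b w g p = f"
    using cok unfolding is_cokernel_def by blast+
  define iq where "iq = comp A e a e i q"
  define u where "u = ident A e \<otimes>\<^bsub>hgrp A e e\<^esub> inv\<^bsub>hgrp A e e\<^esub> iq"
  note [simp] = ob i p q ident_in_Hom hinv_in_Hom hzero_in_Hom comp_in_Hom comp_ident_left
    comp_ident_right
  have iq: "iq \<in> Hom A e e" by (simp add: iq_def comp_in_Hom[of e a e])
  have u: "u \<in> Hom A e e" by (simp add: u_def hadd_in_Hom iq)
  have iqi: "comp A a e e iq i = i"
    using comp_assoc[of a e a e i q i] by (simp add: iq_def qi)
  have "comp A a e e u i = i \<otimes>\<^bsub>hgrp A a e\<^esub> inv\<^bsub>hgrp A a e\<^esub> i"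
    by (simp add: u_def comp_add_left comp_inv_left iqi iq)
  then have "comp A a e e u i = hzero A a e" by (simp add: hadd_inv)
  then obtain s where s: "s \<in> Hom A b e" "comp A e b e s p = u"
    using univ[of e u] u ob by blast
  have "comp A e e b p iq = hzero A e b"
    using comp_assoc[of e a e b q i p] by (simp add: iq_def pi comp_zero_left)
  then have pu: "comp A e e b p u = p"
    by (simp add: u_def comp_add_right comp_inv_right iq hinv_zero hadd_zero)
  have "comp A e b b (comp A b e b p s) p = p"
    using comp_assoc[of e b e b p s p] s pu by simp
  moreover have "comp A e b b (ident A b) p = p" by simp
  moreover have "comp A b e b p s \<in> Hom A b b" using s by (simp add: comp_in_Hom[of b e b])
  ultimately have "comp A b e b p s = ident A b"
    using ob cok by - (rule cokernel_cancel[of a e b b i p], simp_all)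
  with s show ?thesis by blast
qed

text \<open>The map \<open>1 - s p\<close> is killed by \<open>p\<close>, hence is \<open>i q\<close> for some \<open>q\<close>. The remaining equations follow by
  cancelling \<open>i\<close>.\<close>

lemma kernel_section_biproduct:
  assumes ob: "a \<in> Obj A" "e \<in> Obj A" "b \<in> Obj A"
    and ker: "is_kernel A a e b i p"
    and s: "s \<in> Hom A b e" and ps: "comp A b e b p s = ident A b"
  obtains q where "q \<in> Hom A e a" "comp A a e a q i = ident A a" "comp A b e a q s = hzero A b a"
    "comp A e a e i q \<otimes>\<^bsub>hgrp A e e\<^esub> comp A e b e s p = ident A e"
proof -
  have i: "i \<in> Hom A a e" and p: "p \<in> Hom A e b" and pi: "comp A a e b p i = hzero A a b"
    and univ: "\<And>w f. w \<in> Obj A \<Longrightarrow> f \<in> Hom A w e \<Longrightarrow> comp A w e b p f = hzero A w b \<Longrightarrow>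
      \<exists>!g. g \<in> Hom A w a \<and> comp A w a e i g = f"
    using ker unfolding is_kernel_def by blast+
  define sp where "sp = comp A e b e s p"
  define u where "u = ident A e \<otimes>\<^bsub>hgrp A e e\<^esub> inv\<^bsub>hgrp A e e\<^esub> sp"
  note [simp] = ob i p s ident_in_Hom hinv_in_Hom hzero_in_Hom comp_ident_left comp_ident_right
  have sp: "sp \<in> Hom A e e" by (simp add: sp_def comp_in_Hom[of e b e])
  have u: "u \<in> Hom A e e" by (simp add: u_def hadd_in_Hom sp)
  have "comp A e e b p sp = p"
    using comp_assoc[of e b e b p s p] by (simp add: sp_def ps)
  then have pu: "comp A e e b p u = hzero A e b"
    by (simp add: u_def comp_add_right comp_inv_right sp hadd_inv)
  then obtain q where q: "q \<in> Hom A e a" "comp A e a e i q = u"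
    using univ[of e u] u ob by blast
  have "comp A a e e sp i = hzero A a e"
    using comp_assoc[of a e b e i p s] by (simp add: sp_def pi comp_zero_right)
  then have ui: "comp A a e e u i = i"
    by (simp add: u_def comp_add_left comp_inv_left sp hinv_zero hadd_zero)
  have "comp A a a e i (comp A a e a q i) = i"
    using comp_assoc[of a e a e i q i] q ui by simp
  moreover have "comp A a e a q i \<in> Hom A a a" using q by (simp add: comp_in_Hom[of a e a])
  ultimately have qi: "comp A a e a q i = ident A a"
    using ob ker by - (rule kernel_cancel[of a e b a i p], simp_all)
  have "comp A b e e sp s = s"
    using comp_assoc[of b e b e s p s] by (simp add: sp_def ps)
  then have us: "comp A b e e u s = hzero A b e"
    by (simp add: u_def comp_add_left comp_inv_left sp hadd_inv)
  have "comp A b a e i (comp A b e a q s) = hzero A b e"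
    using comp_assoc[of b e a e s q i] q us by simp
  moreover have "comp A b a e i (hzero A b a) = hzero A b e"
    by (simp add: comp_zero_right)
  moreover have "comp A b e a q s \<in> Hom A b a" using q by (simp add: comp_in_Hom[of b e a])
  ultimately have qs: "comp A b e a q s = hzero A b a"
    using ob ker by - (rule kernel_cancel[of a e b b i p], simp_all)
  have "u \<otimes>\<^bsub>hgrp A e e\<^esub> sp = ident A e"
    by (simp add: u_def hadd_assoc sp hadd_inv_left hadd_zero)
  with q qi qs that show ?thesis by (simp add: sp_def)
qed

text \<open>Maps between objects that carry biproduct data for \<open>a\<close> and \<open>b\<close>, and that are the identity on both
  summands, compose to maps of the same form. The comparison map of two split extensions and its
  inverse are of this form.\<close>

lemma biproduct_comp:
  assumes ob: "a \<in> Obj A" "e \<in> Obj A" "b \<in> Obj A" "e' \<in> Obj A" "e'' \<in> Obj A"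
    and m: "i' \<in> Hom A a e'" "s' \<in> Hom A b e'" "q \<in> Hom A e a" "p \<in> Hom A e b"
      "i'' \<in> Hom A a e''" "s'' \<in> Hom A b e''" "q' \<in> Hom A e' a" "p' \<in> Hom A e' b"
    and eqs: "comp A a e' a q' i' = ident A a" "comp A b e' a q' s' = hzero A b a"
      "comp A a e' b p' i' = hzero A a b" "comp A b e' b p' s' = ident A b"
  shows "comp A e e' e'' (comp A e' a e'' i'' q' \<otimes>\<^bsub>hgrp A e' e''\<^esub> comp A e' b e'' s'' p')
      (comp A e a e' i' q \<otimes>\<^bsub>hgrp A e e'\<^esub> comp A e b e' s' p)
    = comp A e a e'' i'' q \<otimes>\<^bsub>hgrp A e e''\<^esub> comp A e b e'' s'' p"
proof -
  note [simp] = ob m ident_in_Hom hzero_in_Hom comp_ident_left comp_ident_right comp_in_Hom hadd_in_Hom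
  define f where "f = comp A e a e' i' q \<otimes>\<^bsub>hgrp A e e'\<^esub> comp A e b e' s' p"
  have iq: "comp A e a e' i' q \<in> Hom A e e'" by (rule comp_in_Hom[of e a e']) simp_all
  have sp: "comp A e b e' s' p \<in> Hom A e e'" by (rule comp_in_Hom[of e b e']) simp_all
  have f: "f \<in> Hom A e e'" by (simp add: f_def iq sp)
  have "comp A e e' a q' (comp A e a e' i' q) = q"
    using comp_assoc[of e a e' a q i' q'] by (simp add: eqs)
  moreover have "comp A e e' a q' (comp A e b e' s' p) = hzero A e a"
    using comp_assoc[of e b e' a p s' q'] by (simp add: eqs comp_zero_left)
  ultimately have q'f: "comp A e e' a q' f = q"
    by (simp add: f_def comp_add_right iq sp hadd_zero)
  have "comp A e e' b p' (comp A e a e' i' q) = hzero A e b"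
    using comp_assoc[of e a e' b q i' p'] by (simp add: eqs comp_zero_left)
  moreover have "comp A e e' b p' (comp A e b e' s' p) = p"
    using comp_assoc[of e b e' b p s' p'] by (simp add: eqs)
  ultimately have p'f: "comp A e e' b p' f = p"
    by (simp add: f_def comp_add_right iq sp hadd_zero_left)
  have "comp A e' a e'' i'' q' \<in> Hom A e' e''" by (rule comp_in_Hom[of e' a e'']) simp_all
  moreover have "comp A e' b e'' s'' p' \<in> Hom A e' e''" by (rule comp_in_Hom[of e' b e'']) simp_all
  moreover have "comp A e e' e'' (comp A e' a e'' i'' q') f = comp A e a e'' i'' q"
    using comp_assoc[of e e' a e'' f q' i''] f by (simp add: q'f)
  moreover have "comp A e e' e'' (comp A e' b e'' s'' p') f = comp A e b e'' s'' p"
    using comp_assoc[of e e' b e'' f p' s''] f by (simp add: p'f)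
  ultimately show ?thesis
    using f by (simp add: comp_add_left flip: f_def)
qed

text \<open>Both middle terms are biproducts of \<open>a\<close> and \<open>b\<close>, and \<open>i' q + s' p\<close> compares them.\<close>

lemma split_extensions_equivalent:
  assumes ob: "a \<in> Obj A" "b \<in> Obj A"
    and x: "(e, i, p) \<in> extensions A b a" and s: "s \<in> Hom A b e" "comp A b e b p s = ident A b"
    and x': "(e', i', p') \<in> extensions A b a"
    and s': "s' \<in> Hom A b e'" "comp A b e' b p' s' = ident A b"
  shows "((e, i, p), (e', i', p')) \<in> extension_equiv A b a"
proof -
  have e: "e \<in> Obj A" "is_kernel A a e b i p" and e': "e' \<in> Obj A" "is_kernel A a e' b i' p'"
    using x x' by (auto simp: extensions_def)
  have ip: "i \<in> Hom A a e" "p \<in> Hom A e b" "comp A a e b p i = hzero A a b"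
    "i' \<in> Hom A a e'" "p' \<in> Hom A e' b" "comp A a e' b p' i' = hzero A a b"
    using e(2) e'(2) by (auto simp: is_kernel_def)
  obtain q where q: "q \<in> Hom A e a" "comp A a e a q i = ident A a" "comp A b e a q s = hzero A b a"
    "comp A e a e i q \<otimes>\<^bsub>hgrp A e e\<^esub> comp A e b e s p = ident A e"
    using kernel_section_biproduct[OF ob(1) e(1) ob(2) e(2) s] by blast
  obtain q' where q': "q' \<in> Hom A e' a" "comp A a e' a q' i' = ident A a"
    "comp A b e' a q' s' = hzero A b a"
    "comp A e' a e' i' q' \<otimes>\<^bsub>hgrp A e' e'\<^esub> comp A e' b e' s' p' = ident A e'"
    using kernel_section_biproduct[OF ob(1) e'(1) ob(2) e'(2) s'] by blast
  define \<phi> where "\<phi> = comp A e a e' i' q \<otimes>\<^bsub>hgrp A e e'\<^esub> comp A e b e' s' p"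
  define \<psi> where "\<psi> = comp A e' a e i q' \<otimes>\<^bsub>hgrp A e' e\<^esub> comp A e' b e s p'"
  note [simp] = ob e(1) e'(1) ip s s' q q' ident_in_Hom hzero_in_Hom comp_ident_left
    comp_ident_right
  have iq: "comp A e a e' i' q \<in> Hom A e e'" by (rule comp_in_Hom[of e a e']) simp_all
  have sp: "comp A e b e' s' p \<in> Hom A e e'" by (rule comp_in_Hom[of e b e']) simp_all
  have \<phi>: "\<phi> \<in> Hom A e e'" by (simp add: \<phi>_def hadd_in_Hom iq sp)
  have \<psi>: "\<psi> \<in> Hom A e' e" unfolding \<psi>_def
    by (intro hadd_in_Hom comp_in_Hom[of e' a e] comp_in_Hom[of e' b e]) simp_all
  have "comp A e e' e \<psi> \<phi> = ident A e"
    unfolding \<psi>_def \<phi>_def by (subst biproduct_comp) simp_all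
  moreover have "comp A e' e e' \<phi> \<psi> = ident A e'"
    unfolding \<psi>_def \<phi>_def by (subst biproduct_comp) simp_all
  ultimately have "is_iso A e e' \<phi>"
    using \<phi> \<psi> by (auto simp: is_iso_def)
  moreover have "comp A a e e' \<phi> i = i'"
  proof -
    have "comp A a e e' (comp A e a e' i' q) i = i'"
      using comp_assoc[of a e a e' i q i'] by simp
    moreover have "comp A a e e' (comp A e b e' s' p) i = hzero A a e'"
      using comp_assoc[of a e b e' i p s'] by (simp add: comp_zero_right)
    ultimately show ?thesis
      by (simp add: \<phi>_def comp_add_left iq sp hadd_zero)
  qed
  moreover have "comp A e e' b p' \<phi> = p"
  proof -
    have "comp A e e' b p' (comp A e a e' i' q) = hzero A e b"
      using comp_assoc[of e a e' b q i' p'] by (simp add: comp_zero_left)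
    moreover have "comp A e e' b p' (comp A e b e' s' p) = p"
      using comp_assoc[of e b e' b p s' p'] by simp
    ultimately show ?thesis
      by (simp add: \<phi>_def comp_add_right iq sp hadd_zero_left)
  qed
  ultimately show ?thesis
    using x x' by (auto simp: extension_equiv_def)
qed

text \<open>Each extension lies in its own class, so it is split if the class of the split extensions is the
  only one; conversely all split extensions are equivalent to each other.\<close>

lemma Ext1_trivial_iff:
  assumes ob: "a \<in> Obj A" "b \<in> Obj A"
  shows "Ext1 A b a = {Ext1_zero A b a} \<longleftrightarrow> extensions A b a \<noteq> {} \<and>
    (\<forall>(e, i, p) \<in> extensions A b a. \<exists>s \<in> Hom A b e. comp A b e b p s = ident A b)"
    (is "?l \<longleftrightarrow> ?ne \<and> ?split")
proof
  assume l: ?l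
  have "?split"
  proof clarify
    fix e i p assume x: "(e, i, p) \<in> extensions A b a"
    then have e: "e \<in> Obj A" "i \<in> Hom A a e" "p \<in> Hom A e b"
      by (auto simp: extensions_def is_kernel_def)
    have "((e, i, p), (e, i, p)) \<in> extension_equiv A b a"
      using x e ob by (auto simp: extension_equiv_def is_iso_def
          intro!: exI[of _ "ident A e"] bexI[of _ "ident A e"]
          simp: ident_in_Hom comp_ident_left comp_ident_right)
    then have "(e, i, p) \<in> extension_equiv A b a `` {(e, i, p)}" by blast
    moreover have "extension_equiv A b a `` {(e, i, p)} \<in> Ext1 A b a"
      using x unfolding Ext1_def by (rule quotientI)
    ultimately have "(e, i, p) \<in> Ext1_zero A b a"
      unfolding l singleton_iff by (simp only:)
    then show "\<exists>s \<in> Hom A b e. comp A b e b p s = ident A b"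
      by (auto simp: Ext1_zero_def)
  qed
  moreover have ?ne using l by (auto simp: Ext1_def quotient_def)
  ultimately show "?ne \<and> ?split" by blast
next
  assume r: "?ne \<and> ?split"
  have "extension_equiv A b a `` {x} = Ext1_zero A b a" if x: "x \<in> extensions A b a" for x
  proof -
    have "(x, y) \<in> extension_equiv A b a" if y: "y \<in> extensions A b a" for y
    proof -
      obtain e i p where xe: "x = (e, i, p)" by (cases x)
      obtain e' i' p' where ye: "y = (e', i', p')" by (cases y)
      obtain s where s: "s \<in> Hom A b e" "comp A b e b p s = ident A b"
        using r x unfolding xe by fastforce
      obtain s' where s': "s' \<in> Hom A b e'" "comp A b e' b p' s' = ident A b"
        using r y unfolding ye by fastforce
      show ?thesis
        using split_extensions_equivalent[OF ob _ s _ s'] x y unfolding xe ye by simp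
    qed
    moreover have "Ext1_zero A b a = extensions A b a"
      using r by (auto simp: Ext1_zero_def)
    moreover have "extension_equiv A b a `` {x} \<subseteq> extensions A b a"
      by (auto simp: extension_equiv_def)
    ultimately show ?thesis by blast
  qed
  with r show ?l by (auto simp: Ext1_def quotient_def)
qed

end

section \<open>Modules over a preadditive category\<close>

text \<open>Right modules, written out on elements. There is no universe here, and the carriers may lie in any
  type, so that representable modules, products and modules before their transport into the universe
  are covered.\<close>

locale amodule = preadditive A
  for A :: "('o, 'a, 'z) preadditive_scheme" +
  fixes F :: "('o, 'a, 'p monoid, 'p \<Rightarrow> 'p) cfunctor"
  assumes comm_grp: "x \<in> Obj A \<Longrightarrow> comm_group (FObj F x)"
    and act_maps: "\<lbrakk>x \<in> Obj A; y \<in> Obj A; f \<in> Hom A y x\<rbrakk>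
      \<Longrightarrow> FArr F x y f \<in> group_maps (FObj F x) (FObj F y)"
    and act_ident: "\<lbrakk>x \<in> Obj A; m \<in> carrier (FObj F x)\<rbrakk> \<Longrightarrow> FArr F x x (ident A x) m = m"
    and act_comp: "\<lbrakk>x \<in> Obj A; y \<in> Obj A; z \<in> Obj A; f \<in> Hom A y x; g \<in> Hom A z y;
        m \<in> carrier (FObj F x)\<rbrakk>
      \<Longrightarrow> FArr F x z (comp A z y x f g) m = FArr F y z g (FArr F x y f m)"
    and act_add: "\<lbrakk>x \<in> Obj A; y \<in> Obj A; f \<in> Hom A y x; g \<in> Hom A y x; m \<in> carrier (FObj F x)\<rbrakk>
      \<Longrightarrow> FArr F x y (f \<otimes>\<^bsub>hgrp A y x\<^esub> g) m = FArr F x y f m \<otimes>\<^bsub>FObj F y\<^esub> FArr F x y g m"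
begin

lemma grp: "x \<in> Obj A \<Longrightarrow> group (FObj F x)"
  using comm_grp comm_group.axioms(2) by blast

lemma act_group_hom: "\<lbrakk>x \<in> Obj A; y \<in> Obj A; f \<in> Hom A y x\<rbrakk>
    \<Longrightarrow> group_hom (FObj F x) (FObj F y) (FArr F x y f)"
  using act_maps grp by (simp add: group_hom_def group_hom_axioms_def group_maps_def)

lemma act_closed: "\<lbrakk>x \<in> Obj A; y \<in> Obj A; f \<in> Hom A y x; m \<in> carrier (FObj F x)\<rbrakk>
    \<Longrightarrow> FArr F x y f m \<in> carrier (FObj F y)"
  using group_hom.hom_closed[OF act_group_hom] by blast

lemma act_mult: "\<lbrakk>x \<in> Obj A; y \<in> Obj A; f \<in> Hom A y x; m \<in> carrier (FObj F x);
    n \<in> carrier (FObj F x)\<rbrakk>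
    \<Longrightarrow> FArr F x y f (m \<otimes>\<^bsub>FObj F x\<^esub> n) = FArr F x y f m \<otimes>\<^bsub>FObj F y\<^esub> FArr F x y f n"
  using group_hom.hom_mult[OF act_group_hom] by blast

lemma act_one: "\<lbrakk>x \<in> Obj A; y \<in> Obj A; f \<in> Hom A y x\<rbrakk>
    \<Longrightarrow> FArr F x y f \<one>\<^bsub>FObj F x\<^esub> = \<one>\<^bsub>FObj F y\<^esub>"
  using group_hom.hom_one[OF act_group_hom] by blast

lemma act_inv: "\<lbrakk>x \<in> Obj A; y \<in> Obj A; f \<in> Hom A y x; m \<in> carrier (FObj F x)\<rbrakk>
    \<Longrightarrow> FArr F x y f (inv\<^bsub>FObj F x\<^esub> m) = inv\<^bsub>FObj F y\<^esub> FArr F x y f m"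
  using group_hom.hom_inv[OF act_group_hom] by blast

lemma act_on_hom:
  assumes "x \<in> Obj A" "y \<in> Obj A" "m \<in> carrier (FObj F x)"
  shows "group_hom (hgrp A y x) (FObj F y) (\<lambda>f. FArr F x y f m)"
  using assms by (intro group_hom.intro group_hom_axioms.intro homI hgrp_group grp)
    (simp_all add: carrier_hgrp act_closed act_add)

lemma act_extensional: "\<lbrakk>x \<in> Obj A; y \<in> Obj A; f \<in> Hom A y x\<rbrakk>
    \<Longrightarrow> FArr F x y f \<in> extensional (carrier (FObj F x))"
  using act_maps by (simp add: group_maps_def)

end

lemma ModCat_simps:
  "Hom (ModCat U A) = module_maps A"
  "ident (ModCat U A) = (\<lambda>F. \<lambda>x \<in> Obj A. \<lambda>m \<in> carrier (FObj F x). m)"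
  "comp (ModCat U A) =
    (\<lambda>F G H \<theta> \<eta>. \<lambda>x \<in> Obj A. compose (carrier (FObj F x)) (\<theta> x) (\<eta> x))"
  "carrier (hgrp (ModCat U A) F G) = module_maps A F G"
  "\<eta> \<otimes>\<^bsub>hgrp (ModCat U A) F G\<^esub> \<theta> =
    (\<lambda>x \<in> Obj A. \<lambda>m \<in> carrier (FObj F x). \<eta> x m \<otimes>\<^bsub>FObj G x\<^esub> \<theta> x m)"
  "hzero (ModCat U A) F G = (\<lambda>x \<in> Obj A. \<lambda>m \<in> carrier (FObj F x). \<one>\<^bsub>FObj G x\<^esub>)"
  "\<one>\<^bsub>hgrp (ModCat U A) F G\<^esub> = (\<lambda>x \<in> Obj A. \<lambda>m \<in> carrier (FObj F x). \<one>\<^bsub>FObj G x\<^esub>)"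
  by (simp_all add: ModCat_def hzero_def)

lemma Ab_simps:
  "Obj (Ab U) = {G. comm_group G \<and> carrier G \<in> U}"
  "Hom (Ab U) = group_maps"
  "ident (Ab U) = (\<lambda>G. \<lambda>a \<in> carrier G. a)"
  "comp (Ab U) = (\<lambda>G H L g f. compose (carrier G) g f)"
  "carrier (hgrp (Ab U) G H) = group_maps G H"
  "mult (hgrp (Ab U) G H) = (\<lambda>f g. \<lambda>a \<in> carrier G. f a \<otimes>\<^bsub>H\<^esub> g a)"
  by (simp_all add: Ab_def)

lemma opp_preadditive_simps:
  "Obj (opp_preadditive A) = Obj A"
  "Hom (opp_preadditive A) = (\<lambda>x y. Hom A y x)"
  "ident (opp_preadditive A) = ident A"
  "comp (opp_preadditive A) = (\<lambda>x y z g f. comp A z y x f g)"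
  "hgrp (opp_preadditive A) = (\<lambda>x y. hgrp A y x)"
  by (simp_all add: opp_preadditive_def opp_def)

lemma (in preadditive) Obj_ModCat_iff:
  "F \<in> Obj (ModCat U A) \<longleftrightarrow> amodule A F \<and> (\<forall>x \<in> Obj A. carrier (FObj F x) \<in> U)"
proof
  assume "F \<in> Obj (ModCat U A)"
  then interpret F: additive_functor "opp_preadditive A" "Ab U" F
    by (simp add: ModCat_def)
  note simps = Ab_simps opp_preadditive_simps
  have "FArr F x x (ident A x) m = m" if "x \<in> Obj A" "m \<in> carrier (FObj F x)" for x m
    using F.FArr_ident[of x] that by (simp add: simps)
  moreover have "FArr F x z (comp A z y x f g) m = FArr F y z g (FArr F x y f m)"
    if "x \<in> Obj A" "y \<in> Obj A" "z \<in> Obj A" "f \<in> Hom A y x" "g \<in> Hom A z y"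
      "m \<in> carrier (FObj F x)" for x y z f g m
    using F.FArr_comp[of x y z f g] that by (simp add: simps compose_def)
  moreover have "FArr F x y (f \<otimes>\<^bsub>hgrp A y x\<^esub> g) m = FArr F x y f m \<otimes>\<^bsub>FObj F y\<^esub> FArr F x y g m"
    if "x \<in> Obj A" "y \<in> Obj A" "f \<in> Hom A y x" "g \<in> Hom A y x" "m \<in> carrier (FObj F x)"
    for x y f g m
    using hom_mult[OF F.FArr_hom[of x y], of f g] that by (simp add: simps carrier_hgrp)
  moreover have "FArr F x y f \<in> group_maps (FObj F x) (FObj F y)"
    if "x \<in> Obj A" "y \<in> Obj A" "f \<in> Hom A y x" for x y f
    using F.FArr_in_Hom[of x y f] that by (simp add: simps)
  moreover have "comm_group (FObj F x) \<and> carrier (FObj F x) \<in> U" if "x \<in> Obj A" for x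
    using F.FObj_in_Obj[of x] that by (simp add: simps)
  ultimately show "amodule A F \<and> (\<forall>x \<in> Obj A. carrier (FObj F x) \<in> U)"
    by (auto simp: amodule_def amodule_axioms_def preadditive_axioms)
next
  assume *: "amodule A F \<and> (\<forall>x \<in> Obj A. carrier (FObj F x) \<in> U)"
  then interpret amodule A F by blast
  note ext = extensionalityI[of _ "carrier (FObj F x)" for x]
  have "additive_functor (opp_preadditive A) (Ab U) F"
  proof (unfold_locales; unfold Ab_simps opp_preadditive_simps)
    fix x assume x: "x \<in> Obj A"
    show "FObj F x \<in> {G. comm_group G \<and> carrier G \<in> U}" using * comm_grp x by blast
    show "FArr F x x (ident A x) = (\<lambda>a \<in> carrier (FObj F x). a)"
      by (rule ext) (use x act_extensional ident_in_Hom act_ident in auto)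
  next
    fix x y assume xy: "x \<in> Obj A" "y \<in> Obj A"
    show "FArr F x y \<in> hom (hgrp A y x) (hgrp (Ab U) (FObj F x) (FObj F y))"
    proof (rule homI)
      fix f g assume "f \<in> carrier (hgrp A y x)" "g \<in> carrier (hgrp A y x)"
      then have fg: "f \<in> Hom A y x" "g \<in> Hom A y x" using carrier_hgrp xy by auto
      show "FArr F x y f \<in> carrier (hgrp (Ab U) (FObj F x) (FObj F y))"
        using act_maps xy fg by (simp add: Ab_simps)
      show "FArr F x y (f \<otimes>\<^bsub>hgrp A y x\<^esub> g)
          = FArr F x y f \<otimes>\<^bsub>hgrp (Ab U) (FObj F x) (FObj F y)\<^esub> FArr F x y g"
        unfolding Ab_simps
        by (rule ext) (use xy fg act_extensional hadd_in_Hom act_add in auto)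
    qed
    fix f assume f: "f \<in> Hom A y x"
    show "FArr F x y f \<in> group_maps (FObj F x) (FObj F y)" using act_maps xy f by blast
    fix z g assume z: "z \<in> Obj A" and g: "g \<in> Hom A z y"
    show "FArr F x z (comp A z y x f g)
        = compose (carrier (FObj F x)) (FArr F y z g) (FArr F x y f)"
      by (rule ext[of _ x])
        (use xy z f g act_extensional comp_in_Hom act_comp in \<open>auto simp: compose_def\<close>)
  qed
  then show "F \<in> Obj (ModCat U A)" by (simp add: ModCat_def)
qed

lemma module_mapsI:
  assumes "\<eta> \<in> extensional (Obj A)"
    and "\<And>x. x \<in> Obj A \<Longrightarrow> \<eta> x \<in> extensional (carrier (FObj F x))"
    and "\<And>x m. x \<in> Obj A \<Longrightarrow> m \<in> carrier (FObj F x) \<Longrightarrow> \<eta> x m \<in> carrier (FObj G x)"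
    and "\<And>x m n. x \<in> Obj A \<Longrightarrow> m \<in> carrier (FObj F x) \<Longrightarrow> n \<in> carrier (FObj F x) \<Longrightarrow>
      \<eta> x (m \<otimes>\<^bsub>FObj F x\<^esub> n) = \<eta> x m \<otimes>\<^bsub>FObj G x\<^esub> \<eta> x n"
    and "\<And>x y f m. x \<in> Obj A \<Longrightarrow> y \<in> Obj A \<Longrightarrow> f \<in> Hom A y x \<Longrightarrow> m \<in> carrier (FObj F x) \<Longrightarrow>
      \<eta> y (FArr F x y f m) = FArr G x y f (\<eta> x m)"
  shows "\<eta> \<in> module_maps A F G"
  using assms by (auto simp: module_maps_def group_maps_def intro!: PiE_I homI)
    (auto simp: extensional_def)

lemma module_mapsD:
  assumes "\<eta> \<in> module_maps A F G"
  shows module_maps_extensional: "\<eta> \<in> extensional (Obj A)"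
    and module_maps_group_maps: "x \<in> Obj A \<Longrightarrow> \<eta> x \<in> group_maps (FObj F x) (FObj G x)"
    and module_maps_closed: "x \<in> Obj A \<Longrightarrow> m \<in> carrier (FObj F x) \<Longrightarrow> \<eta> x m \<in> carrier (FObj G x)"
    and module_maps_mult: "x \<in> Obj A \<Longrightarrow> m \<in> carrier (FObj F x) \<Longrightarrow> n \<in> carrier (FObj F x) \<Longrightarrow>
      \<eta> x (m \<otimes>\<^bsub>FObj F x\<^esub> n) = \<eta> x m \<otimes>\<^bsub>FObj G x\<^esub> \<eta> x n"
    and module_maps_natural: "x \<in> Obj A \<Longrightarrow> y \<in> Obj A \<Longrightarrow> f \<in> Hom A y x \<Longrightarrow>
      m \<in> carrier (FObj F x) \<Longrightarrow> \<eta> y (FArr F x y f m) = FArr G x y f (\<eta> x m)"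
proof -
  show "\<eta> \<in> extensional (Obj A)" and gm: "x \<in> Obj A \<Longrightarrow> \<eta> x \<in> group_maps (FObj F x) (FObj G x)"
    and "x \<in> Obj A \<Longrightarrow> y \<in> Obj A \<Longrightarrow> f \<in> Hom A y x \<Longrightarrow>
      m \<in> carrier (FObj F x) \<Longrightarrow> \<eta> y (FArr F x y f m) = FArr G x y f (\<eta> x m)"
    using assms by (auto simp: module_maps_def PiE_def)
  show "x \<in> Obj A \<Longrightarrow> m \<in> carrier (FObj F x) \<Longrightarrow> \<eta> x m \<in> carrier (FObj G x)"
    "x \<in> Obj A \<Longrightarrow> m \<in> carrier (FObj F x) \<Longrightarrow> n \<in> carrier (FObj F x) \<Longrightarrow>
      \<eta> x (m \<otimes>\<^bsub>FObj F x\<^esub> n) = \<eta> x m \<otimes>\<^bsub>FObj G x\<^esub> \<eta> x n"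
    using gm by (auto simp: group_maps_def hom_def)
qed

lemma module_maps_group_hom:
  assumes "\<eta> \<in> module_maps A F G" "amodule A F" "amodule A G" "x \<in> Obj A"
  shows "group_hom (FObj F x) (FObj G x) (\<eta> x)"
  using module_maps_group_maps[OF assms(1,4)] amodule.grp[OF assms(2,4)] amodule.grp[OF assms(3,4)]
  by (simp add: group_hom_def group_hom_axioms_def group_maps_def)

lemma module_maps_eqI:
  assumes \<eta>: "\<eta> \<in> module_maps A F G" and \<theta>: "\<theta> \<in> module_maps A F H"
    and eq: "\<And>x m. x \<in> Obj A \<Longrightarrow> m \<in> carrier (FObj F x) \<Longrightarrow> \<eta> x m = \<theta> x m"
  shows "\<eta> = \<theta>"
proof (rule extensionalityI[OF module_maps_extensional[OF \<eta>] module_maps_extensional[OF \<theta>]])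
  fix x assume x: "x \<in> Obj A"
  have "\<eta> x \<in> extensional (carrier (FObj F x))" "\<theta> x \<in> extensional (carrier (FObj F x))"
    using module_maps_group_maps[OF \<eta> x] module_maps_group_maps[OF \<theta> x]
    by (auto simp: group_maps_def)
  then show "\<eta> x = \<theta> x" using eq x by (auto intro: extensionalityI)
qed

lemma module_maps_comp:
  assumes F: "amodule A F" and \<eta>: "\<eta> \<in> module_maps A F G" and \<theta>: "\<theta> \<in> module_maps A G H"
  shows "(\<lambda>x \<in> Obj A. compose (carrier (FObj F x)) (\<theta> x) (\<eta> x)) \<in> module_maps A F H"
proof (rule module_mapsI)
  fix x y f m assume xy: "x \<in> Obj A" "y \<in> Obj A" "f \<in> Hom A y x" "m \<in> carrier (FObj F x)"
  then show "(\<lambda>x \<in> Obj A. compose (carrier (FObj F x)) (\<theta> x) (\<eta> x)) y (FArr F x y f m)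
      = FArr H x y f ((\<lambda>x \<in> Obj A. compose (carrier (FObj F x)) (\<theta> x) (\<eta> x)) x m)"
    using amodule.act_closed[OF F xy]
    by (simp add: compose_def module_maps_natural[OF \<eta>] module_maps_natural[OF \<theta>]
        module_maps_closed[OF \<eta>])
next
  fix x m n assume x: "x \<in> Obj A" "m \<in> carrier (FObj F x)" "n \<in> carrier (FObj F x)"
  interpret group "FObj F x" using amodule.grp[OF F x(1)] .
  show "(\<lambda>x \<in> Obj A. compose (carrier (FObj F x)) (\<theta> x) (\<eta> x)) x (m \<otimes>\<^bsub>FObj F x\<^esub> n)
    = (\<lambda>x \<in> Obj A. compose (carrier (FObj F x)) (\<theta> x) (\<eta> x)) x m
      \<otimes>\<^bsub>FObj H x\<^esub> (\<lambda>x \<in> Obj A. compose (carrier (FObj F x)) (\<theta> x) (\<eta> x)) x n"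
    using x by (simp add: compose_def module_maps_mult[OF \<eta>] module_maps_mult[OF \<theta>]
        module_maps_closed[OF \<eta>])
qed (use module_maps_closed[OF \<eta>] module_maps_closed[OF \<theta>] in \<open>auto simp: compose_def\<close>)

lemma module_maps_ident:
  assumes F: "amodule A F"
  shows "(\<lambda>x \<in> Obj A. \<lambda>m \<in> carrier (FObj F x). m) \<in> module_maps A F F"
proof -
  interpret amodule A F by fact
  show ?thesis
    by (rule module_mapsI)
      (auto simp: act_closed monoid.m_closed[OF group.is_monoid[OF grp]])
qed

lemma module_maps_zero:
  assumes F: "amodule A F" and G: "amodule A G"
  shows "(\<lambda>x \<in> Obj A. \<lambda>m \<in> carrier (FObj F x). \<one>\<^bsub>FObj G x\<^esub>) \<in> module_maps A F G"
proof -
  interpret F: amodule A F by fact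
  interpret G: amodule A G by fact
  show ?thesis
    by (rule module_mapsI) (auto simp: F.act_closed G.act_one
        monoid.m_closed[OF group.is_monoid[OF F.grp]] group.is_monoid[OF G.grp])
qed

lemma module_maps_add:
  assumes F: "amodule A F" and G: "amodule A G"
    and \<eta>: "\<eta> \<in> module_maps A F G" and \<theta>: "\<theta> \<in> module_maps A F G"
  shows "(\<lambda>x \<in> Obj A. \<lambda>m \<in> carrier (FObj F x). \<eta> x m \<otimes>\<^bsub>FObj G x\<^esub> \<theta> x m) \<in> module_maps A F G"
proof -
  interpret F: amodule A F by fact
  interpret G: amodule A G by fact
  note closed = module_maps_closed[OF \<eta>] module_maps_closed[OF \<theta>]
  show ?thesis
  proof (rule module_mapsI)
    fix x m n assume x: "x \<in> Obj A" "m \<in> carrier (FObj F x)" "n \<in> carrier (FObj F x)"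
    interpret gF: group "FObj F x" using F.grp x(1) .
    interpret gG: comm_group "FObj G x" using G.comm_grp x(1) .
    show "(\<lambda>x \<in> Obj A. \<lambda>m \<in> carrier (FObj F x). \<eta> x m \<otimes>\<^bsub>FObj G x\<^esub> \<theta> x m) x (m \<otimes>\<^bsub>FObj F x\<^esub> n)
      = (\<lambda>x \<in> Obj A. \<lambda>m \<in> carrier (FObj F x). \<eta> x m \<otimes>\<^bsub>FObj G x\<^esub> \<theta> x m) x m
        \<otimes>\<^bsub>FObj G x\<^esub> (\<lambda>x \<in> Obj A. \<lambda>m \<in> carrier (FObj F x). \<eta> x m \<otimes>\<^bsub>FObj G x\<^esub> \<theta> x m) x n"
      using x closed by (simp add: module_maps_mult[OF \<eta>] module_maps_mult[OF \<theta>] gG.m_ac)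
  qed (auto simp: closed F.act_closed G.act_mult module_maps_natural[OF \<eta>]
      module_maps_natural[OF \<theta>] monoid.m_closed[OF group.is_monoid[OF G.grp]])
qed

lemma module_maps_inv:
  assumes F: "amodule A F" and G: "amodule A G" and \<eta>: "\<eta> \<in> module_maps A F G"
  shows "(\<lambda>x \<in> Obj A. \<lambda>m \<in> carrier (FObj F x). inv\<^bsub>FObj G x\<^esub> \<eta> x m) \<in> module_maps A F G"
proof -
  interpret F: amodule A F by fact
  interpret G: amodule A G by fact
  note closed = module_maps_closed[OF \<eta>]
  show ?thesis
    by (rule module_mapsI)
      (auto simp: closed F.act_closed G.act_inv module_maps_natural[OF \<eta>] module_maps_mult[OF \<eta>]
        monoid.m_closed[OF group.is_monoid[OF F.grp]] group.inv_closed[OF G.grp]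
        comm_group.inv_mult[OF G.comm_grp])
qed

lemma (in preadditive) preadditive_ModCat:
  fixes U :: "'m set set"
  shows "preadditive (ModCat U A)"
proof -
  have mod: "amodule A F" if "F \<in> Obj (ModCat U A)" for F
    using that Obj_ModCat_iff by blast
  let ?add = "\<lambda>F G \<eta> \<theta>. \<lambda>x \<in> Obj A. \<lambda>m \<in> carrier (FObj F x). \<eta> x m \<otimes>\<^bsub>FObj G x\<^esub> \<theta> x m"
  show ?thesis
  proof (intro preadditive.intro category.intro preadditive_axioms.intro; (unfold ModCat_simps)?)
    fix F :: "('o, 'a, 'm monoid, 'm \<Rightarrow> 'm) cfunctor"
    assume F: "F \<in> Obj (ModCat U A)"
    note mF = mod[OF F]
    show iF: "(\<lambda>x \<in> Obj A. \<lambda>m \<in> carrier (FObj F x). m) \<in> module_maps A F F"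
      using module_maps_ident mF .
    fix G :: "('o, 'a, 'm monoid, 'm \<Rightarrow> 'm) cfunctor"
    assume G: "G \<in> Obj (ModCat U A)"
    note mG = mod[OF G]
    have mult_G: "u \<otimes>\<^bsub>FObj G x\<^esub> v \<in> carrier (FObj G x)"
      if "x \<in> Obj A" "u \<in> carrier (FObj G x)" "v \<in> carrier (FObj G x)" for x u v
      using amodule.grp[OF mG that(1)] that by (simp add: group.is_monoid monoid.m_closed)
    show "comm_group (hgrp (ModCat U A) F G)"
    proof (rule comm_groupI; unfold ModCat_simps)
      show "(\<lambda>x \<in> Obj A. \<lambda>m \<in> carrier (FObj F x). \<one>\<^bsub>FObj G x\<^esub>) \<in> module_maps A F G"
        using module_maps_zero mF mG .
      fix \<eta> assume \<eta>: "\<eta> \<in> module_maps A F G"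
      show "?add F G (\<lambda>x \<in> Obj A. \<lambda>m \<in> carrier (FObj F x). \<one>\<^bsub>FObj G x\<^esub>) \<eta> = \<eta>"
        using module_maps_closed[OF \<eta>]
        by (intro module_maps_eqI[OF module_maps_add[OF mF mG module_maps_zero[OF mF mG] \<eta>] \<eta>])
          (simp add: group.is_monoid amodule.grp[OF mG])
      show "\<exists>\<theta> \<in> module_maps A F G. ?add F G \<theta> \<eta> = (\<lambda>x \<in> Obj A. \<lambda>m \<in> carrier (FObj F x). \<one>\<^bsub>FObj G x\<^esub>)"
        using module_maps_closed[OF \<eta>]
        by (intro bexI[OF _ module_maps_inv[OF mF mG \<eta>]] restrict_ext)
          (simp add: group.l_inv amodule.grp[OF mG])
      fix \<theta> assume \<theta>: "\<theta> \<in> module_maps A F G"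
      show "?add F G \<eta> \<theta> \<in> module_maps A F G"
        using module_maps_add mF mG \<eta> \<theta> .
      show "?add F G \<eta> \<theta> = ?add F G \<theta> \<eta>"
        using module_maps_closed[OF \<eta>] module_maps_closed[OF \<theta>] amodule.comm_grp[OF mG]
        by (intro restrict_ext) (simp add: comm_group_def comm_monoid.m_comm)
      fix \<zeta> assume \<zeta>: "\<zeta> \<in> module_maps A F G"
      show "?add F G (?add F G \<eta> \<theta>) \<zeta> = ?add F G \<eta> (?add F G \<theta> \<zeta>)"
        using module_maps_closed[OF \<eta>] module_maps_closed[OF \<theta>] module_maps_closed[OF \<zeta>]
          amodule.grp[OF mG]
        by (intro restrict_ext) (simp add: group.is_monoid monoid.m_assoc)
    qed
    show "module_maps A F G = module_maps A F G" ..
    fix \<eta> assume \<eta>: "\<eta> \<in> module_maps A F G"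
    have iG: "(\<lambda>x \<in> Obj A. \<lambda>m \<in> carrier (FObj G x). m) \<in> module_maps A G G"
      using module_maps_ident mG .
    show "(\<lambda>x \<in> Obj A. compose (carrier (FObj F x)) ((\<lambda>x \<in> Obj A. \<lambda>m \<in> carrier (FObj G x). m) x) (\<eta> x)) = \<eta>"
      using module_maps_closed[OF \<eta>]
      by (intro module_maps_eqI[OF module_maps_comp[OF mF \<eta> iG] \<eta>]) (simp add: compose_def)
    show "(\<lambda>x \<in> Obj A. compose (carrier (FObj F x)) (\<eta> x) ((\<lambda>x \<in> Obj A. \<lambda>m \<in> carrier (FObj F x). m) x)) = \<eta>"
      by (intro module_maps_eqI[OF module_maps_comp[OF mF iF \<eta>] \<eta>]) (simp add: compose_def)
    fix H :: "('o, 'a, 'm monoid, 'm \<Rightarrow> 'm) cfunctor"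
    assume H: "H \<in> Obj (ModCat U A)"
    note mH = mod[OF H]
    fix \<theta> assume \<theta>: "\<theta> \<in> module_maps A G H"
    show "(\<lambda>x \<in> Obj A. compose (carrier (FObj F x)) (\<theta> x) (\<eta> x)) \<in> module_maps A F H"
      using module_maps_comp mF \<eta> \<theta> .
    {
      fix L :: "('o, 'a, 'm monoid, 'm \<Rightarrow> 'm) cfunctor" and \<zeta>
      assume \<zeta>: "\<zeta> \<in> module_maps A H L"
      show "(\<lambda>x \<in> Obj A. compose (carrier (FObj F x)) (\<zeta> x)
            ((\<lambda>x \<in> Obj A. compose (carrier (FObj F x)) (\<theta> x) (\<eta> x)) x))
          = (\<lambda>x \<in> Obj A. compose (carrier (FObj F x))
              ((\<lambda>x \<in> Obj A. compose (carrier (FObj G x)) (\<zeta> x) (\<theta> x)) x) (\<eta> x))"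
        using module_maps_closed[OF \<eta>]
        by (intro restrict_ext) (auto simp: compose_def)
    }
    {
      fix \<theta>' assume \<theta>': "\<theta>' \<in> module_maps A G H"
      show "(\<lambda>x \<in> Obj A. compose (carrier (FObj F x)) (?add G H \<theta> \<theta>' x) (\<eta> x))
          = ?add F H (\<lambda>x \<in> Obj A. compose (carrier (FObj F x)) (\<theta> x) (\<eta> x))
              (\<lambda>x \<in> Obj A. compose (carrier (FObj F x)) (\<theta>' x) (\<eta> x))"
        using module_maps_closed[OF \<eta>]
        by (intro restrict_ext) (auto simp: compose_def)
    }
    {
      fix \<eta>' assume \<eta>': "\<eta>' \<in> module_maps A F G"
      show "(\<lambda>x \<in> Obj A. compose (carrier (FObj F x)) (\<theta> x) (?add F G \<eta> \<eta>' x))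
          = ?add F H (\<lambda>x \<in> Obj A. compose (carrier (FObj F x)) (\<theta> x) (\<eta> x))
              (\<lambda>x \<in> Obj A. compose (carrier (FObj F x)) (\<theta> x) (\<eta>' x))"
        using module_maps_closed[OF \<eta>] module_maps_closed[OF \<eta>']
        by (intro restrict_ext) (auto simp: compose_def module_maps_mult[OF \<theta>])
    }
  qed
qed

section \<open>Submodules, products and quotients of modules\<close>

definition is_submodule ::
  "('o, 'a, 'z) preadditive_scheme \<Rightarrow> ('o, 'a, 'p monoid, 'p \<Rightarrow> 'p) cfunctor \<Rightarrow> ('o \<Rightarrow> 'p set) \<Rightarrow> bool"
  where "is_submodule A F S \<longleftrightarrow> (\<forall>x \<in> Obj A. subgroup (S x) (FObj F x)) \<and>
    (\<forall>x \<in> Obj A. \<forall>y \<in> Obj A. \<forall>f \<in> Hom A y x. \<forall>m \<in> S x. FArr F x y f m \<in> S y)"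

definition sub_module ::
  "('o, 'a, 'p monoid, 'p \<Rightarrow> 'p) cfunctor \<Rightarrow> ('o \<Rightarrow> 'p set) \<Rightarrow> ('o, 'a, 'p monoid, 'p \<Rightarrow> 'p) cfunctor"
  where "sub_module F S = \<lparr>FObj = (\<lambda>x. (FObj F x)\<lparr>carrier := S x\<rparr>),
    FArr = (\<lambda>x y f. restrict (FArr F x y f) (S x))\<rparr>"

lemma sub_module_simps:
  "FObj (sub_module F S) x = (FObj F x)\<lparr>carrier := S x\<rparr>"
  "FArr (sub_module F S) x y f = restrict (FArr F x y f) (S x)"
  by (simp_all add: sub_module_def)

lemma comm_group_subgroup:
  assumes "comm_group G" "subgroup H G"
  shows "comm_group (G\<lparr>carrier := H\<rparr>)"
proof -
  interpret comm_group G by fact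
  interpret H: group "G\<lparr>carrier := H\<rparr>"
    using subgroup.subgroup_is_group[OF assms(2) is_group] .
  show ?thesis
    by (rule H.group_comm_groupI) (use assms(2) in \<open>auto simp: m_comm subgroup.mem_carrier\<close>)
qed

lemma amodule_sub_module:
  assumes F: "amodule A F" and S: "is_submodule A F S"
  shows "amodule A (sub_module F S)"
proof -
  interpret amodule A F by fact
  have sg: "subgroup (S x) (FObj F x)" if "x \<in> Obj A" for x
    using S that by (simp add: is_submodule_def)
  have st: "FArr F x y f m \<in> S y" if "x \<in> Obj A" "y \<in> Obj A" "f \<in> Hom A y x" "m \<in> S x" for x y f m
    using S that by (simp add: is_submodule_def)
  have car: "m \<in> carrier (FObj F x)" if "x \<in> Obj A" "m \<in> S x" for x m
    using subgroup.mem_carrier[OF sg] that .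
  show ?thesis
    by (intro amodule.intro amodule_axioms.intro preadditive_axioms)
      (use comm_group_subgroup[OF comm_grp sg] in
        \<open>auto simp: sub_module_simps group_maps_def st act_mult act_ident act_comp act_add
          ident_in_Hom comp_in_Hom hadd_in_Hom subgroup.m_closed[OF sg] car intro!: homI\<close>)
qed

lemma sub_module_inclusion:
  assumes F: "amodule A F" and S: "is_submodule A F S"
  shows "(\<lambda>x \<in> Obj A. \<lambda>m \<in> S x. m) \<in> module_maps A (sub_module F S) F"
  by (rule module_mapsI)
    (use S in \<open>auto simp: sub_module_simps is_submodule_def subgroup.mem_carrier subgroup.m_closed\<close>)

lemma is_submodule_kernel:
  assumes F: "amodule A F" and G: "amodule A G" and \<eta>: "\<eta> \<in> module_maps A F G"
  shows "is_submodule A F (\<lambda>x. {m \<in> carrier (FObj F x). \<eta> x m = \<one>\<^bsub>FObj G x\<^esub>})"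
proof -
  have "subgroup {m \<in> carrier (FObj F x). \<eta> x m = \<one>\<^bsub>FObj G x\<^esub>} (FObj F x)" if "x \<in> Obj A" for x
    using group_hom.subgroup_kernel[OF module_maps_group_hom[OF \<eta> F G that]]
    by (simp add: kernel_def)
  then show ?thesis
    by (auto simp: is_submodule_def module_maps_natural[OF \<eta>] amodule.act_closed[OF F]
        amodule.act_one[OF G])
qed

lemma is_submodule_image:
  assumes F: "amodule A F" and G: "amodule A G" and \<eta>: "\<eta> \<in> module_maps A F G"
  shows "is_submodule A G (\<lambda>x. \<eta> x ` carrier (FObj F x))"
proof -
  have "subgroup (\<eta> x ` carrier (FObj F x)) (FObj G x)" if "x \<in> Obj A" for x
    using group_hom.img_is_subgroup[OF module_maps_group_hom[OF \<eta> F G that]] .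
  then show ?thesis
    by (auto simp: is_submodule_def module_maps_natural[OF \<eta>, symmetric]
        amodule.act_closed[OF F])
qed

lemma is_submodule_trivial:
  assumes F: "amodule A F"
  shows "is_submodule A F (\<lambda>x. {\<one>\<^bsub>FObj F x\<^esub>})"
  using amodule.grp[OF F] by (auto simp: is_submodule_def group.triv_subgroup amodule.act_one[OF F])

lemma (in preadditive) amodule_representable:
  assumes x: "x \<in> Obj A"
  shows "amodule A (representable A x)"
  by (intro amodule.intro amodule_axioms.intro preadditive_axioms)
    (use x in \<open>auto simp: representable_def hgrp_comm_group group_maps_def carrier_hgrp comp_in_Hom
      comp_add_left comp_add_right hadd_in_Hom comp_ident_right comp_assoc ident_in_Hom intro!: homI\<close>)

lemma universe_subset: "size_universe U \<Longrightarrow> X \<in> U \<Longrightarrow> Y \<subseteq> X \<Longrightarrow> Y \<in> U"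
  unfolding size_universe_def by (meson subset_imp_lepoll)

lemma (in preadditive) sub_module_in_ModCat:
  assumes U: "size_universe U" and F: "F \<in> Obj (ModCat U A)" and S: "is_submodule A F S"
  shows "sub_module F S \<in> Obj (ModCat U A)"
proof -
  have "carrier (FObj (sub_module F S) x) \<in> U" if "x \<in> Obj A" for x
    using F S that universe_subset[OF U, of "carrier (FObj F x)" "S x"]
    by (auto simp: Obj_ModCat_iff sub_module_simps is_submodule_def subgroup.subset)
  then show ?thesis
    using F S by (simp add: Obj_ModCat_iff amodule_sub_module)
qed

definition prod_module ::
  "('o, 'a, 'p monoid, 'p \<Rightarrow> 'p) cfunctor \<Rightarrow> ('o, 'a, 'q monoid, 'q \<Rightarrow> 'q) cfunctor \<Rightarrow>
   ('o, 'a, ('p \<times> 'q) monoid, 'p \<times> 'q \<Rightarrow> 'p \<times> 'q) cfunctor"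
  where "prod_module F G = \<lparr>FObj = (\<lambda>x. FObj F x \<times>\<times> FObj G x),
    FArr = (\<lambda>x y f. \<lambda>m \<in> carrier (FObj F x) \<times> carrier (FObj G x).
      (FArr F x y f (fst m), FArr G x y f (snd m)))\<rparr>"

lemma prod_module_simps:
  "FObj (prod_module F G) x = FObj F x \<times>\<times> FObj G x"
  "m \<in> carrier (FObj F x) \<Longrightarrow> n \<in> carrier (FObj G x) \<Longrightarrow>
    FArr (prod_module F G) x y f (m, n) = (FArr F x y f m, FArr G x y f n)"
  by (simp_all add: prod_module_def)

lemma comm_group_DirProd:
  assumes "comm_group G" "comm_group H"
  shows "comm_group (G \<times>\<times> H)"
proof -
  interpret G: comm_group G by fact
  interpret H: comm_group H by fact
  interpret group "G \<times>\<times> H" by (rule DirProd_group) (rule G.is_group H.is_group)+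
  show ?thesis by (rule group_comm_groupI) (auto simp: G.m_comm H.m_comm)
qed

lemma amodule_prod_module:
  assumes F: "amodule A F" and G: "amodule A G"
  shows "amodule A (prod_module F G)"
proof -
  interpret F: amodule A F by fact
  interpret G: amodule A G by fact
  show ?thesis
    by (intro amodule.intro amodule_axioms.intro F.preadditive_axioms)
      (use comm_group_DirProd[OF F.comm_grp G.comm_grp] in
        \<open>auto simp: prod_module_simps group_maps_def F.act_closed G.act_closed F.act_mult G.act_mult
          F.act_ident G.act_ident F.act_comp G.act_comp F.act_add G.act_add
          F.ident_in_Hom F.comp_in_Hom F.hadd_in_Hom
          monoid.m_closed[OF group.is_monoid[OF F.grp]] monoid.m_closed[OF group.is_monoid[OF G.grp]]
          intro!: homI\<close>, auto simp: prod_module_def)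
qed

lemma prod_module_maps:
  assumes F: "amodule A F" and G: "amodule A G"
  shows prod_module_in1: "(\<lambda>x \<in> Obj A. \<lambda>m \<in> carrier (FObj F x). (m, \<one>\<^bsub>FObj G x\<^esub>))
      \<in> module_maps A F (prod_module F G)"
    and prod_module_snd: "(\<lambda>x \<in> Obj A. \<lambda>m \<in> carrier (FObj F x) \<times> carrier (FObj G x). snd m)
      \<in> module_maps A (prod_module F G) G"
proof -
  interpret F: amodule A F by fact
  interpret G: amodule A G by fact
  note [simp] = F.act_closed G.act_closed group.is_monoid[OF G.grp] G.act_one
    monoid.m_closed[OF group.is_monoid[OF F.grp]] monoid.m_closed[OF group.is_monoid[OF G.grp]]
  show "(\<lambda>x \<in> Obj A. \<lambda>m \<in> carrier (FObj F x). (m, \<one>\<^bsub>FObj G x\<^esub>)) \<in> module_maps A F (prod_module F G)"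
    by (rule module_mapsI) (auto simp: prod_module_simps)
  show "(\<lambda>x \<in> Obj A. \<lambda>m \<in> carrier (FObj F x) \<times> carrier (FObj G x). snd m)
      \<in> module_maps A (prod_module F G) G"
    by (rule module_mapsI) (auto simp: prod_module_simps)
qed

text \<open>Cosets are sets of elements, hence of the wrong type to form a group in the universe. A choice of
  representatives, followed by an injection into the universe, names each coset by an element of the
  prescribed type.\<close>

lemma coset_choice:
  fixes G :: "'p monoid" and U :: "'m set set"
  assumes U: "size_universe U" and G: "comm_group G" and L: "subgroup L G"
    and small: "small U (carrier G)"
  obtains \<pi> :: "'p \<Rightarrow> 'm" where "\<pi> ` carrier G \<in> U"
    "\<And>m n. m \<in> carrier G \<Longrightarrow> n \<in> carrier G \<Longrightarrow> \<pi> m = \<pi> n \<longleftrightarrow> m \<otimes>\<^bsub>G\<^esub> inv\<^bsub>G\<^esub> n \<in> L"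
proof -
  interpret comm_group G by fact
  interpret L: subgroup L G by fact
  obtain B c where B: "B \<in> U" "inj_on c (carrier G)" "c ` carrier G \<subseteq> B"
    using small unfolding small_def lepoll_def by blast
  define rep where "rep m = (SOME n. n \<in> L #>\<^bsub>G\<^esub> m)" for m
  have rep: "rep m \<in> L #>\<^bsub>G\<^esub> m" if "m \<in> carrier G" for m
    unfolding rep_def by (rule someI[of _ m]) (use that rcos_self L in blast)
  have repc: "rep m \<in> carrier G" if "m \<in> carrier G" for m
    using rep[OF that] r_coset_subset_G[OF L.subset that] by blast
  have eq: "rep m = rep n \<longleftrightarrow> m \<otimes>\<^bsub>G\<^esub> inv\<^bsub>G\<^esub> n \<in> L" if m: "m \<in> carrier G" and n: "n \<in> carrier G" for m n
  proof
    assume "rep m = rep n"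
    then have "L #>\<^bsub>G\<^esub> m = L #>\<^bsub>G\<^esub> n"
      using rep[OF m] rep[OF n] repr_independence[OF _ m L] repr_independence[OF _ n L] by metis
    then have "m \<in> L #>\<^bsub>G\<^esub> n" using rcos_self[OF m L] by blast
    then show "m \<otimes>\<^bsub>G\<^esub> inv\<^bsub>G\<^esub> n \<in> L"
      using L.rcos_module_imp[OF is_group n] by blast
  next
    assume "m \<otimes>\<^bsub>G\<^esub> inv\<^bsub>G\<^esub> n \<in> L"
    then have "m \<in> L #>\<^bsub>G\<^esub> n" using L.rcos_module_rev[OF is_group n m] by blast
    then have "L #>\<^bsub>G\<^esub> n = L #>\<^bsub>G\<^esub> m" using repr_independence[OF _ n L] by blast
    then show "rep m = rep n" by (simp add: rep_def)
  qed
  show thesis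
  proof (rule that[of "c \<circ> rep"])
    have "(c \<circ> rep) ` carrier G \<subseteq> B" using repc B(3) by auto
    then show "(c \<circ> rep) ` carrier G \<in> U" using universe_subset[OF U B(1)] by blast
    show "(c \<circ> rep) m = (c \<circ> rep) n \<longleftrightarrow> m \<otimes>\<^bsub>G\<^esub> inv\<^bsub>G\<^esub> n \<in> L" if "m \<in> carrier G" "n \<in> carrier G" for m n
      using eq[OF that] inj_on_eq_iff[OF B(2) repc[OF that(1)] repc[OF that(2)]] by simp
  qed
qed

text \<open>The quotient by \<open>L\<close> with its projection \<open>\<pi>\<close>. For trivial \<open>L\<close> this moves a small module with
  carriers of any type into the universe.\<close>

lemma (in preadditive) quotient_in_universe:
  fixes F :: "('o, 'a, 'p monoid, 'p \<Rightarrow> 'p) cfunctor" and U :: "'m set set"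
  assumes U: "size_universe U" and F: "amodule A F" and L: "is_submodule A F L"
    and small: "\<And>x. x \<in> Obj A \<Longrightarrow> small U (carrier (FObj F x))"
  obtains Q \<pi> where "Q \<in> Obj (ModCat U A)" "\<pi> \<in> module_maps A F Q"
    "\<And>x. x \<in> Obj A \<Longrightarrow> \<pi> x ` carrier (FObj F x) = carrier (FObj Q x)"
    "\<And>x m. x \<in> Obj A \<Longrightarrow> m \<in> carrier (FObj F x) \<Longrightarrow> \<pi> x m = \<one>\<^bsub>FObj Q x\<^esub> \<longleftrightarrow> m \<in> L x"
proof -
  interpret F: amodule A F by fact
  have "\<exists>\<pi> :: 'p \<Rightarrow> 'm. \<pi> ` carrier (FObj F x) \<in> U \<and> (\<forall>m \<in> carrier (FObj F x).
      \<forall>n \<in> carrier (FObj F x). \<pi> m = \<pi> n \<longleftrightarrow> m \<otimes>\<^bsub>FObj F x\<^esub> inv\<^bsub>FObj F x\<^esub> n \<in> L x)"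
    if x: "x \<in> Obj A" for x
    using coset_choice[OF U F.comm_grp[OF x] _ small[OF x], of "L x"] L x
    unfolding is_submodule_def by metis
  then obtain c where cU: "\<And>x. x \<in> Obj A \<Longrightarrow> c x ` carrier (FObj F x) \<in> U"
    and ceq: "\<And>x m n. x \<in> Obj A \<Longrightarrow> m \<in> carrier (FObj F x) \<Longrightarrow> n \<in> carrier (FObj F x) \<Longrightarrow>
      (c x m :: 'm) = c x n \<longleftrightarrow> m \<otimes>\<^bsub>FObj F x\<^esub> inv\<^bsub>FObj F x\<^esub> n \<in> L x"
    by metis
  define g where "g x = inv_into (carrier (FObj F x)) (c x)" for x
  define Q :: "('o, 'a, 'm monoid, 'm \<Rightarrow> 'm) cfunctor" where "Q =
    \<lparr>FObj = (\<lambda>x. \<lparr>carrier = c x ` carrier (FObj F x),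
        monoid.mult = (\<lambda>u v. c x (g x u \<otimes>\<^bsub>FObj F x\<^esub> g x v)), one = c x \<one>\<^bsub>FObj F x\<^esub>\<rparr>),
     FArr = (\<lambda>x y f. \<lambda>u \<in> c x ` carrier (FObj F x). c y (FArr F x y f (g x u)))\<rparr>"
  have gc: "g x (c x m) \<in> carrier (FObj F x)" "c x (g x (c x m)) = c x m"
    if "m \<in> carrier (FObj F x)" for x m
    using that by (auto simp: g_def inv_into_into f_inv_into_f)
  have L': "subgroup (L x) (FObj F x)" if "x \<in> Obj A" for x
    using L that by (simp add: is_submodule_def)
  have carQ: "carrier (FObj Q x) = c x ` carrier (FObj F x)" for x
    by (simp add: Q_def)
  have oneQ: "\<one>\<^bsub>FObj Q x\<^esub> = c x \<one>\<^bsub>FObj F x\<^esub>" for x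
    by (simp add: Q_def)
  \<comment> \<open>Well-defined because \<open>L x\<close> is a subgroup of a commutative group.\<close>
  have multQ: "c x m \<otimes>\<^bsub>FObj Q x\<^esub> c x n = c x (m \<otimes>\<^bsub>FObj F x\<^esub> n)"
    if x: "x \<in> Obj A" and m: "m \<in> carrier (FObj F x)" and n: "n \<in> carrier (FObj F x)" for x m n
  proof -
    interpret G: comm_group "FObj F x" using F.comm_grp[OF x] .
    let ?a = "g x (c x m)" and ?b = "g x (c x n)"
    have "?a \<otimes>\<^bsub>FObj F x\<^esub> inv\<^bsub>FObj F x\<^esub> m \<in> L x" "?b \<otimes>\<^bsub>FObj F x\<^esub> inv\<^bsub>FObj F x\<^esub> n \<in> L x"
      using ceq[OF x gc(1)[OF m] m] ceq[OF x gc(1)[OF n] n] gc(2)[OF m] gc(2)[OF n] by auto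
    then have "(?a \<otimes>\<^bsub>FObj F x\<^esub> inv\<^bsub>FObj F x\<^esub> m) \<otimes>\<^bsub>FObj F x\<^esub> (?b \<otimes>\<^bsub>FObj F x\<^esub> inv\<^bsub>FObj F x\<^esub> n) \<in> L x"
      using subgroup.m_closed[OF L'[OF x]] by blast
    also have "(?a \<otimes>\<^bsub>FObj F x\<^esub> inv\<^bsub>FObj F x\<^esub> m) \<otimes>\<^bsub>FObj F x\<^esub> (?b \<otimes>\<^bsub>FObj F x\<^esub> inv\<^bsub>FObj F x\<^esub> n)
      = (?a \<otimes>\<^bsub>FObj F x\<^esub> ?b) \<otimes>\<^bsub>FObj F x\<^esub> inv\<^bsub>FObj F x\<^esub> (m \<otimes>\<^bsub>FObj F x\<^esub> n)"
      using m n gc(1)[OF m] gc(1)[OF n] by (simp add: G.inv_mult G.m_ac)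
    finally show ?thesis
      using ceq[OF x] m n gc(1)[OF m] gc(1)[OF n] by (simp add: Q_def)
  qed
  \<comment> \<open>Well-defined because \<open>L\<close> is stable under the action.\<close>
  have actQ: "FArr Q x y f (c x m) = c y (FArr F x y f m)"
    if xy: "x \<in> Obj A" "y \<in> Obj A" "f \<in> Hom A y x" and m: "m \<in> carrier (FObj F x)" for x y f m
  proof -
    interpret Gx: group "FObj F x" using F.grp[OF xy(1)] .
    let ?a = "g x (c x m)"
    have a: "?a \<otimes>\<^bsub>FObj F x\<^esub> inv\<^bsub>FObj F x\<^esub> m \<in> L x"
      using ceq[OF xy(1) gc(1)[OF m] m] gc(2)[OF m] by auto
    then have "FArr F x y f (?a \<otimes>\<^bsub>FObj F x\<^esub> inv\<^bsub>FObj F x\<^esub> m) \<in> L y"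
      using L xy by (auto simp: is_submodule_def)
    also have "FArr F x y f (?a \<otimes>\<^bsub>FObj F x\<^esub> inv\<^bsub>FObj F x\<^esub> m)
      = FArr F x y f ?a \<otimes>\<^bsub>FObj F y\<^esub> inv\<^bsub>FObj F y\<^esub> FArr F x y f m"
      using xy m gc(1)[OF m] by (simp add: F.act_mult F.act_inv)
    finally show ?thesis
      using ceq[OF xy(2) F.act_closed[OF xy gc(1)[OF m]] F.act_closed[OF xy m]] m
      by (simp add: Q_def)
  qed
  have "amodule A Q"
  proof (intro amodule.intro amodule_axioms.intro preadditive_axioms)
    fix x assume x: "x \<in> Obj A"
    interpret Gx: comm_group "FObj F x" using F.comm_grp[OF x] .
    show "comm_group (FObj Q x)"
    proof (rule comm_groupI)
      show "\<one>\<^bsub>FObj Q x\<^esub> \<in> carrier (FObj Q x)" by (simp add: carQ oneQ)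
      fix u assume "u \<in> carrier (FObj Q x)"
      then obtain m where m: "m \<in> carrier (FObj F x)" "u = c x m" by (auto simp: carQ)
      show "\<one>\<^bsub>FObj Q x\<^esub> \<otimes>\<^bsub>FObj Q x\<^esub> u = u" using m by (simp add: oneQ multQ x)
      show "\<exists>v \<in> carrier (FObj Q x). v \<otimes>\<^bsub>FObj Q x\<^esub> u = \<one>\<^bsub>FObj Q x\<^esub>"
        using m by (auto simp: carQ oneQ multQ x intro!: bexI[of _ "inv\<^bsub>FObj F x\<^esub> m"])
      fix v assume "v \<in> carrier (FObj Q x)"
      then obtain n where n: "n \<in> carrier (FObj F x)" "v = c x n" by (auto simp: carQ)
      show "u \<otimes>\<^bsub>FObj Q x\<^esub> v \<in> carrier (FObj Q x)" using m n by (simp add: multQ x carQ)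
      show "u \<otimes>\<^bsub>FObj Q x\<^esub> v = v \<otimes>\<^bsub>FObj Q x\<^esub> u" using m n by (simp add: multQ x Gx.m_comm)
      fix w assume "w \<in> carrier (FObj Q x)"
      then obtain l where l: "l \<in> carrier (FObj F x)" "w = c x l" by (auto simp: carQ)
      show "u \<otimes>\<^bsub>FObj Q x\<^esub> v \<otimes>\<^bsub>FObj Q x\<^esub> w = u \<otimes>\<^bsub>FObj Q x\<^esub> (v \<otimes>\<^bsub>FObj Q x\<^esub> w)"
        using m n l by (simp add: multQ x Gx.m_assoc)
    qed
    fix u assume "u \<in> carrier (FObj Q x)"
    then obtain m where m: "m \<in> carrier (FObj F x)" "u = c x m" by (auto simp: carQ)
    show "FArr Q x x (ident A x) u = u"
      using x m by (simp add: actQ ident_in_Hom F.act_ident)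
    fix y assume y: "y \<in> Obj A"
    {
      fix f h assume "f \<in> Hom A y x" "h \<in> Hom A y x"
      then show "FArr Q x y (f \<otimes>\<^bsub>hgrp A y x\<^esub> h) u = FArr Q x y f u \<otimes>\<^bsub>FObj Q y\<^esub> FArr Q x y h u"
        using x y m by (simp add: actQ hadd_in_Hom multQ F.act_closed F.act_add)
    }
    {
      fix z f h assume "z \<in> Obj A" "f \<in> Hom A y x" "h \<in> Hom A z y"
      then show "FArr Q x z (comp A z y x f h) u = FArr Q y z h (FArr Q x y f u)"
        using x y m by (simp add: actQ comp_in_Hom[of z y x] F.act_closed F.act_comp)
    }
  next
    fix x y f assume xy: "x \<in> Obj A" "y \<in> Obj A" "f \<in> Hom A y x"
    interpret Gx: group "FObj F x" using F.grp[OF xy(1)] .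
    have "FArr Q x y f \<in> hom (FObj Q x) (FObj Q y)"
      by (rule homI) (auto simp: carQ actQ multQ xy F.act_closed F.act_mult)
    then show "FArr Q x y f \<in> group_maps (FObj Q x) (FObj Q y)"
      by (simp add: group_maps_def Q_def)
  qed
  then have Q: "Q \<in> Obj (ModCat U A)"
    by (simp add: Obj_ModCat_iff carQ cU)
  define \<pi> where "\<pi> = (\<lambda>x \<in> Obj A. restrict (c x) (carrier (FObj F x)))"
  have "\<pi> \<in> module_maps A F Q"
    by (rule module_mapsI) (auto simp: \<pi>_def carQ multQ actQ F.act_closed
        monoid.m_closed[OF group.is_monoid[OF F.grp]])
  moreover have "\<pi> x m = \<one>\<^bsub>FObj Q x\<^esub> \<longleftrightarrow> m \<in> L x" if "x \<in> Obj A" "m \<in> carrier (FObj F x)" for x m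
  proof -
    interpret Gx: group "FObj F x" using F.grp[OF that(1)] .
    show ?thesis using ceq[of x m "\<one>\<^bsub>FObj F x\<^esub>"] that by (simp add: \<pi>_def oneQ)
  qed
  moreover have "\<pi> x ` carrier (FObj F x) = carrier (FObj Q x)" if "x \<in> Obj A" for x
    using that by (auto simp: \<pi>_def carQ)
  ultimately show thesis using that Q by blast
qed

lemma factor_through_surjection:
  fixes F :: "('o, 'a, 'p monoid, 'p \<Rightarrow> 'p) cfunctor" and E :: "('o, 'a, 'q monoid, 'q \<Rightarrow> 'q) cfunctor"
    and W :: "('o, 'a, 'w monoid, 'w \<Rightarrow> 'w) cfunctor"
  assumes mod: "amodule A F" "amodule A E" "amodule A W"
    and p: "p \<in> module_maps A F E" and f: "f \<in> module_maps A F W"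
    and surj: "\<And>x. x \<in> Obj A \<Longrightarrow> p x ` carrier (FObj F x) = carrier (FObj E x)"
    and ker: "\<And>x m. x \<in> Obj A \<Longrightarrow> m \<in> carrier (FObj F x) \<Longrightarrow> p x m = \<one>\<^bsub>FObj E x\<^esub> \<Longrightarrow>
      f x m = \<one>\<^bsub>FObj W x\<^esub>"
  obtains g where "g \<in> module_maps A E W"
    "\<And>x m. x \<in> Obj A \<Longrightarrow> m \<in> carrier (FObj F x) \<Longrightarrow> g x (p x m) = f x m"
proof -
  have fp: "f x u = f x v" if x: "x \<in> Obj A" and u: "u \<in> carrier (FObj F x)"
    and v: "v \<in> carrier (FObj F x)" and eq: "p x u = p x v" for x u v
  proof -
    interpret f: group_hom "FObj F x" "FObj W x" "f x"
      by (rule module_maps_group_hom[OF f mod(1,3) x])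
    interpret p: group_hom "FObj F x" "FObj E x" "p x"
      by (rule module_maps_group_hom[OF p mod(1,2) x])
    have "p x (u \<otimes>\<^bsub>FObj F x\<^esub> inv\<^bsub>FObj F x\<^esub> v) = \<one>\<^bsub>FObj E x\<^esub>"
      using u v eq by simp
    then have "f x (u \<otimes>\<^bsub>FObj F x\<^esub> inv\<^bsub>FObj F x\<^esub> v) = \<one>\<^bsub>FObj W x\<^esub>"
      using ker[OF x] u v by simp
    then have "f x u \<otimes>\<^bsub>FObj W x\<^esub> inv\<^bsub>FObj W x\<^esub> f x v = \<one>\<^bsub>FObj W x\<^esub>" using u v by simp
    then show ?thesis
      using u v by (metis f.H.inv_inv f.H.inv_equality f.H.inv_closed f.hom_closed)
  qed
  define g where "g = (\<lambda>x \<in> Obj A. \<lambda>b \<in> carrier (FObj E x). f x (inv_into (carrier (FObj F x)) (p x) b))"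
  have gp: "g x (p x e) = f x e" if "x \<in> Obj A" "e \<in> carrier (FObj F x)" for x e
  proof -
    have "p x e \<in> p x ` carrier (FObj F x)" using that by blast
    then have "f x (inv_into (carrier (FObj F x)) (p x) (p x e)) = f x e"
      using that by (intro fp) (auto simp: inv_into_into f_inv_into_f)
    then show ?thesis using that module_maps_closed[OF p] by (simp add: g_def)
  qed
  have lift: "\<exists>e \<in> carrier (FObj F x). b = p x e" if "x \<in> Obj A" "b \<in> carrier (FObj E x)" for x b
    using surj[OF that(1)] that(2) by blast
  have "g \<in> module_maps A E W"
  proof (rule module_mapsI)
    fix x m n assume x: "x \<in> Obj A" and m: "m \<in> carrier (FObj E x)" "n \<in> carrier (FObj E x)"
    interpret gF: group "FObj F x" using amodule.grp[OF mod(1) x] .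
    obtain u v where uv: "u \<in> carrier (FObj F x)" "v \<in> carrier (FObj F x)" "m = p x u" "n = p x v"
      using lift[OF x m(1)] lift[OF x m(2)] by metis
    then show "g x (m \<otimes>\<^bsub>FObj E x\<^esub> n) = g x m \<otimes>\<^bsub>FObj W x\<^esub> g x n"
      using x by (simp add: gp module_maps_mult[OF p, symmetric] module_maps_mult[OF f])
  next
    fix x y h m assume xy: "x \<in> Obj A" "y \<in> Obj A" "h \<in> Hom A y x" and m: "m \<in> carrier (FObj E x)"
    obtain u where u: "u \<in> carrier (FObj F x)" "m = p x u" using lift[OF xy(1) m] by metis
    then show "g y (FArr E x y h m) = FArr W x y h (g x m)"
      using xy amodule.act_closed[OF mod(1) xy u(1)]
      by (simp add: gp module_maps_natural[OF p, symmetric] module_maps_natural[OF f])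
  next
    fix x m assume xm: "x \<in> Obj A" "m \<in> carrier (FObj E x)"
    show "g x m \<in> carrier (FObj W x)"
      using lift[OF xm] gp[OF xm(1)] module_maps_closed[OF f xm(1)] by metis
  qed (auto simp: g_def)
  then show thesis using that gp by blast
qed

section \<open>Exact sequences of modules\<close>

lemma ModCat_comp_apply:
  assumes "x \<in> Obj A" "m \<in> carrier (FObj F x)"
  shows "comp (ModCat U A) F G H \<theta> \<eta> x m = \<theta> x (\<eta> x m)"
  using assms by (simp add: ModCat_simps compose_def)

text \<open>The universal property is tested on the submodules \<open>ker i\<close> and \<open>ker p\<close>, whose inclusions are maps in
  the category since subsets of members of the universe belong to it.\<close>

lemma (in preadditive) kernel_pointwise:
  assumes U: "size_universe U" and ob: "F \<in> Obj (ModCat U A)" "E \<in> Obj (ModCat U A)"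
    "B \<in> Obj (ModCat U A)" and ker: "is_kernel (ModCat U A) F E B i p" and x: "x \<in> Obj A"
  shows kernel_injective: "m \<in> carrier (FObj F x) \<Longrightarrow> i x m = \<one>\<^bsub>FObj E x\<^esub> \<Longrightarrow> m = \<one>\<^bsub>FObj F x\<^esub>"
    and kernel_complex: "m \<in> carrier (FObj F x) \<Longrightarrow> p x (i x m) = \<one>\<^bsub>FObj B x\<^esub>"
    and kernel_exact: "e \<in> carrier (FObj E x) \<Longrightarrow> p x e = \<one>\<^bsub>FObj B x\<^esub> \<Longrightarrow>
      \<exists>m \<in> carrier (FObj F x). i x m = e"
proof -
  interpret M: preadditive "ModCat U A" by (rule preadditive_ModCat)
  have mod: "amodule A F" "amodule A E" "amodule A B"
    using ob by (auto simp: Obj_ModCat_iff)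
  have i: "i \<in> module_maps A F E" and p: "p \<in> module_maps A E B"
    and pi: "comp (ModCat U A) F E B p i = hzero (ModCat U A) F B"
    using ker by (auto simp: is_kernel_def ModCat_simps)
  show "p x (i x m) = \<one>\<^bsub>FObj B x\<^esub>" if "m \<in> carrier (FObj F x)"
    using ModCat_comp_apply[OF x that, of U E B p i] x that by (simp add: pi ModCat_simps(6))
  {
    assume m: "m \<in> carrier (FObj F x)" "i x m = \<one>\<^bsub>FObj E x\<^esub>"
    define S where "S x = {m \<in> carrier (FObj F x). i x m = \<one>\<^bsub>FObj E x\<^esub>}" for x
    have S: "is_submodule A F S"
      using is_submodule_kernel[OF mod(1,2) i] by (simp add: S_def[abs_def])
    define j where "j = (\<lambda>x \<in> Obj A. \<lambda>m \<in> S x. m)"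
    have K: "sub_module F S \<in> Obj (ModCat U A)" by (rule sub_module_in_ModCat[OF U ob(1) S])
    have j: "j \<in> Hom (ModCat U A) (sub_module F S) F"
      using sub_module_inclusion[OF mod(1) S] by (simp add: ModCat_simps j_def)
    have 0: "hzero (ModCat U A) (sub_module F S) F \<in> Hom (ModCat U A) (sub_module F S) F"
      using K ob M.hzero_in_Hom by blast
    have "comp (ModCat U A) (sub_module F S) F E i j = hzero (ModCat U A) (sub_module F S) E"
      unfolding ModCat_simps
      by (intro restrict_ext) (auto simp: compose_def sub_module_simps j_def S_def)
    also have "\<dots> = comp (ModCat U A) (sub_module F S) F E i (hzero (ModCat U A) (sub_module F S) F)"
      using M.comp_zero_right[OF K ob(1,2)] i by (simp add: ModCat_simps)
    finally have "j = hzero (ModCat U A) (sub_module F S) F"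
      using M.kernel_cancel[OF ob K ker j 0] by blast
    then have "j x m = \<one>\<^bsub>FObj F x\<^esub>"
      using x m by (simp add: ModCat_simps(6) sub_module_simps S_def)
    then show "m = \<one>\<^bsub>FObj F x\<^esub>" using x m by (simp add: j_def S_def)
  }
  {
    assume e: "e \<in> carrier (FObj E x)" "p x e = \<one>\<^bsub>FObj B x\<^esub>"
    define S where "S x = {m \<in> carrier (FObj E x). p x m = \<one>\<^bsub>FObj B x\<^esub>}" for x
    have S: "is_submodule A E S"
      using is_submodule_kernel[OF mod(2,3) p] by (simp add: S_def[abs_def])
    define j where "j = (\<lambda>x \<in> Obj A. \<lambda>m \<in> S x. m)"
    have K: "sub_module E S \<in> Obj (ModCat U A)" by (rule sub_module_in_ModCat[OF U ob(2) S])
    have j: "j \<in> Hom (ModCat U A) (sub_module E S) E"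
      using sub_module_inclusion[OF mod(2) S] by (simp add: ModCat_simps j_def)
    have "comp (ModCat U A) (sub_module E S) E B p j = hzero (ModCat U A) (sub_module E S) B"
      unfolding ModCat_simps
      by (intro restrict_ext) (auto simp: compose_def sub_module_simps j_def S_def)
    then obtain g where g: "g \<in> Hom (ModCat U A) (sub_module E S) F"
      "comp (ModCat U A) (sub_module E S) F E i g = j"
      using ker K j unfolding is_kernel_def by blast
    have eS: "e \<in> carrier (FObj (sub_module E S) x)"
      using e by (simp add: sub_module_simps S_def)
    then have "i x (g x e) = j x e"
      using ModCat_comp_apply[OF x eS, of U F E i g] g(2) by simp
    then have "i x (g x e) = e" using x e by (simp add: j_def S_def)
    moreover have "g x e \<in> carrier (FObj F x)"
      using module_maps_closed[of g A "sub_module E S" F x e] g(1) x eS by (simp add: ModCat_simps)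
    ultimately show "\<exists>m \<in> carrier (FObj F x). i x m = e" by blast
  }
qed

text \<open>The factorisation through \<open>i\<close> is obtained from its pointwise inverse on the image, and that through
  \<open>p\<close> from \<open>factor_through_surjection\<close>.\<close>

lemma (in preadditive) exact_extension:
  assumes ob: "F \<in> Obj (ModCat U A)" "E \<in> Obj (ModCat U A)" "B \<in> Obj (ModCat U A)"
    and i: "i \<in> module_maps A F E" and p: "p \<in> module_maps A E B"
    and inj: "\<And>x m. x \<in> Obj A \<Longrightarrow> m \<in> carrier (FObj F x) \<Longrightarrow> i x m = \<one>\<^bsub>FObj E x\<^esub> \<Longrightarrow> m = \<one>\<^bsub>FObj F x\<^esub>"
    and exact: "\<And>x e. x \<in> Obj A \<Longrightarrow> e \<in> carrier (FObj E x) \<Longrightarrow>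
      p x e = \<one>\<^bsub>FObj B x\<^esub> \<longleftrightarrow> e \<in> i x ` carrier (FObj F x)"
    and surj: "\<And>x. x \<in> Obj A \<Longrightarrow> p x ` carrier (FObj E x) = carrier (FObj B x)"
  shows "(E, i, p) \<in> extensions (ModCat U A) B F"
proof -
  have mod: "amodule A F" "amodule A E" "amodule A B"
    using ob by (auto simp: Obj_ModCat_iff)
  interpret F: amodule A F by (rule mod)
  interpret E: amodule A E by (rule mod)
  interpret B: amodule A B by (rule mod)
  have inj': "inj_on (i x) (carrier (FObj F x))" if "x \<in> Obj A" for x
    using group_hom.inj_on_one_iff[OF module_maps_group_hom[OF i mod(1,2) that]] inj that by blast
  have pi: "p x (i x m) = \<one>\<^bsub>FObj B x\<^esub>" if "x \<in> Obj A" "m \<in> carrier (FObj F x)" for x m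
    using exact[OF that(1) module_maps_closed[OF i that]] that by blast
  have zero: "comp (ModCat U A) F E B p i = hzero (ModCat U A) F B"
    unfolding ModCat_simps by (auto simp: compose_def pi intro!: restrict_ext)
  have "is_kernel (ModCat U A) F E B i p"
    unfolding is_kernel_def
  proof (intro conjI ballI impI zero)
    show "i \<in> Hom (ModCat U A) F E" "p \<in> Hom (ModCat U A) E B" using i p by (simp_all add: ModCat_simps)
    fix W f assume W: "W \<in> Obj (ModCat U A)" and f: "f \<in> Hom (ModCat U A) W E"
      and pf: "comp (ModCat U A) W E B p f = hzero (ModCat U A) W B"
    have mW: "amodule A W" using W by (simp add: Obj_ModCat_iff)
    interpret W: amodule A W by (rule mW)
    have f: "f \<in> module_maps A W E" using f by (simp add: ModCat_simps)
    define g where "g = (\<lambda>x \<in> Obj A. \<lambda>m \<in> carrier (FObj W x). inv_into (carrier (FObj F x)) (i x) (f x m))"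
    have im: "f x m \<in> i x ` carrier (FObj F x)" if "x \<in> Obj A" "m \<in> carrier (FObj W x)" for x m
    proof -
      have "p x (f x m) = \<one>\<^bsub>FObj B x\<^esub>"
        using ModCat_comp_apply[OF that, of U E B p f] that by (simp add: pf ModCat_simps(6))
      then show ?thesis using exact[OF that(1) module_maps_closed[OF f that]] by blast
    qed
    have ig: "i x (g x m) = f x m" and gc: "g x m \<in> carrier (FObj F x)"
      if "x \<in> Obj A" "m \<in> carrier (FObj W x)" for x m
      using im[OF that] that by (auto simp: g_def f_inv_into_f inv_into_into)
    have eqI: "u = v" if "x \<in> Obj A" "u \<in> carrier (FObj F x)" "v \<in> carrier (FObj F x)" "i x u = i x v"
      for x u v
      using inj_onD[OF inj'[OF that(1)] that(4,2,3)] .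
    have g: "g \<in> module_maps A W F"
    proof (rule module_mapsI)
      fix x m n assume x: "x \<in> Obj A" and m: "m \<in> carrier (FObj W x)" "n \<in> carrier (FObj W x)"
      interpret gW: group "FObj W x" using W.grp[OF x] .
      interpret gF: group "FObj F x" using F.grp[OF x] .
      show "g x (m \<otimes>\<^bsub>FObj W x\<^esub> n) = g x m \<otimes>\<^bsub>FObj F x\<^esub> g x n"
        using m by - (rule eqI[OF x],
          simp_all add: gc[OF x] ig[OF x] module_maps_mult[OF i x] module_maps_mult[OF f x])
    next
      fix x y h m assume xy: "x \<in> Obj A" "y \<in> Obj A" "h \<in> Hom A y x" and m: "m \<in> carrier (FObj W x)"
      show "g y (FArr W x y h m) = FArr F x y h (g x m)"
        using xy m W.act_closed[OF xy m] F.act_closed[OF xy gc[OF xy(1) m]]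
        by - (rule eqI[OF xy(2)],
          simp_all add: gc ig module_maps_natural[OF i] module_maps_natural[OF f])
    qed (use gc in \<open>auto simp: g_def\<close>)
    have "comp (ModCat U A) W F E i g = f"
      using module_maps_comp[OF mW g i] ig
      by (intro module_maps_eqI[OF _ f]) (simp_all add: ModCat_simps compose_def)
    moreover have "h = g" if "h \<in> module_maps A W F" "comp (ModCat U A) W F E i h = f" for h
    proof (rule module_maps_eqI[OF that(1) g])
      fix x m assume xm: "x \<in> Obj A" "m \<in> carrier (FObj W x)"
      then have "i x (h x m) = f x m"
        using ModCat_comp_apply[OF xm, of U F E i h] that(2) by simp
      then show "h x m = g x m"
        using eqI[OF xm(1) module_maps_closed[OF that(1) xm] gc[OF xm]] ig[OF xm] by simp
    qed
    ultimately show "\<exists>!g. g \<in> Hom (ModCat U A) W F \<and> comp (ModCat U A) W F E i g = f"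
      using g by (auto simp: ModCat_simps(1))
  qed
  moreover have "is_cokernel (ModCat U A) F E B i p"
    unfolding is_cokernel_def
  proof (intro conjI ballI impI zero)
    show "i \<in> Hom (ModCat U A) F E" "p \<in> Hom (ModCat U A) E B" using i p by (simp_all add: ModCat_simps)
    fix W f assume W: "W \<in> Obj (ModCat U A)" and f: "f \<in> Hom (ModCat U A) E W"
      and fi: "comp (ModCat U A) F E W f i = hzero (ModCat U A) F W"
    have mW: "amodule A W" using W by (simp add: Obj_ModCat_iff)
    interpret W: amodule A W by (rule mW)
    have f: "f \<in> module_maps A E W" using f by (simp add: ModCat_simps)
    have fi: "f x (i x m) = \<one>\<^bsub>FObj W x\<^esub>" if "x \<in> Obj A" "m \<in> carrier (FObj F x)" for x m
      using ModCat_comp_apply[OF that, of U E W f i] that by (simp add: fi ModCat_simps(6))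
    have "f x e = \<one>\<^bsub>FObj W x\<^esub>" if "x \<in> Obj A" "e \<in> carrier (FObj E x)" "p x e = \<one>\<^bsub>FObj B x\<^esub>" for x e
      using exact[OF that(1,2)] that(3) fi[OF that(1)] by auto
    then obtain g where g: "g \<in> module_maps A B W"
      and gp: "\<And>x e. x \<in> Obj A \<Longrightarrow> e \<in> carrier (FObj E x) \<Longrightarrow> g x (p x e) = f x e"
      using factor_through_surjection[OF mod(2,3) mW p f surj] by metis
    have "comp (ModCat U A) E B W g p = f"
      using module_maps_comp[OF mod(2) p g] gp
      by (intro module_maps_eqI[OF _ f]) (simp_all add: ModCat_simps compose_def)
    moreover have "h = g" if "h \<in> module_maps A B W" "comp (ModCat U A) E B W h p = f" for h
    proof (rule module_maps_eqI[OF that(1) g])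
      fix x m assume xm: "x \<in> Obj A" "m \<in> carrier (FObj B x)"
      then obtain e where e: "e \<in> carrier (FObj E x)" "m = p x e"
        using surj[OF xm(1)] by (metis imageE)
      then show "h x m = g x m"
        using ModCat_comp_apply[OF xm(1) e(1), of U B W h p] that(2) gp[OF xm(1) e(1)] by simp
    qed
    ultimately show "\<exists>!g. g \<in> Hom (ModCat U A) B W \<and> comp (ModCat U A) E B W g p = f"
      using g by (auto simp: ModCat_simps(1))
  qed
  ultimately show ?thesis using ob by (simp add: extensions_def)
qed

section \<open>The linear Grothendieck construction is preadditive\<close>

lemma opp_simps:
  "Obj (opp C) = Obj C"
  "Hom (opp C) = (\<lambda>x y. Hom C y x)"
  "ident (opp C) = ident C"
  "comp (opp C) = (\<lambda>x y z g f. comp C z y x f g)"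
  by (simp_all add: opp_def)

locale algebra_presheaf = category C
  for C :: "('o, 'a) category" +
  fixes K :: "'k ring" and R :: "('o, 'a, ('k, 'r) module, 'r \<Rightarrow> 'r) cfunctor"
  assumes R_functor: "cfunctor (opp C) (KAlg K) R"
begin

lemma R_algebra: "x \<in> Obj C \<Longrightarrow> k_algebra K (FObj R x)"
  using cfunctor.FObj_in_Obj[OF R_functor, of x] by (simp add: opp_simps KAlg_def)

lemma R_ring: "x \<in> Obj C \<Longrightarrow> ring (FObj R x)"
  using R_algebra by (simp add: k_algebra_def)

lemma R_add_group: "x \<in> Obj C \<Longrightarrow> group (add_monoid (FObj R x))"
  using R_ring abelian_group.a_group ring_def by blast

lemma R_restrict:
  assumes "x \<in> Obj C" "y \<in> Obj C" "f \<in> Hom C y x"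
  shows R_ring_hom: "FArr R x y f \<in> ring_hom (FObj R x) (FObj R y)"
    and R_restrict_smult: "c \<in> carrier K \<Longrightarrow> a \<in> carrier (FObj R x) \<Longrightarrow>
      FArr R x y f (c \<odot>\<^bsub>FObj R x\<^esub> a) = c \<odot>\<^bsub>FObj R y\<^esub> FArr R x y f a"
  using cfunctor.FArr_in_Hom[OF R_functor, of x y f] assms by (simp_all add: opp_simps KAlg_def)

lemma R_restrict_simps:
  assumes "x \<in> Obj C" "y \<in> Obj C" "f \<in> Hom C y x"
  shows R_closed: "a \<in> carrier (FObj R x) \<Longrightarrow> FArr R x y f a \<in> carrier (FObj R y)"
    and R_mult: "a \<in> carrier (FObj R x) \<Longrightarrow> b \<in> carrier (FObj R x) \<Longrightarrow>
      FArr R x y f (a \<otimes>\<^bsub>FObj R x\<^esub> b) = FArr R x y f a \<otimes>\<^bsub>FObj R y\<^esub> FArr R x y f b"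
    and R_add: "a \<in> carrier (FObj R x) \<Longrightarrow> b \<in> carrier (FObj R x) \<Longrightarrow>
      FArr R x y f (a \<oplus>\<^bsub>FObj R x\<^esub> b) = FArr R x y f a \<oplus>\<^bsub>FObj R y\<^esub> FArr R x y f b"
    and R_one: "FArr R x y f \<one>\<^bsub>FObj R x\<^esub> = \<one>\<^bsub>FObj R y\<^esub>"
    and R_zero: "FArr R x y f \<zero>\<^bsub>FObj R x\<^esub> = \<zero>\<^bsub>FObj R y\<^esub>"
  using R_ring_hom[OF assms] ring_hom_zero[OF R_ring_hom[OF assms] R_ring[OF assms(1)] R_ring[OF assms(2)]]
  by (simp_all add: ring_hom_closed ring_hom_mult ring_hom_add ring_hom_one)

lemma R_ident: "x \<in> Obj C \<Longrightarrow> a \<in> carrier (FObj R x) \<Longrightarrow> FArr R x x (ident C x) a = a"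
  using cfunctor.FArr_ident[OF R_functor, of x] by (simp add: opp_simps KAlg_def)

lemma R_comp:
  assumes "x \<in> Obj C" "y \<in> Obj C" "z \<in> Obj C" "f \<in> Hom C y x" "g \<in> Hom C z y" "a \<in> carrier (FObj R x)"
  shows "FArr R x z (comp C z y x f g) a = FArr R y z g (FArr R x y f a)"
  using cfunctor.FArr_comp[OF R_functor, of x y z f g] assms
  by (simp add: opp_simps KAlg_def compose_def)

abbreviation gr :: "('o, 'a \<Rightarrow> 'r) preadditive" where "gr \<equiv> Gr C R"

text \<open>Monomials generate the Hom groups, so additive identities are checked on them.\<close>

definition monomial :: "'o \<Rightarrow> 'o \<Rightarrow> 'a \<Rightarrow> 'r \<Rightarrow> 'a \<Rightarrow> 'r" where
  "monomial x y = single (Hom C x y) (\<lambda>f. add_monoid (FObj R x))"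

lemma Gr_simps:
  "Obj gr = Obj C"
  "Hom gr x y = carrier (hgrp gr x y)"
  "hgrp gr x y = sum_group (Hom C x y) (\<lambda>f. add_monoid (FObj R x))"
  by (simp_all add: Gr_def)

lemma Gr_add: "\<phi> \<otimes>\<^bsub>hgrp gr x y\<^esub> \<psi> = (\<lambda>f \<in> Hom C x y. \<phi> f \<oplus>\<^bsub>FObj R x\<^esub> \<psi> f)"
  by (simp add: Gr_simps)

lemma Gr_zero: "\<one>\<^bsub>hgrp gr x y\<^esub> = (\<lambda>f \<in> Hom C x y. \<zero>\<^bsub>FObj R x\<^esub>)"
  by (simp add: Gr_simps)

lemma Gr_Hom_iff:
  assumes "x \<in> Obj C"
  shows "\<phi> \<in> Hom gr x y \<longleftrightarrow> \<phi> \<in> (\<Pi>\<^sub>E f \<in> Hom C x y. carrier (FObj R x)) \<and>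
    finite {f \<in> Hom C x y. \<phi> f \<noteq> \<zero>\<^bsub>FObj R x\<^esub>}"
  using R_add_group[OF assms] by (auto simp: Gr_simps carrier_sum_group)

lemma Gr_group: "x \<in> Obj C \<Longrightarrow> group (hgrp gr x y)"
  using R_add_group by (simp add: Gr_simps)

lemma Gr_comm_group: "x \<in> Obj C \<Longrightarrow> comm_group (hgrp gr x y)"
proof -
  assume x: "x \<in> Obj C"
  interpret ring "FObj R x" by (rule R_ring[OF x])
  interpret group "hgrp gr x y" by (rule Gr_group[OF x])
  show ?thesis
  proof (rule group_comm_groupI)
    fix \<phi> \<psi> assume "\<phi> \<in> carrier (hgrp gr x y)" "\<psi> \<in> carrier (hgrp gr x y)"
    then have "\<phi> \<in> Hom gr x y" "\<psi> \<in> Hom gr x y" by (simp_all add: Gr_simps)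
    then show "\<phi> \<otimes>\<^bsub>hgrp gr x y\<^esub> \<psi> = \<psi> \<otimes>\<^bsub>hgrp gr x y\<^esub> \<phi>"
      unfolding Gr_add by (intro restrict_ext) (auto simp: Gr_Hom_iff[OF x] a_comm PiE_iff)
  qed
qed

lemma Gr_induct [consumes 2, case_names zero monomial add]:
  assumes x: "x \<in> Obj C" and \<phi>: "\<phi> \<in> Hom gr x y"
    and "P \<one>\<^bsub>hgrp gr x y\<^esub>"
    and "\<And>f. f \<in> Hom C x y \<Longrightarrow> \<phi> f \<noteq> \<zero>\<^bsub>FObj R x\<^esub> \<Longrightarrow> \<phi> f \<in> carrier (FObj R x) \<Longrightarrow> P (monomial x y f (\<phi> f))"
    and "\<And>u v. u \<in> Hom gr x y \<Longrightarrow> v \<in> Hom gr x y \<Longrightarrow> P u \<Longrightarrow> P v \<Longrightarrow> P (u \<otimes>\<^bsub>hgrp gr x y\<^esub> v)"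
  shows "P \<phi>"
  by (rule sum_group_induct[of "Hom C x y" "\<lambda>f. add_monoid (FObj R x)" \<phi> P])
    (use assms R_add_group[OF x] in \<open>auto simp: Gr_simps monomial_def\<close>)

lemma monomial_in_Hom:
  assumes "x \<in> Obj C" "f \<in> Hom C x y" "r \<in> carrier (FObj R x)"
  shows "monomial x y f r \<in> Hom gr x y"
  using single_carrier[of "Hom C x y" "\<lambda>f. add_monoid (FObj R x)" f r] assms R_add_group
  by (simp add: monomial_def Gr_simps)

lemma monomial_add:
  assumes "x \<in> Obj C"
  shows "monomial x y f r \<otimes>\<^bsub>hgrp gr x y\<^esub> monomial x y f s = monomial x y f (r \<oplus>\<^bsub>FObj R x\<^esub> s)"
  using single_mult[of "Hom C x y" "\<lambda>f. add_monoid (FObj R x)" f r s] assms R_add_group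
  by (simp add: monomial_def Gr_simps)

lemma monomial_apply: "h \<in> Hom C x y \<Longrightarrow> monomial x y f r h = (if h = f then r else \<zero>\<^bsub>FObj R x\<^esub>)"
  by (simp add: monomial_def single_def)

lemma Gr_ident: "ident gr x = monomial x x (ident C x) \<one>\<^bsub>FObj R x\<^esub>"
  by (simp add: Gr_def monomial_def single_def cong: if_cong)

text \<open>Additivity of composition requires all summations to run over the same index set, so the supports
  are replaced by arbitrary finite sets containing them.\<close>

lemma Gr_comp_eq:
  assumes ob: "x \<in> Obj C" "y \<in> Obj C" "z \<in> Obj C"
    and \<phi>: "\<phi> \<in> Hom gr x y" and \<psi>: "\<psi> \<in> Hom gr y z" and h: "h \<in> Hom C x z"
    and X: "finite X" "X \<subseteq> Hom C x y" "{f \<in> Hom C x y. \<phi> f \<noteq> \<zero>\<^bsub>FObj R x\<^esub>} \<subseteq> X"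
    and Y: "finite Y" "Y \<subseteq> Hom C y z" "{g \<in> Hom C y z. \<psi> g \<noteq> \<zero>\<^bsub>FObj R y\<^esub>} \<subseteq> Y"
  shows "comp gr x y z \<psi> \<phi> h = finsum (FObj R x) (\<lambda>(f, g). FArr R y x f (\<psi> g) \<otimes>\<^bsub>FObj R x\<^esub> \<phi> f)
    {p \<in> X \<times> Y. comp C x y z (snd p) (fst p) = h}"
proof -
  interpret ring "FObj R x" by (rule R_ring[OF ob(1)])
  have \<phi>c: "\<phi> f \<in> carrier (FObj R x)" if "f \<in> Hom C x y" for f
    using \<phi> that by (auto simp: Gr_Hom_iff[OF ob(1)])
  have \<psi>c: "\<psi> g \<in> carrier (FObj R y)" if "g \<in> Hom C y z" for g
    using \<psi> that by (auto simp: Gr_Hom_iff[OF ob(2)])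
  let ?S = "{(f, g). f \<in> Hom C x y \<and> g \<in> Hom C y z \<and> comp C x y z g f = h \<and>
    \<phi> f \<noteq> \<zero>\<^bsub>FObj R x\<^esub> \<and> \<psi> g \<noteq> \<zero>\<^bsub>FObj R y\<^esub>}"
  let ?T = "{p \<in> X \<times> Y. comp C x y z (snd p) (fst p) = h}"
  let ?t = "\<lambda>(f, g). FArr R y x f (\<psi> g) \<otimes>\<^bsub>FObj R x\<^esub> \<phi> f"
  have ST: "?S \<subseteq> ?T" using X(3) Y(3) by auto
  have "comp gr x y z \<psi> \<phi> h = finsum (FObj R x) ?t ?S"
    using h by (simp add: Gr_def)
  also have "\<dots> = finsum (FObj R x) ?t ?T"
  proof (rule add.finprod_mono_neutral_cong_left[OF _ ST])
    show "finite ?T" using X(1) Y(1) by simp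
    show "?t p = \<zero>\<^bsub>FObj R x\<^esub>" if "p \<in> ?T - ?S" for p
    proof -
      obtain f g where p: "p = (f, g)" by (cases p)
      then have fg: "f \<in> Hom C x y" "g \<in> Hom C y z" "\<phi> f = \<zero>\<^bsub>FObj R x\<^esub> \<or> \<psi> g = \<zero>\<^bsub>FObj R y\<^esub>"
        using that X(2) Y(2) by auto
      then show ?thesis
        using R_closed[OF ob(2,1) fg(1) \<psi>c[OF fg(2)]] R_zero[OF ob(2,1) fg(1)] \<phi>c[OF fg(1)]
        by (auto simp: p)
    qed
    show "?t \<in> ?T \<rightarrow> carrier (FObj R x)"
      using X(2) Y(2) \<phi>c R_closed[OF ob(2,1) _ \<psi>c] by (auto simp: subset_iff)
  qed simp
  finally show ?thesis .
qed

lemma Gr_comp_in_Hom: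
  assumes ob: "x \<in> Obj C" "y \<in> Obj C" "z \<in> Obj C"
    and \<phi>: "\<phi> \<in> Hom gr x y" and \<psi>: "\<psi> \<in> Hom gr y z"
  shows "comp gr x y z \<psi> \<phi> \<in> Hom gr x z"
proof -
  interpret ring "FObj R x" by (rule R_ring[OF ob(1)])
  define X where "X = {f \<in> Hom C x y. \<phi> f \<noteq> \<zero>\<^bsub>FObj R x\<^esub>}"
  define Y where "Y = {g \<in> Hom C y z. \<psi> g \<noteq> \<zero>\<^bsub>FObj R y\<^esub>}"
  have fin: "finite X" "finite Y" using \<phi> \<psi> ob by (auto simp: Gr_Hom_iff X_def Y_def)
  have \<phi>c: "\<phi> f \<in> carrier (FObj R x)" if "f \<in> Hom C x y" for f
    using \<phi> that by (auto simp: Gr_Hom_iff[OF ob(1)])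
  have \<psi>c: "\<psi> g \<in> carrier (FObj R y)" if "g \<in> Hom C y z" for g
    using \<psi> that by (auto simp: Gr_Hom_iff[OF ob(2)])
  have val: "comp gr x y z \<psi> \<phi> h = finsum (FObj R x) (\<lambda>(f, g). FArr R y x f (\<psi> g) \<otimes>\<^bsub>FObj R x\<^esub> \<phi> f)
    {p \<in> X \<times> Y. comp C x y z (snd p) (fst p) = h}" if "h \<in> Hom C x z" for h
    by (rule Gr_comp_eq[OF ob \<phi> \<psi> that]) (use fin in \<open>auto simp: X_def Y_def\<close>)
  have "comp gr x y z \<psi> \<phi> h \<in> carrier (FObj R x)" if "h \<in> Hom C x z" for h
    unfolding val[OF that]
    by (rule finsum_closed) (use R_closed[OF ob(2,1) _ \<psi>c] \<phi>c in \<open>auto simp: X_def Y_def\<close>)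
  moreover have "{h \<in> Hom C x z. comp gr x y z \<psi> \<phi> h \<noteq> \<zero>\<^bsub>FObj R x\<^esub>}
    \<subseteq> (\<lambda>p. comp C x y z (snd p) (fst p)) ` (X \<times> Y)"
  proof
    fix h assume h: "h \<in> {h \<in> Hom C x z. comp gr x y z \<psi> \<phi> h \<noteq> \<zero>\<^bsub>FObj R x\<^esub>}"
    then have "{p \<in> X \<times> Y. comp C x y z (snd p) (fst p) = h} \<noteq> {}"
      using val[of h] by (metis (mono_tags, lifting) finsum_empty mem_Collect_eq)
    then show "h \<in> (\<lambda>p. comp C x y z (snd p) (fst p)) ` (X \<times> Y)" by force
  qed
  then have "finite {h \<in> Hom C x z. comp gr x y z \<psi> \<phi> h \<noteq> \<zero>\<^bsub>FObj R x\<^esub>}"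
    using fin finite_subset by blast
  moreover have "comp gr x y z \<psi> \<phi> \<in> extensional (Hom C x z)" by (simp add: Gr_def)
  ultimately show ?thesis by (auto simp: Gr_Hom_iff[OF ob(1)] PiE_iff)
qed

lemma Gr_comp_add_left:
  assumes ob: "x \<in> Obj C" "y \<in> Obj C" "z \<in> Obj C"
    and \<phi>: "\<phi> \<in> Hom gr x y" and \<psi>: "\<psi> \<in> Hom gr y z" "\<psi>' \<in> Hom gr y z"
  shows "comp gr x y z (\<psi> \<otimes>\<^bsub>hgrp gr y z\<^esub> \<psi>') \<phi>
    = comp gr x y z \<psi> \<phi> \<otimes>\<^bsub>hgrp gr x z\<^esub> comp gr x y z \<psi>' \<phi>"
proof -
  interpret ring "FObj R x" by (rule R_ring[OF ob(1)])
  interpret Ry: ring "FObj R y" by (rule R_ring[OF ob(2)])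
  have sum: "\<psi> \<otimes>\<^bsub>hgrp gr y z\<^esub> \<psi>' \<in> Hom gr y z"
    using \<psi> group.is_monoid[OF Gr_group[OF ob(2)]] monoid.m_closed by (fastforce simp: Gr_simps(2))
  define X where "X = {f \<in> Hom C x y. \<phi> f \<noteq> \<zero>\<^bsub>FObj R x\<^esub>}"
  define Y where "Y = {g \<in> Hom C y z. \<psi> g \<noteq> \<zero>\<^bsub>FObj R y\<^esub>} \<union> {g \<in> Hom C y z. \<psi>' g \<noteq> \<zero>\<^bsub>FObj R y\<^esub>}"
  have X: "finite X" "X \<subseteq> Hom C x y" "{f \<in> Hom C x y. \<phi> f \<noteq> \<zero>\<^bsub>FObj R x\<^esub>} \<subseteq> X"
    using \<phi> by (auto simp: Gr_Hom_iff[OF ob(1)] X_def)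
  have Y: "finite Y" "Y \<subseteq> Hom C y z" "{g \<in> Hom C y z. \<psi> g \<noteq> \<zero>\<^bsub>FObj R y\<^esub>} \<subseteq> Y"
    "{g \<in> Hom C y z. \<psi>' g \<noteq> \<zero>\<^bsub>FObj R y\<^esub>} \<subseteq> Y"
    "{g \<in> Hom C y z. (\<psi> \<otimes>\<^bsub>hgrp gr y z\<^esub> \<psi>') g \<noteq> \<zero>\<^bsub>FObj R y\<^esub>} \<subseteq> Y"
    using \<psi> by (auto simp: Gr_Hom_iff[OF ob(2)] Y_def Gr_add)
  have \<phi>c: "\<phi> f \<in> carrier (FObj R x)" if "f \<in> Hom C x y" for f
    using \<phi> that by (auto simp: Gr_Hom_iff[OF ob(1)])
  have \<psi>c: "\<psi> g \<in> carrier (FObj R y)" "\<psi>' g \<in> carrier (FObj R y)" if "g \<in> Hom C y z" for g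
    using \<psi> that by (auto simp: Gr_Hom_iff[OF ob(2)])
  note eq = Gr_comp_eq[OF ob \<phi> _ _ X Y(1,2)]
  have rc: "FArr R y x f a \<in> carrier (FObj R x)" if "f \<in> Hom C x y" "a \<in> carrier (FObj R y)" for f a
    using R_closed[OF ob(2,1)] that .
  have "comp gr x y z (\<psi> \<otimes>\<^bsub>hgrp gr y z\<^esub> \<psi>') \<phi> h
    = comp gr x y z \<psi> \<phi> h \<oplus>\<^bsub>FObj R x\<^esub> comp gr x y z \<psi>' \<phi> h" if h: "h \<in> Hom C x z" for h
  proof -
    let ?T = "{p \<in> X \<times> Y. comp C x y z (snd p) (fst p) = h}"
    have T: "f \<in> Hom C x y \<and> g \<in> Hom C y z" if "(f, g) \<in> ?T" for f g
      using that X(2) Y(2) by auto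
    have "comp gr x y z (\<psi> \<otimes>\<^bsub>hgrp gr y z\<^esub> \<psi>') \<phi> h = finsum (FObj R x)
      (\<lambda>p. (case p of (f, g) \<Rightarrow> FArr R y x f (\<psi> g) \<otimes>\<^bsub>FObj R x\<^esub> \<phi> f)
        \<oplus>\<^bsub>FObj R x\<^esub> (case p of (f, g) \<Rightarrow> FArr R y x f (\<psi>' g) \<otimes>\<^bsub>FObj R x\<^esub> \<phi> f)) ?T"
      unfolding eq[OF sum h Y(5)]
      by (rule finsum_cong') (use T \<phi>c \<psi>c rc R_add[OF ob(2,1)] in \<open>auto simp: Gr_add l_distr\<close>)
    also have "\<dots> = comp gr x y z \<psi> \<phi> h \<oplus>\<^bsub>FObj R x\<^esub> comp gr x y z \<psi>' \<phi> h"
      unfolding eq[OF \<psi>(1) h Y(3)] eq[OF \<psi>(2) h Y(4)]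
      by (rule finsum_addf) (use T \<phi>c \<psi>c rc in auto)
    finally show ?thesis .
  qed
  then show ?thesis
    by (intro extensionalityI[of _ "Hom C x z"]) (simp_all add: Gr_add, simp add: Gr_def)
qed

lemma Gr_comp_add_right:
  assumes ob: "x \<in> Obj C" "y \<in> Obj C" "z \<in> Obj C"
    and \<phi>: "\<phi> \<in> Hom gr x y" "\<phi>' \<in> Hom gr x y" and \<psi>: "\<psi> \<in> Hom gr y z"
  shows "comp gr x y z \<psi> (\<phi> \<otimes>\<^bsub>hgrp gr x y\<^esub> \<phi>')
    = comp gr x y z \<psi> \<phi> \<otimes>\<^bsub>hgrp gr x z\<^esub> comp gr x y z \<psi> \<phi>'"
proof -
  interpret ring "FObj R x" by (rule R_ring[OF ob(1)])
  have sum: "\<phi> \<otimes>\<^bsub>hgrp gr x y\<^esub> \<phi>' \<in> Hom gr x y"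
    using \<phi> group.is_monoid[OF Gr_group[OF ob(1)]] monoid.m_closed by (fastforce simp: Gr_simps(2))
  define Y where "Y = {g \<in> Hom C y z. \<psi> g \<noteq> \<zero>\<^bsub>FObj R y\<^esub>}"
  define X where "X = {f \<in> Hom C x y. \<phi> f \<noteq> \<zero>\<^bsub>FObj R x\<^esub>} \<union> {f \<in> Hom C x y. \<phi>' f \<noteq> \<zero>\<^bsub>FObj R x\<^esub>}"
  have Y: "finite Y" "Y \<subseteq> Hom C y z" "{g \<in> Hom C y z. \<psi> g \<noteq> \<zero>\<^bsub>FObj R y\<^esub>} \<subseteq> Y"
    using \<psi> by (auto simp: Gr_Hom_iff[OF ob(2)] Y_def)
  have X: "finite X" "X \<subseteq> Hom C x y" "{f \<in> Hom C x y. \<phi> f \<noteq> \<zero>\<^bsub>FObj R x\<^esub>} \<subseteq> X"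
    "{f \<in> Hom C x y. \<phi>' f \<noteq> \<zero>\<^bsub>FObj R x\<^esub>} \<subseteq> X"
    "{f \<in> Hom C x y. (\<phi> \<otimes>\<^bsub>hgrp gr x y\<^esub> \<phi>') f \<noteq> \<zero>\<^bsub>FObj R x\<^esub>} \<subseteq> X"
    using \<phi> by (auto simp: Gr_Hom_iff[OF ob(1)] X_def Gr_add)
  have \<phi>c: "\<phi> f \<in> carrier (FObj R x)" "\<phi>' f \<in> carrier (FObj R x)" if "f \<in> Hom C x y" for f
    using \<phi> that by (auto simp: Gr_Hom_iff[OF ob(1)])
  have \<psi>c: "\<psi> g \<in> carrier (FObj R y)" if "g \<in> Hom C y z" for g
    using \<psi> that by (auto simp: Gr_Hom_iff[OF ob(2)])
  note eq = Gr_comp_eq[OF ob _ \<psi> _ X(1,2) _ Y]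
  have rc: "FArr R y x f a \<in> carrier (FObj R x)" if "f \<in> Hom C x y" "a \<in> carrier (FObj R y)" for f a
    using R_closed[OF ob(2,1)] that .
  have "comp gr x y z \<psi> (\<phi> \<otimes>\<^bsub>hgrp gr x y\<^esub> \<phi>') h
    = comp gr x y z \<psi> \<phi> h \<oplus>\<^bsub>FObj R x\<^esub> comp gr x y z \<psi> \<phi>' h" if h: "h \<in> Hom C x z" for h
  proof -
    let ?T = "{p \<in> X \<times> Y. comp C x y z (snd p) (fst p) = h}"
    have T: "f \<in> Hom C x y \<and> g \<in> Hom C y z" if "(f, g) \<in> ?T" for f g
      using that X(2) Y(2) by auto
    have "comp gr x y z \<psi> (\<phi> \<otimes>\<^bsub>hgrp gr x y\<^esub> \<phi>') h = finsum (FObj R x)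
      (\<lambda>p. (case p of (f, g) \<Rightarrow> FArr R y x f (\<psi> g) \<otimes>\<^bsub>FObj R x\<^esub> \<phi> f)
        \<oplus>\<^bsub>FObj R x\<^esub> (case p of (f, g) \<Rightarrow> FArr R y x f (\<psi> g) \<otimes>\<^bsub>FObj R x\<^esub> \<phi>' f)) ?T"
      unfolding eq[OF sum h X(5)]
      by (rule finsum_cong') (use T \<phi>c \<psi>c rc in \<open>auto simp: Gr_add r_distr\<close>)
    also have "\<dots> = comp gr x y z \<psi> \<phi> h \<oplus>\<^bsub>FObj R x\<^esub> comp gr x y z \<psi> \<phi>' h"
      unfolding eq[OF \<phi>(1) h X(3)] eq[OF \<phi>(2) h X(4)]
      by (rule finsum_addf) (use T \<phi>c \<psi>c rc in auto)
    finally show ?thesis .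
  qed
  then show ?thesis
    by (intro extensionalityI[of _ "Hom C x z"]) (simp_all add: Gr_add, simp add: Gr_def)
qed

lemma Gr_comp_mono:
  assumes ob: "x \<in> Obj C" "y \<in> Obj C" "z \<in> Obj C" and f: "f \<in> Hom C x y" and g: "g \<in> Hom C y z"
    and r: "r \<in> carrier (FObj R x)" and s: "s \<in> carrier (FObj R y)"
  shows "comp gr x y z (monomial y z g s) (monomial x y f r)
    = monomial x z (comp C x y z g f) (FArr R y x f s \<otimes>\<^bsub>FObj R x\<^esub> r)"
proof -
  interpret ring "FObj R x" by (rule R_ring[OF ob(1)])
  note m = monomial_in_Hom[OF ob(1) f r] monomial_in_Hom[OF ob(2) g s]
  have "comp gr x y z (monomial y z g s) (monomial x y f r) h
    = monomial x z (comp C x y z g f) (FArr R y x f s \<otimes>\<^bsub>FObj R x\<^esub> r) h" if h: "h \<in> Hom C x z" for h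
  proof -
    have "comp gr x y z (monomial y z g s) (monomial x y f r) h = finsum (FObj R x)
      (\<lambda>(f', g'). FArr R y x f' (monomial y z g s g') \<otimes>\<^bsub>FObj R x\<^esub> monomial x y f r f')
      {p \<in> {f} \<times> {g}. comp C x y z (snd p) (fst p) = h}"
      by (rule Gr_comp_eq[OF ob m h]) (use f g in \<open>auto simp: monomial_apply split: if_splits\<close>)
    also have "{p \<in> {f} \<times> {g}. comp C x y z (snd p) (fst p) = h}
      = (if h = comp C x y z g f then {(f, g)} else {})" by auto
    finally show ?thesis
      using h f g r R_closed[OF ob(2,1) f s] by (auto simp: monomial_apply)
  qed
  then show ?thesis
    by (intro extensionalityI[of _ "Hom C x z"]) (simp_all add: Gr_def monomial_def single_def)
qed

lemma Gr_hom_zero: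
  assumes ob: "x \<in> Obj C" "y \<in> Obj C" "z \<in> Obj C"
  shows "\<phi> \<in> Hom gr x y \<Longrightarrow> comp gr x y z \<one>\<^bsub>hgrp gr y z\<^esub> \<phi> = \<one>\<^bsub>hgrp gr x z\<^esub>"
    and "\<psi> \<in> Hom gr y z \<Longrightarrow> comp gr x y z \<psi> \<one>\<^bsub>hgrp gr x y\<^esub> = \<one>\<^bsub>hgrp gr x z\<^esub>"
proof -
  show "comp gr x y z \<one>\<^bsub>hgrp gr y z\<^esub> \<phi> = \<one>\<^bsub>hgrp gr x z\<^esub>" if "\<phi> \<in> Hom gr x y"
    using that by (intro hom_one[OF _ Gr_group[OF ob(2)] Gr_group[OF ob(1)],
          of "\<lambda>\<psi>. comp gr x y z \<psi> \<phi>"] homI)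
      (simp_all add: Gr_comp_add_left[OF ob] Gr_comp_in_Hom[OF ob] flip: Gr_simps(2))
  show "comp gr x y z \<psi> \<one>\<^bsub>hgrp gr x y\<^esub> = \<one>\<^bsub>hgrp gr x z\<^esub>" if "\<psi> \<in> Hom gr y z"
    using that by (intro hom_one[OF _ Gr_group[OF ob(1)] Gr_group[OF ob(1)],
          of "comp gr x y z \<psi>"] homI)
      (simp_all add: Gr_comp_add_right[OF ob] Gr_comp_in_Hom[OF ob] flip: Gr_simps(2))
qed

lemma Gr_add_in_Hom: "x \<in> Obj C \<Longrightarrow> u \<in> Hom gr x y \<Longrightarrow> v \<in> Hom gr x y \<Longrightarrow>
    u \<otimes>\<^bsub>hgrp gr x y\<^esub> v \<in> Hom gr x y"
  using monoid.m_closed[OF group.is_monoid[OF Gr_group]] by (simp add: Gr_simps(2))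

lemma Gr_zero_in_Hom: "x \<in> Obj C \<Longrightarrow> \<one>\<^bsub>hgrp gr x y\<^esub> \<in> Hom gr x y"
  using monoid.one_closed[OF group.is_monoid[OF Gr_group]] by (simp add: Gr_simps(2))

text \<open>Both sides are additive in each of the three morphisms. On monomials the identity is the
  functoriality and multiplicativity of \<open>R\<close>.\<close>

lemma Gr_assoc:
  assumes ob: "w \<in> Obj C" "x \<in> Obj C" "y \<in> Obj C" "z \<in> Obj C"
    and \<phi>: "\<phi> \<in> Hom gr w x" and \<psi>: "\<psi> \<in> Hom gr x y" and \<chi>: "\<chi> \<in> Hom gr y z"
  shows "comp gr w y z \<chi> (comp gr w x y \<psi> \<phi>) = comp gr w x z (comp gr x y z \<chi> \<psi>) \<phi>"
proof -
  note [simp] = ob Gr_comp_add_left Gr_comp_add_right Gr_comp_in_Hom Gr_hom_zero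
    Gr_zero_in_Hom monomial_in_Hom comp_in_Hom R_closed ring.ring_simprules(5)[OF R_ring]
  interpret Rw: ring "FObj R w" using R_ring ob by blast
  interpret Rx: ring "FObj R x" using R_ring ob by blast
  have step1: "comp gr w y z (monomial y z h t) (comp gr w x y (monomial x y g s) (monomial w x f r))
      = comp gr w x z (comp gr x y z (monomial y z h t) (monomial x y g s)) (monomial w x f r)"
    if "f \<in> Hom C w x" "g \<in> Hom C x y" "h \<in> Hom C y z"
      "r \<in> carrier (FObj R w)" "s \<in> carrier (FObj R x)" "t \<in> carrier (FObj R y)" for f g h r s t
    using that by (simp add: Gr_comp_mono R_comp[OF ob(3,2,1)] R_mult comp_assoc Rw.m_assoc)
  have step2: "comp gr w y z (monomial y z h t) (comp gr w x y (monomial x y g s) \<phi>)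
      = comp gr w x z (comp gr x y z (monomial y z h t) (monomial x y g s)) \<phi>"
    if that: "g \<in> Hom C x y" "h \<in> Hom C y z" "s \<in> carrier (FObj R x)" "t \<in> carrier (FObj R y)" for g h s t
    using ob(1) \<phi> by (induction rule: Gr_induct) (use that in \<open>simp_all add: step1\<close>)
  have step3: "comp gr w y z (monomial y z h t) (comp gr w x y \<psi> \<phi>)
      = comp gr w x z (comp gr x y z (monomial y z h t) \<psi>) \<phi>"
    if that: "h \<in> Hom C y z" "t \<in> carrier (FObj R y)" for h t
    using ob(2) \<psi> by (induction rule: Gr_induct) (use that \<phi> in \<open>simp_all add: step2\<close>)
  show ?thesis
    using ob(3) \<chi> by (induction rule: Gr_induct) (use \<phi> \<psi> in \<open>simp_all add: step3\<close>)
qed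

sublocale gr: preadditive gr
proof (intro preadditive.intro category.intro preadditive_axioms.intro; (unfold Gr_simps(1))?)
  fix x assume x: "x \<in> Obj C"
  interpret Rx: ring "FObj R x" by (rule R_ring[OF x])
  show idx: "ident gr x \<in> Hom gr x x"
    unfolding Gr_ident using x ident_in_Hom by (intro monomial_in_Hom) auto
  fix y assume y: "y \<in> Obj C"
  interpret Ry: ring "FObj R y" by (rule R_ring[OF y])
  have idy: "ident gr y \<in> Hom gr y y"
    unfolding Gr_ident using y ident_in_Hom by (intro monomial_in_Hom) auto
  show "comm_group (hgrp gr x y)" using x by (rule Gr_comm_group)
  show "carrier (hgrp gr x y) = Hom gr x y" by (simp add: Gr_simps)
  fix \<phi> assume \<phi>: "\<phi> \<in> Hom gr x y"
  show "comp gr x y y (ident gr y) \<phi> = \<phi>"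
    using x \<phi>
  proof (induction rule: Gr_induct)
    case zero show ?case using Gr_hom_zero(2)[OF x y y idy] .
  next
    case (monomial f)
    then show ?case using x y ident_in_Hom
      by (simp add: Gr_ident Gr_comp_mono R_one comp_ident_left)
  next
    case (add u v)
    then show ?case using Gr_comp_add_right[OF x y y _ _ idy] by simp
  qed
  show "comp gr x x y \<phi> (ident gr x) = \<phi>"
    using x \<phi>
  proof (induction rule: Gr_induct)
    case zero show ?case using Gr_hom_zero(1)[OF x x y idx] .
  next
    case (monomial f)
    then show ?case using x y ident_in_Hom
      by (simp add: Gr_ident Gr_comp_mono R_ident comp_ident_right)
  next
    case (add u v)
    then show ?case using Gr_comp_add_left[OF x x y idx] by simp
  qed
  fix z assume z: "z \<in> Obj C"
  fix \<psi> assume \<psi>: "\<psi> \<in> Hom gr y z"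
  show "comp gr x y z \<psi> \<phi> \<in> Hom gr x z" using Gr_comp_in_Hom x y z \<phi> \<psi> .
  show "comp gr x y z \<psi> (\<phi> \<otimes>\<^bsub>hgrp gr x y\<^esub> \<phi>') = comp gr x y z \<psi> \<phi> \<otimes>\<^bsub>hgrp gr x z\<^esub> comp gr x y z \<psi> \<phi>'"
    if "\<phi>' \<in> Hom gr x y" for \<phi>' using Gr_comp_add_right x y z \<phi> that \<psi> .
  show "comp gr x y z (\<psi> \<otimes>\<^bsub>hgrp gr y z\<^esub> \<psi>') \<phi> = comp gr x y z \<psi> \<phi> \<otimes>\<^bsub>hgrp gr x z\<^esub> comp gr x y z \<psi>' \<phi>"
    if "\<psi>' \<in> Hom gr y z" for \<psi>' using Gr_comp_add_left x y z \<phi> \<psi> that .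
next
  show "comp gr w y z \<chi> (comp gr w x y \<psi> \<phi>) = comp gr w x z (comp gr x y z \<chi> \<psi>) \<phi>"
    if "w \<in> Obj C" "x \<in> Obj C" "y \<in> Obj C" "z \<in> Obj C"
      "\<phi> \<in> Hom gr w x" "\<psi> \<in> Hom gr x y" "\<chi> \<in> Hom gr y z" for w x y z \<phi> \<psi> \<chi>
    using Gr_assoc that .
qed

end

section \<open>Covering sieves\<close>

lemma sieveD:
  assumes "sieve C x S"
  shows "y \<in> Obj C \<Longrightarrow> f \<in> S y \<Longrightarrow> f \<in> Hom C y x"
    and "y \<in> Obj C \<Longrightarrow> z \<in> Obj C \<Longrightarrow> f \<in> S y \<Longrightarrow> g \<in> Hom C z y \<Longrightarrow> comp C z y x f g \<in> S z"
  using assms by (auto simp: sieve_def)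

context grothendieck_topology
begin

lemma sieve_pullback:
  assumes "x \<in> Obj C" "y \<in> Obj C" "f \<in> Hom C y x" "sieve C x S"
  shows "sieve C y (pullback_sieve C y x f S)"
  unfolding sieve_def
proof (intro conjI ballI allI impI)
  fix z w g h assume z: "z \<in> Obj C" and w: "w \<in> Obj C" and g: "g \<in> pullback_sieve C y x f S z"
    and h: "h \<in> Hom C w z"
  then have "g \<in> Hom C z y" "comp C z y x f g \<in> S z" by (auto simp: pullback_sieve_def)
  then show "comp C w z y g h \<in> pullback_sieve C y x f S w"
    using assms z w h sieveD(2)[OF assms(4) z w, of "comp C z y x f g" h]
    by (simp add: pullback_sieve_def comp_in_Hom comp_assoc[of w z y x h g f])
qed (auto simp: pullback_sieve_def)

text \<open>The pullback of \<open>T\<close> along a morphism of \<open>S\<close> is the maximal sieve.\<close>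

lemma covering_superset:
  assumes x: "x \<in> Obj C" and S: "S \<in> J x" and T: "sieve C x T"
    and sub: "\<And>y. y \<in> Obj C \<Longrightarrow> S y \<subseteq> T y"
  shows "T \<in> J x"
proof (rule transitive[OF x S T])
  fix y f assume y: "y \<in> Obj C" and f: "f \<in> S y"
  have "f \<in> T y" "f \<in> Hom C y x" using sub[OF y] f sieveD(1)[OF T y] by auto
  then have "pullback_sieve C y x f T = max_sieve C y"
    using sieveD(2)[OF T y] by (auto simp: pullback_sieve_def max_sieve_def fun_eq_iff)
  then show "pullback_sieve C y x f T \<in> J y" using max_sieve_covering y by simp
qed

text \<open>The pullback of the intersection along a morphism of \<open>S\<close> contains the pullback of \<open>T\<close>.\<close>

lemma covering_Int:
  assumes x: "x \<in> Obj C" and S: "S \<in> J x" and T: "T \<in> J x"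
  shows "(\<lambda>y. S y \<inter> T y) \<in> J x"
proof -
  note sS = covering_sieve[OF x S] and sT = covering_sieve[OF x T]
  have ST: "sieve C x (\<lambda>y. S y \<inter> T y)" using sS sT by (auto simp: sieve_def)
  show ?thesis
  proof (rule transitive[OF x S ST])
    fix y f assume y: "y \<in> Obj C" and f: "f \<in> S y"
    have fx: "f \<in> Hom C y x" using sieveD(1)[OF sS y f] .
    show "pullback_sieve C y x f (\<lambda>y. S y \<inter> T y) \<in> J y"
      by (rule covering_superset[OF y stable[OF x y T fx] sieve_pullback[OF x y fx ST]])
        (use sieveD(2)[OF sS y _ f] in \<open>auto simp: pullback_sieve_def\<close>)
  qed
qed

end

section \<open>The induced linear topology\<close>

locale algebra_site = algebra_presheaf C K R + top: grothendieck_topology C J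
  for C :: "('o, 'a) category" and K :: "'k ring"
    and R :: "('o, 'a, ('k, 'r) module, 'r \<Rightarrow> 'r) cfunctor"
    and J :: "'o \<Rightarrow> ('o \<Rightarrow> 'a set) set"
begin

text \<open>The action on morphisms of the functor from \<open>C\<close> to its linear Grothendieck construction that is the
  identity on objects.\<close>

definition emb :: "'o \<Rightarrow> 'o \<Rightarrow> 'a \<Rightarrow> 'a \<Rightarrow> 'r" where
  "emb x y f = monomial x y f \<one>\<^bsub>FObj R x\<^esub>"

lemma R_monoid: "x \<in> Obj C \<Longrightarrow> monoid (FObj R x)"
  using R_ring ring.is_monoid by blast

lemma R_one_closed: "x \<in> Obj C \<Longrightarrow> \<one>\<^bsub>FObj R x\<^esub> \<in> carrier (FObj R x)"
  using R_monoid monoid.one_closed by blast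

lemma emb_in_Hom: "x \<in> Obj C \<Longrightarrow> f \<in> Hom C x y \<Longrightarrow> emb x y f \<in> Hom gr x y"
  by (simp add: emb_def monomial_in_Hom R_one_closed)

lemma emb_comp:
  assumes "x \<in> Obj C" "y \<in> Obj C" "z \<in> Obj C" "f \<in> Hom C y x" "g \<in> Hom C z y"
  shows "comp gr z y x (emb y x f) (emb z y g) = emb z x (comp C z y x f g)"
  using assms by (simp add: emb_def Gr_comp_mono R_one_closed R_one R_monoid monoid.r_one)

lemma emb_comp_scalar:
  assumes "x \<in> Obj C" "y \<in> Obj C" "f \<in> Hom C y x" "r \<in> carrier (FObj R y)"
  shows "comp gr y y x (emb y x f) (monomial y y (ident C y) r) = monomial y x f r"
  using assms ident_in_Hom[of y]
  by (simp add: emb_def Gr_comp_mono R_one_closed R_one R_monoid comp_ident_right)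

text \<open>The submodule of \<open>Hom(-, x)\<close> generated by the sieve \<open>T\<close> consists of the families supported in \<open>T\<close>.\<close>

definition lin :: "'o \<Rightarrow> ('o \<Rightarrow> 'a set) \<Rightarrow> 'o \<Rightarrow> ('a \<Rightarrow> 'r) set" where
  "lin x T y = (if y \<in> Obj C then
    {\<phi> \<in> Hom gr y x. \<forall>f \<in> Hom C y x. f \<notin> T y \<longrightarrow> \<phi> f = \<zero>\<^bsub>FObj R y\<^esub>} else {})"

text \<open>The restriction of a linear sieve to \<open>C\<close>.\<close>

definition trace :: "'o \<Rightarrow> ('o \<Rightarrow> ('a \<Rightarrow> 'r) set) \<Rightarrow> 'o \<Rightarrow> 'a set" where
  "trace x S y = (if y \<in> Obj C then {f \<in> Hom C y x. emb y x f \<in> S y} else {})"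

definition lintop :: "'o \<Rightarrow> ('o \<Rightarrow> ('a \<Rightarrow> 'r) set) set" where
  "lintop x = {S. linear_sieve gr x S \<and> trace x S \<in> J x}"

lemma lin_Hom: "y \<in> Obj C \<Longrightarrow> \<phi> \<in> lin x T y \<Longrightarrow> \<phi> \<in> Hom gr y x"
  by (simp add: lin_def)

lemma lin_induct [consumes 2, case_names zero monomial add]:
  assumes y: "y \<in> Obj C" and \<phi>: "\<phi> \<in> lin x T y"
    and zero: "P \<one>\<^bsub>hgrp gr y x\<^esub>"
    and monomial: "\<And>f r. f \<in> Hom C y x \<Longrightarrow> f \<in> T y \<Longrightarrow> r \<in> carrier (FObj R y) \<Longrightarrow> P (monomial y x f r)"
    and add: "\<And>u v. u \<in> Hom gr y x \<Longrightarrow> v \<in> Hom gr y x \<Longrightarrow> P u \<Longrightarrow> P v \<Longrightarrow> P (u \<otimes>\<^bsub>hgrp gr y x\<^esub> v)"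
  shows "P \<phi>"
  using y lin_Hom[OF y \<phi>]
proof (induction rule: Gr_induct)
  case (monomial f)
  then have "f \<in> T y" using \<phi> y by (auto simp: lin_def)
  then show ?case using assms(4) monomial by blast
qed (use zero add in auto)

lemma monomial_in_lin:
  assumes "y \<in> Obj C" "f \<in> Hom C y x" "f \<in> T y" "r \<in> carrier (FObj R y)"
  shows "monomial y x f r \<in> lin x T y"
  using assms by (auto simp: lin_def monomial_in_Hom monomial_apply)

lemma subgroup_lin:
  assumes y: "y \<in> Obj C"
  shows "subgroup (lin x T y) (hgrp gr y x)"
proof -
  interpret Ry: ring "FObj R y" by (rule R_ring[OF y])
  interpret H: group "hgrp gr y x" by (rule Gr_group[OF y])
  show ?thesis
  proof (rule H.subgroupI)
    show "lin x T y \<subseteq> carrier (hgrp gr y x)" using y by (auto simp: lin_def Gr_simps(2))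
    have "\<one>\<^bsub>hgrp gr y x\<^esub> \<in> lin x T y" using y Gr_zero_in_Hom[OF y] by (simp add: lin_def Gr_zero)
    then show "lin x T y \<noteq> {}" by blast
    fix \<phi> assume \<phi>: "\<phi> \<in> lin x T y"
    then have "\<phi> \<in> carrier (hgrp gr y x)" using lin_Hom[OF y] by (simp add: Gr_simps(2))
    moreover from this have "inv\<^bsub>hgrp gr y x\<^esub> \<phi> = (\<lambda>f \<in> Hom C y x. \<ominus>\<^bsub>FObj R y\<^esub> \<phi> f)"
      using R_add_group[OF y] by (simp add: Gr_simps(3) a_inv_def)
    ultimately show "inv\<^bsub>hgrp gr y x\<^esub> \<phi> \<in> lin x T y"
      using \<phi> y H.inv_closed[of \<phi>] by (simp add: lin_def Gr_simps(2))
    fix \<psi> assume "\<psi> \<in> lin x T y"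
    then show "\<phi> \<otimes>\<^bsub>hgrp gr y x\<^esub> \<psi> \<in> lin x T y"
      using \<phi> y Gr_add_in_Hom[OF y] by (simp add: lin_def Gr_add)
  qed
qed

lemma lin_comp:
  assumes ob: "x \<in> Obj C" "y \<in> Obj C" "z \<in> Obj C" and T: "sieve C x T"
    and \<phi>: "\<phi> \<in> lin x T y" and \<psi>: "\<psi> \<in> Hom gr z y"
  shows "comp gr z y x \<phi> \<psi> \<in> lin x T z"
proof -
  note sub = subgroup_lin[OF ob(3), of x T]
  have one: "\<one>\<^bsub>hgrp gr z x\<^esub> \<in> lin x T z" using subgroup.one_closed[OF sub] .
  have *: "comp gr z y x (monomial y x f r) \<psi> \<in> lin x T z"
    if that: "f \<in> Hom C y x" "f \<in> T y" "r \<in> carrier (FObj R y)" for f r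
    using ob(3) \<psi>
  proof (induction rule: Gr_induct)
    case zero then show ?case using that one ob by (simp add: Gr_hom_zero monomial_in_Hom)
  next
    case (monomial g)
    then show ?case using that ob sieveD(2)[OF T ob(2,3) that(2)]
      by (simp add: Gr_comp_mono monomial_in_lin comp_in_Hom R_closed R_monoid monoid.m_closed)
  next
    case (add u v)
    then show ?case using that ob subgroup.m_closed[OF sub] by (simp add: Gr_comp_add_right monomial_in_Hom)
  qed
  show ?thesis
    using ob(2) \<phi>
  proof (induction rule: lin_induct)
    case zero then show ?case using one ob \<psi> by (simp add: Gr_hom_zero)
  next
    case (monomial f r) then show ?case by (rule *)
  next
    case (add u v)
    then show ?case using ob \<psi> subgroup.m_closed[OF sub] by (simp add: Gr_comp_add_left)
  qed
qed

lemma linear_sieve_lin: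
  assumes x: "x \<in> Obj C" and T: "sieve C x T"
  shows "linear_sieve gr x (lin x T)"
  unfolding linear_sieve_def sieve_def Gr_simps(1)
proof (intro conjI ballI allI impI)
  fix y assume y: "y \<in> Obj C"
  show "lin x T y \<subseteq> Hom gr y x" using lin_Hom[OF y] by blast
  show "subgroup (lin x T y) (hgrp gr y x)" using subgroup_lin[OF y] .
  fix z \<phi> \<psi> assume "z \<in> Obj C" "\<phi> \<in> lin x T y" "\<psi> \<in> Hom gr z y"
  then show "comp gr z y x \<phi> \<psi> \<in> lin x T z" using lin_comp[OF x y _ T] by blast
qed (simp add: lin_def)

lemma linear_sieveD:
  assumes "linear_sieve gr x S"
  shows "y \<in> Obj C \<Longrightarrow> \<phi> \<in> S y \<Longrightarrow> \<phi> \<in> Hom gr y x"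
    and "y \<in> Obj C \<Longrightarrow> z \<in> Obj C \<Longrightarrow> \<phi> \<in> S y \<Longrightarrow> \<psi> \<in> Hom gr z y \<Longrightarrow> comp gr z y x \<phi> \<psi> \<in> S z"
    and "y \<in> Obj C \<Longrightarrow> subgroup (S y) (hgrp gr y x)"
  using assms by (auto simp: linear_sieve_def sieve_def Gr_simps(1))

text \<open>A linear sieve contains the multiples of its morphisms from \<open>C\<close>, and their sums.\<close>

lemma lin_trace_subset:
  assumes x: "x \<in> Obj C" and S: "linear_sieve gr x S" and y: "y \<in> Obj C"
    and \<phi>: "\<phi> \<in> lin x (trace x S) y"
  shows "\<phi> \<in> S y"
  using y \<phi>
proof (induction rule: lin_induct)
  case zero show ?case using subgroup.one_closed[OF linear_sieveD(3)[OF S y]] .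
next
  case (monomial f r)
  then have "emb y x f \<in> S y" using y by (simp add: trace_def)
  then show ?case
    using linear_sieveD(2)[OF S y y, of "emb y x f" "monomial y y (ident C y) r"] x y monomial
      emb_comp_scalar[OF x y] monomial_in_Hom[OF y] ident_in_Hom[OF y] by simp
next
  case (add u v)
  then show ?case using subgroup.m_closed[OF linear_sieveD(3)[OF S y]] by blast
qed

lemma sieve_trace:
  assumes x: "x \<in> Obj C" and S: "linear_sieve gr x S"
  shows "sieve C x (trace x S)"
  unfolding sieve_def
proof (intro conjI ballI allI impI)
  fix y z f g assume yz: "y \<in> Obj C" "z \<in> Obj C" and f: "f \<in> trace x S y" and g: "g \<in> Hom C z y"
  have "f \<in> Hom C y x" "emb y x f \<in> S y" using f yz by (auto simp: trace_def)
  then show "comp C z y x f g \<in> trace x S z"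
    using linear_sieveD(2)[OF S yz, of "emb y x f" "emb z y g"] x yz g
    by (simp add: trace_def emb_comp emb_in_Hom comp_in_Hom)
qed (auto simp: trace_def)

lemma trace_lin:
  assumes x: "x \<in> Obj C" and T: "T \<in> J x"
  shows "lin x T \<in> lintop x"
proof -
  note sT = top.covering_sieve[OF x T]
  have "trace x (lin x T) \<in> J x"
    by (rule top.covering_superset[OF x T sieve_trace[OF x linear_sieve_lin[OF x sT]]])
      (auto simp: trace_def sieveD(1)[OF sT] emb_def monomial_in_lin R_one_closed)
  then show ?thesis using linear_sieve_lin[OF x sT] by (simp add: lintop_def)
qed

text \<open>A single component \<open>r\<close> at \<open>f\<close> pulls \<open>T\<close> back to a sieve containing the pullback along \<open>f\<close>. For a sum
  of finitely many components one intersects.\<close>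

lemma covering_pullback_Gr:
  assumes ob: "x \<in> Obj C" "y \<in> Obj C" and T: "T \<in> J x" and \<phi>: "\<phi> \<in> Hom gr y x"
  obtains T' where "T' \<in> J y"
    "\<And>z g. z \<in> Obj C \<Longrightarrow> g \<in> T' z \<Longrightarrow> comp gr z y x \<phi> (emb z y g) \<in> lin x T z"
proof -
  let ?P = "\<lambda>\<phi>. \<exists>T' \<in> J y. \<forall>z \<in> Obj C. \<forall>g \<in> T' z. comp gr z y x \<phi> (emb z y g) \<in> lin x T z"
  have g_Hom: "g \<in> Hom C z y" if "T' \<in> J y" "z \<in> Obj C" "g \<in> T' z" for T' z g
    using top.covering_sieve[OF ob(2) that(1)] that(2,3) by (rule sieveD(1))
  have "?P \<phi>"
    using ob(2) \<phi>
  proof (induction rule: Gr_induct)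
    case zero
    have "comp gr z y x \<one>\<^bsub>hgrp gr y x\<^esub> (emb z y g) \<in> lin x T z"
      if "z \<in> Obj C" "g \<in> max_sieve C y z" for z g
      using that ob subgroup.one_closed[OF subgroup_lin[OF that(1), of x T]]
      by (simp add: max_sieve_def Gr_hom_zero emb_in_Hom)
    then show ?case using top.max_sieve_covering[OF ob(2)] by blast
  next
    case (monomial f)
    have "comp gr z y x (monomial y x f (\<phi> f)) (emb z y g) \<in> lin x T z"
      if "z \<in> Obj C" "g \<in> pullback_sieve C y x f T z" for z g
      using that monomial ob
      by (auto simp: pullback_sieve_def emb_def Gr_comp_mono R_one_closed comp_in_Hom R_closed
          R_monoid monoid.r_one intro!: monomial_in_lin)
    then show ?case using top.stable[OF ob T monomial(1)] by blast
  next
    case (add u v)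
    then obtain T1 T2 where T12: "T1 \<in> J y" "T2 \<in> J y"
      "\<And>z g. z \<in> Obj C \<Longrightarrow> g \<in> T1 z \<Longrightarrow> comp gr z y x u (emb z y g) \<in> lin x T z"
      "\<And>z g. z \<in> Obj C \<Longrightarrow> g \<in> T2 z \<Longrightarrow> comp gr z y x v (emb z y g) \<in> lin x T z"
      by blast
    have "comp gr z y x (u \<otimes>\<^bsub>hgrp gr y x\<^esub> v) (emb z y g) \<in> lin x T z"
      if z: "z \<in> Obj C" and g: "g \<in> T1 z \<inter> T2 z" for z g
    proof -
      have gT: "g \<in> T1 z" "g \<in> T2 z" using g by auto
      have e: "emb z y g \<in> Hom gr z y" using emb_in_Hom[OF z g_Hom[OF T12(1) z gT(1)]] .
      show ?thesis
        unfolding Gr_comp_add_left[OF z ob(2,1) e add(1,2)]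
        using subgroup.m_closed[OF subgroup_lin[OF z, of x T] T12(3)[OF z gT(1)] T12(4)[OF z gT(2)]] .
    qed
    then show ?case by (intro bexI[OF _ top.covering_Int[OF ob(2) T12(1,2)]] ballI)
  qed
  then show thesis using that by blast
qed

text \<open>Transitivity is inherited from \<open>J\<close>, since the trace of the pullback of a linear sieve along a morphism
  of \<open>C\<close> is the pullback of the trace. For stability one needs pullbacks along arbitrary morphisms, for
  which \<open>covering_pullback_Gr\<close> is made.\<close>

lemma linear_topology_lintop: "linear_topology gr lintop"
proof (intro linear_topology.intro linear_topology_axioms.intro gr.preadditive_axioms; (unfold Gr_simps(1))?)
  fix x S assume "x \<in> Obj C" "S \<in> lintop x"
  then show "linear_sieve gr x S" by (simp add: lintop_def)
next
  fix x assume x: "x \<in> Obj C"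
  have "linear_sieve gr x (max_sieve gr x)"
    unfolding linear_sieve_def sieve_def Gr_simps(1)
  proof (intro conjI ballI allI impI)
    fix y assume y: "y \<in> Obj C"
    show "subgroup (max_sieve gr x y) (hgrp gr y x)"
      using group.subgroup_self[OF Gr_group[OF y]] y
      by (simp add: max_sieve_def Gr_simps(1) Gr_simps(2))
    fix z \<phi> \<psi> assume "z \<in> Obj C" "\<phi> \<in> max_sieve gr x y" "\<psi> \<in> Hom gr z y"
    then show "comp gr z y x \<phi> \<psi> \<in> max_sieve gr x z"
      using Gr_comp_in_Hom[OF _ y x] y by (simp add: max_sieve_def Gr_simps(1))
  qed (simp_all add: max_sieve_def Gr_simps(1))
  moreover have "trace x (max_sieve gr x) = max_sieve C x"
    using emb_in_Hom by (auto simp: trace_def max_sieve_def Gr_simps(1) fun_eq_iff)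
  ultimately show "max_sieve gr x \<in> lintop x"
    using top.max_sieve_covering[OF x] by (simp add: lintop_def)
next
  fix x y S \<phi> assume xy: "x \<in> Obj C" "y \<in> Obj C" and "S \<in> lintop x" and \<phi>: "\<phi> \<in> Hom gr y x"
  then have S: "linear_sieve gr x S" and tS: "trace x S \<in> J x" by (auto simp: lintop_def)
  have lin: "linear_sieve gr y (pullback_sieve gr y x \<phi> S)"
    unfolding linear_sieve_def sieve_def Gr_simps(1)
  proof (intro conjI ballI allI impI)
    fix z assume z: "z \<in> Obj C"
    interpret hom: group_hom "hgrp gr z y" "hgrp gr z x" "comp gr z y x \<phi>"
      using gr.comp_hom_right[of z y x \<phi>] xy z \<phi> by (simp add: Gr_simps(1))
    show "subgroup (pullback_sieve gr y x \<phi> S z) (hgrp gr z y)"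
      using subgroup.one_closed[OF linear_sieveD(3)[OF S z]]
        subgroup.m_closed[OF linear_sieveD(3)[OF S z]]
        subgroup.m_inv_closed[OF linear_sieveD(3)[OF S z]] z
      by (intro hom.G.subgroupI)
        (auto simp: pullback_sieve_def Gr_simps(1) Gr_simps(2) intro!: exI[of _ "\<one>\<^bsub>hgrp gr z y\<^esub>"])
  next
    fix z w \<psi> \<chi> assume zw: "z \<in> Obj C" "w \<in> Obj C" and \<psi>: "\<psi> \<in> pullback_sieve gr y x \<phi> S z"
      and \<chi>: "\<chi> \<in> Hom gr w z"
    then have "\<psi> \<in> Hom gr z y" "comp gr z y x \<phi> \<psi> \<in> S z"
      by (auto simp: pullback_sieve_def Gr_simps(1))
    then show "comp gr w z y \<psi> \<chi> \<in> pullback_sieve gr y x \<phi> S w"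
      using linear_sieveD(2)[OF S zw, of "comp gr z y x \<phi> \<psi>" \<chi>] xy zw \<phi> \<chi>
      by (simp add: pullback_sieve_def Gr_simps(1) Gr_comp_in_Hom Gr_assoc[of w z y x \<chi> \<psi> \<phi>])
  qed (auto simp: pullback_sieve_def Gr_simps(1))
  obtain T' where T': "T' \<in> J y"
    "\<And>z g. z \<in> Obj C \<Longrightarrow> g \<in> T' z \<Longrightarrow> comp gr z y x \<phi> (emb z y g) \<in> lin x (trace x S) z"
    using covering_pullback_Gr[OF xy tS \<phi>] by blast
  have "trace y (pullback_sieve gr y x \<phi> S) \<in> J y"
    by (rule top.covering_superset[OF xy(2) T'(1) sieve_trace[OF xy(2) lin]])
      (use sieveD(1)[OF top.covering_sieve[OF xy(2) T'(1)]] T'(2) lin_trace_subset[OF xy(1) S] in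
        \<open>auto simp: trace_def pullback_sieve_def Gr_simps(1) emb_in_Hom\<close>)
  then show "pullback_sieve gr y x \<phi> S \<in> lintop y" using lin by (simp add: lintop_def)
next
  fix x S T assume x: "x \<in> Obj C" and "S \<in> lintop x" and T: "linear_sieve gr x T"
    and loc: "\<And>y \<phi>. y \<in> Obj C \<Longrightarrow> \<phi> \<in> S y \<Longrightarrow> pullback_sieve gr y x \<phi> T \<in> lintop y"
  then have tS: "trace x S \<in> J x" by (auto simp: lintop_def)
  have "trace x T \<in> J x"
  proof (rule top.transitive[OF x tS sieve_trace[OF x T]])
    fix y f assume y: "y \<in> Obj C" and f: "f \<in> trace x S y"
    then have f': "f \<in> Hom C y x" "emb y x f \<in> S y" by (auto simp: trace_def)
    have "trace y (pullback_sieve gr y x (emb y x f) T) = pullback_sieve C y x f (trace x T)"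
      using x y f' by (auto simp: trace_def pullback_sieve_def Gr_simps(1) emb_in_Hom emb_comp
          comp_in_Hom fun_eq_iff)
    then show "pullback_sieve C y x f (trace x T) \<in> J y"
      using loc[OF y f'(2)] by (simp add: lintop_def)
  qed
  then show "T \<in> lintop x" using T by (simp add: lintop_def)
qed

end

section \<open>Torsion elements\<close>

context algebra_site
begin

definition tors :: "('o, 'a \<Rightarrow> 'r, 'p monoid, 'p \<Rightarrow> 'p) cfunctor \<Rightarrow> 'o \<Rightarrow> 'p set" where
  "tors F x = {m \<in> carrier (FObj F x).
    \<exists>T \<in> J x. \<forall>y \<in> Obj C. \<forall>f \<in> T y. FArr F x y (emb y x f) m = \<one>\<^bsub>FObj F y\<^esub>}"

lemma torsI:
  assumes "m \<in> carrier (FObj F x)" "T \<in> J x"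
    and "\<And>y f. y \<in> Obj C \<Longrightarrow> f \<in> T y \<Longrightarrow> FArr F x y (emb y x f) m = \<one>\<^bsub>FObj F y\<^esub>"
  shows "m \<in> tors F x"
  unfolding tors_def using assms by (intro CollectI conjI bexI[of _ T] ballI)

lemma cover_Hom: "x \<in> Obj C \<Longrightarrow> T \<in> J x \<Longrightarrow> y \<in> Obj C \<Longrightarrow> f \<in> T y \<Longrightarrow> f \<in> Hom C y x"
  using top.covering_sieve sieveD(1) by metis

text \<open>Every monomial factors through a morphism of \<open>C\<close>: it is the composite of \<open>f\<close> and multiplication by
  \<open>r\<close>.\<close>

lemma killed_by_lin:
  assumes F: "amodule gr F" and ob: "x \<in> Obj C" "y \<in> Obj C" and m: "m \<in> carrier (FObj F x)"
    and kill: "\<And>f. f \<in> Hom C y x \<Longrightarrow> f \<in> T y \<Longrightarrow> FArr F x y (emb y x f) m = \<one>\<^bsub>FObj F y\<^esub>"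
    and \<phi>: "\<phi> \<in> lin x T y"
  shows "FArr F x y \<phi> m = \<one>\<^bsub>FObj F y\<^esub>"
proof -
  interpret F: amodule gr F by fact
  interpret Fy: group "FObj F y" using F.grp ob by (simp add: Gr_simps(1))
  interpret h: group_hom "hgrp gr y x" "FObj F y" "\<lambda>\<phi>. FArr F x y \<phi> m"
    using F.act_on_hom ob m by (simp add: Gr_simps(1))
  show ?thesis
    using ob(2) \<phi>
  proof (induction rule: lin_induct)
    case zero show ?case by (rule h.hom_one)
  next
    case (monomial f r)
    have "FArr F x y (monomial y x f r) m = FArr F y y (monomial y y (ident C y) r) (FArr F x y (emb y x f) m)"
      using F.act_comp[of x y y "emb y x f" "monomial y y (ident C y) r" m] ob m monomial
      by (simp add: Gr_simps(1) emb_comp_scalar emb_in_Hom monomial_in_Hom ident_in_Hom)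
    then show ?case
      using kill[OF monomial(1,2)] F.act_one[of y y] ob monomial by (simp add: Gr_simps(1) monomial_in_Hom ident_in_Hom)
  next
    case (add u v)
    then show ?case using h.hom_mult[of u v] by (simp add: Gr_simps(2))
  qed
qed

text \<open>Sums are treated by intersecting covers. For the action of a morphism, the cover of the element is
  pulled back by \<open>covering_pullback_Gr\<close>.\<close>

lemma is_submodule_tors:
  assumes F: "amodule gr F"
  shows "is_submodule gr F (tors F)"
proof -
  interpret F: amodule gr F by fact
  note ob_simp = Gr_simps(1)
  have car: "m \<in> carrier (FObj F x)" if "m \<in> tors F x" for x m using that by (simp add: tors_def)
  have sg: "subgroup (tors F x) (FObj F x)" if x: "x \<in> Obj C" for x
  proof -
    interpret Fx: group "FObj F x" using F.grp x by (simp add: ob_simp)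
    have act: "FArr F x y (emb y x f) u \<in> carrier (FObj F y)"
      "FArr F x y (emb y x f) (u \<otimes>\<^bsub>FObj F x\<^esub> v)
        = FArr F x y (emb y x f) u \<otimes>\<^bsub>FObj F y\<^esub> FArr F x y (emb y x f) v"
      "FArr F x y (emb y x f) (inv\<^bsub>FObj F x\<^esub> u) = inv\<^bsub>FObj F y\<^esub> FArr F x y (emb y x f) u"
      "FArr F x y (emb y x f) \<one>\<^bsub>FObj F x\<^esub> = \<one>\<^bsub>FObj F y\<^esub>"
      if "y \<in> Obj C" "f \<in> Hom C y x" "u \<in> carrier (FObj F x)" "v \<in> carrier (FObj F x)" for y f u v
      using that x F.act_closed F.act_mult F.act_inv F.act_one by (simp_all add: ob_simp emb_in_Hom)
    have one: "\<one>\<^bsub>FObj F y\<^esub> \<otimes>\<^bsub>FObj F y\<^esub> \<one>\<^bsub>FObj F y\<^esub> = \<one>\<^bsub>FObj F y\<^esub>"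
      "inv\<^bsub>FObj F y\<^esub> \<one>\<^bsub>FObj F y\<^esub> = \<one>\<^bsub>FObj F y\<^esub>" if "y \<in> Obj C" for y
    proof -
      interpret Fy: group "FObj F y" using F.grp that by (simp add: ob_simp)
      show "\<one>\<^bsub>FObj F y\<^esub> \<otimes>\<^bsub>FObj F y\<^esub> \<one>\<^bsub>FObj F y\<^esub> = \<one>\<^bsub>FObj F y\<^esub>"
        "inv\<^bsub>FObj F y\<^esub> \<one>\<^bsub>FObj F y\<^esub> = \<one>\<^bsub>FObj F y\<^esub>" by simp_all
    qed
    show ?thesis
    proof (rule Fx.subgroupI)
      show "tors F x \<subseteq> carrier (FObj F x)" using car by blast
      have "\<one>\<^bsub>FObj F x\<^esub> \<in> tors F x"
        by (rule torsI[OF Fx.one_closed top.max_sieve_covering[OF x]])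
          (rule act(4)[OF _ cover_Hom[OF x top.max_sieve_covering[OF x]] Fx.one_closed Fx.one_closed])
      then show "tors F x \<noteq> {}" by blast
      fix u assume u: "u \<in> tors F x"
      then obtain T where T: "T \<in> J x"
        "\<And>y f. y \<in> Obj C \<Longrightarrow> f \<in> T y \<Longrightarrow> FArr F x y (emb y x f) u = \<one>\<^bsub>FObj F y\<^esub>"
        by (auto simp: tors_def)
      have "FArr F x y (emb y x f) (inv\<^bsub>FObj F x\<^esub> u) = \<one>\<^bsub>FObj F y\<^esub>"
        if "y \<in> Obj C" "f \<in> T y" for y f
        using act(3)[OF that(1) cover_Hom[OF x T(1) that] car[OF u] car[OF u]] T(2)[OF that] one[OF that(1)]
        by simp
      then show "inv\<^bsub>FObj F x\<^esub> u \<in> tors F x" by (rule torsI[OF Fx.inv_closed[OF car[OF u]] T(1)])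
      fix v assume v: "v \<in> tors F x"
      then obtain T' where T': "T' \<in> J x"
        "\<And>y f. y \<in> Obj C \<Longrightarrow> f \<in> T' y \<Longrightarrow> FArr F x y (emb y x f) v = \<one>\<^bsub>FObj F y\<^esub>"
        by (auto simp: tors_def)
      have "FArr F x y (emb y x f) (u \<otimes>\<^bsub>FObj F x\<^esub> v) = \<one>\<^bsub>FObj F y\<^esub>"
        if y: "y \<in> Obj C" and f: "f \<in> T y" "f \<in> T' y" for y f
        using act(2)[OF y cover_Hom[OF x T(1) y f(1)] car[OF u] car[OF v]]
          T(2)[OF y f(1)] T'(2)[OF y f(2)] one[OF y] by simp
      then show "u \<otimes>\<^bsub>FObj F x\<^esub> v \<in> tors F x"
        by (intro torsI[OF Fx.m_closed[OF car[OF u] car[OF v]] top.covering_Int[OF x T(1) T'(1)]]) auto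
    qed
  qed
  have "FArr F x y \<phi> m \<in> tors F y"
    if ob: "x \<in> Obj C" "y \<in> Obj C" and \<phi>: "\<phi> \<in> Hom gr y x" and m: "m \<in> tors F x" for x y \<phi> m
  proof -
    obtain T where T: "T \<in> J x"
      "\<And>y f. y \<in> Obj C \<Longrightarrow> f \<in> T y \<Longrightarrow> FArr F x y (emb y x f) m = \<one>\<^bsub>FObj F y\<^esub>"
      using m by (auto simp: tors_def)
    obtain T' where T': "T' \<in> J y"
      "\<And>z g. z \<in> Obj C \<Longrightarrow> g \<in> T' z \<Longrightarrow> comp gr z y x \<phi> (emb z y g) \<in> lin x T z"
      using covering_pullback_Gr[OF ob T(1) \<phi>] by blast
    have "FArr F y z (emb z y g) (FArr F x y \<phi> m) = \<one>\<^bsub>FObj F z\<^esub>" if z: "z \<in> Obj C" and g: "g \<in> T' z" for z g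
    proof -
      have "FArr F y z (emb z y g) (FArr F x y \<phi> m) = FArr F x z (comp gr z y x \<phi> (emb z y g)) m"
        using F.act_comp[of x y z \<phi> "emb z y g" m] ob z \<phi> car[OF m] cover_Hom[OF ob(2) T'(1) z g]
        by (simp add: ob_simp emb_in_Hom)
      also have "\<dots> = \<one>\<^bsub>FObj F z\<^esub>"
        using killed_by_lin[OF F ob(1) z car[OF m] T(2)[OF z] T'(2)[OF z g]] by blast
      finally show ?thesis .
    qed
    then show ?thesis
      using F.act_closed[of x y \<phi> m] ob \<phi> car[OF m]
      by (intro torsI[OF _ T'(1)]) (simp_all add: ob_simp)
  qed
  then show ?thesis using sg by (simp add: is_submodule_def ob_simp)
qed

text \<open>By the Yoneda lemma, a map from \<open>Hom(-, x)\<close> to \<open>F\<close> is the orbit of an element \<open>m\<close>; it vanishes on a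
  covering linear sieve exactly if \<open>m\<close> vanishes on its trace.\<close>

lemma torsion_iff:
  assumes F: "amodule gr F"
  shows "torsion gr lintop F \<longleftrightarrow> (\<forall>x \<in> Obj C. carrier (FObj F x) \<subseteq> tors F x)"
proof
  interpret F: amodule gr F by fact
  assume tor: "torsion gr lintop F"
  show "\<forall>x \<in> Obj C. carrier (FObj F x) \<subseteq> tors F x"
  proof (intro ballI subsetI)
    fix x m assume x: "x \<in> Obj C" and m: "m \<in> carrier (FObj F x)"
    define \<alpha> where "\<alpha> = (\<lambda>y \<in> Obj C. \<lambda>\<phi> \<in> Hom gr y x. FArr F x y \<phi> m)"
    have "\<alpha> \<in> module_maps gr (representable gr x) F"
      by (rule module_mapsI)
        (use x m in \<open>auto simp: \<alpha>_def representable_def Gr_simps(1) F.act_closed F.act_add F.act_comp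
          Gr_comp_in_Hom Gr_add_in_Hom simp flip: Gr_simps(2)\<close>)
    then obtain S where S: "S \<in> lintop x" "\<forall>y \<in> Obj C. \<forall>\<phi> \<in> S y. \<alpha> y \<phi> = \<one>\<^bsub>FObj F y\<^esub>"
      using tor x unfolding torsion_def Gr_simps(1) by blast
    have "FArr F x y (emb y x f) m = \<one>\<^bsub>FObj F y\<^esub>" if "y \<in> Obj C" "f \<in> trace x S y" for y f
    proof -
      have "f \<in> Hom C y x" "emb y x f \<in> S y" using that by (auto simp: trace_def)
      then show ?thesis
        using S(2)[rule_format, OF that(1), of "emb y x f"] emb_in_Hom[of y f x] that(1)
        by (simp add: \<alpha>_def)
    qed
    then show "m \<in> tors F x" using torsI[OF m, of "trace x S"] S(1) by (simp add: lintop_def)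
  qed
next
  interpret F: amodule gr F by fact
  assume tor: "\<forall>x \<in> Obj C. carrier (FObj F x) \<subseteq> tors F x"
  show "torsion gr lintop F"
    unfolding torsion_def Gr_simps(1)
  proof (intro ballI)
    fix x \<alpha> assume x: "x \<in> Obj C" and \<alpha>: "\<alpha> \<in> module_maps gr (representable gr x) F"
    define m where "m = \<alpha> x (ident gr x)"
    have idx: "ident gr x \<in> Hom gr x x" using gr.ident_in_Hom x by (simp add: Gr_simps(1))
    have m: "m \<in> carrier (FObj F x)"
      using module_maps_closed[OF \<alpha>, of x "ident gr x"] x idx
      by (simp add: m_def representable_def Gr_simps(1) flip: Gr_simps(2))
    have \<alpha>eq: "\<alpha> y \<phi> = FArr F x y \<phi> m" if y: "y \<in> Obj C" and \<phi>: "\<phi> \<in> Hom gr y x" for y \<phi>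
      using module_maps_natural[OF \<alpha>, of x y \<phi> "ident gr x"] x y \<phi> idx gr.comp_ident_left[of y x \<phi>]
      by (simp add: m_def representable_def Gr_simps(1) flip: Gr_simps(2))
    obtain T where T: "T \<in> J x"
      "\<And>y f. y \<in> Obj C \<Longrightarrow> f \<in> T y \<Longrightarrow> FArr F x y (emb y x f) m = \<one>\<^bsub>FObj F y\<^esub>"
      using tor x m unfolding tors_def by blast
    have "\<alpha> y \<phi> = \<one>\<^bsub>FObj F y\<^esub>" if y: "y \<in> Obj C" and \<phi>: "\<phi> \<in> lin x T y" for y \<phi>
      using \<alpha>eq[OF y lin_Hom[OF y \<phi>]] killed_by_lin[OF F x y m T(2)[OF y] \<phi>] by simp
    then show "\<exists>S \<in> lintop x. \<forall>y \<in> Obj C. \<forall>\<phi> \<in> S y. \<alpha> y \<phi> = \<one>\<^bsub>FObj F y\<^esub>"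
      using trace_lin[OF x T(1)] by blast
  qed
qed

lemma tors_map:
  assumes \<eta>: "\<eta> \<in> module_maps gr F G" and F: "amodule gr F" and G: "amodule gr G"
    and x: "x \<in> Obj C" and m: "m \<in> tors F x"
  shows "\<eta> x m \<in> tors G x"
proof -
  obtain T where T: "T \<in> J x"
    "\<And>y f. y \<in> Obj C \<Longrightarrow> f \<in> T y \<Longrightarrow> FArr F x y (emb y x f) m = \<one>\<^bsub>FObj F y\<^esub>"
    and mc: "m \<in> carrier (FObj F x)"
    using m by (auto simp: tors_def)
  have "FArr G x y (emb y x f) (\<eta> x m) = \<one>\<^bsub>FObj G y\<^esub>" if "y \<in> Obj C" "f \<in> T y" for y f
    using module_maps_natural[OF \<eta>, of x y "emb y x f" m] T(2)[OF that] x that mc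
      cover_Hom[OF x T(1) that] group_hom.hom_one[OF module_maps_group_hom[OF \<eta> F G, of y]]
    by (simp add: Gr_simps(1) emb_in_Hom)
  moreover have "\<eta> x m \<in> carrier (FObj G x)"
    using module_maps_closed[OF \<eta>, of x m] x mc by (simp add: Gr_simps(1))
  ultimately show ?thesis by (intro torsI[OF _ T(1)])
qed

section \<open>Sheaves are perpendicular to torsion modules\<close>

definition is_sheaf :: "('o, 'a \<Rightarrow> 'r, 'p monoid, 'p \<Rightarrow> 'p) cfunctor \<Rightarrow> bool" where
  "is_sheaf F \<longleftrightarrow> set_sheaf C J (\<lambda>x. carrier (FObj F x)) (\<lambda>x y f. FArr F x y (emb y x f))"

lemma act_emb_comp:
  assumes F: "amodule gr F" and "x \<in> Obj C" "y \<in> Obj C" "z \<in> Obj C" "f \<in> Hom C y x" "g \<in> Hom C z y"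
    "m \<in> carrier (FObj F x)"
  shows "FArr F y z (emb z y g) (FArr F x y (emb y x f) m) = FArr F x z (emb z x (comp C z y x f g)) m"
  using amodule.act_comp[OF F, of x y z "emb y x f" "emb z y g" m] assms
  by (simp add: Gr_simps(1) emb_in_Hom emb_comp)

lemma sheaf_unique:
  assumes F: "amodule gr F" and sh: "is_sheaf F" and x: "x \<in> Obj C" and T: "T \<in> J x"
    and m: "m \<in> carrier (FObj F x)" "m' \<in> carrier (FObj F x)"
    and eq: "\<And>y f. y \<in> Obj C \<Longrightarrow> f \<in> T y \<Longrightarrow> FArr F x y (emb y x f) m = FArr F x y (emb y x f) m'"
  shows "m = m'"
proof -
  note sT = top.covering_sieve[OF x T]
  define s where "s y f = FArr F x y (emb y x f) m" for y f
  have "matching_family C (\<lambda>x. carrier (FObj F x)) (\<lambda>x y f. FArr F x y (emb y x f)) x T s"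
    unfolding matching_family_def s_def
  proof (intro conjI ballI)
    fix y f assume y: "y \<in> Obj C" and f: "f \<in> T y"
    show "FArr F x y (emb y x f) m \<in> carrier (FObj F y)"
      using amodule.act_closed[OF F, of x y "emb y x f" m] x y m cover_Hom[OF x T y f]
      by (simp add: Gr_simps(1) emb_in_Hom)
    fix z g assume "z \<in> Obj C" "g \<in> Hom C z y"
    then show "FArr F y z (emb z y g) (FArr F x y (emb y x f) m) = FArr F x z (emb z x (comp C z y x f g)) m"
      using act_emb_comp[OF F x y] cover_Hom[OF x T y f] m by blast
  qed
  then have "\<exists>!n. n \<in> carrier (FObj F x) \<and> (\<forall>y \<in> Obj C. \<forall>f \<in> T y. FArr F x y (emb y x f) n = s y f)"
    using sh x T unfolding is_sheaf_def set_sheaf_def by blast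
  moreover have "\<forall>y \<in> Obj C. \<forall>f \<in> T y. FArr F x y (emb y x f) m = s y f"
    "\<forall>y \<in> Obj C. \<forall>f \<in> T y. FArr F x y (emb y x f) m' = s y f"
    using eq by (simp_all add: s_def)
  ultimately show ?thesis using m by metis
qed

lemma sheaf_torsion_free:
  assumes F: "amodule gr F" and sh: "is_sheaf F" and x: "x \<in> Obj C" and m: "m \<in> tors F x"
  shows "m = \<one>\<^bsub>FObj F x\<^esub>"
proof -
  interpret F: amodule gr F by fact
  interpret Fx: group "FObj F x" using F.grp x by (simp add: Gr_simps(1))
  obtain T where T: "T \<in> J x"
    "\<And>y f. y \<in> Obj C \<Longrightarrow> f \<in> T y \<Longrightarrow> FArr F x y (emb y x f) m = \<one>\<^bsub>FObj F y\<^esub>"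
    and mc: "m \<in> carrier (FObj F x)"
    using m by (auto simp: tors_def)
  show ?thesis
    by (rule sheaf_unique[OF F sh x T(1) mc])
      (use T cover_Hom[OF x T(1)] F.act_one x in \<open>auto simp: Gr_simps(1) emb_in_Hom\<close>)
qed

text \<open>The middle term is the direct sum of \<open>F\<close> and its torsion submodule, and the projection to \<open>F\<close> is a
  retraction of \<open>i\<close>.\<close>

lemma sheaf_torsion_extension_splits:
  fixes U :: "'m set set"
  assumes U: "size_universe U" and F: "F \<in> Obj (ModCat U gr)" and sh: "is_sheaf F"
    and B: "B \<in> Obj (ModCat U gr)" and tor: "torsion gr lintop B"
    and ext: "(E, i, p) \<in> extensions (ModCat U gr) B F"
  shows "\<exists>s \<in> Hom (ModCat U gr) B E. comp (ModCat U gr) B E B p s = ident (ModCat U gr) B"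
proof -
  interpret M: preadditive "ModCat U gr" by (rule gr.preadditive_ModCat)
  have E: "E \<in> Obj (ModCat U gr)" and ker: "is_kernel (ModCat U gr) F E B i p"
    and cok: "is_cokernel (ModCat U gr) F E B i p"
    using ext by (auto simp: extensions_def)
  have mod: "amodule gr F" "amodule gr E" "amodule gr B"
    using F E B by (auto simp: gr.Obj_ModCat_iff)
  interpret F: amodule gr F by (rule mod)
  interpret E: amodule gr E by (rule mod)
  interpret B: amodule gr B by (rule mod)
  have i: "i \<in> module_maps gr F E" and p: "p \<in> module_maps gr E B"
    using ker by (auto simp: is_kernel_def ModCat_simps)
  note kp = gr.kernel_pointwise[OF U F E B ker, unfolded Gr_simps(1)]
  note ob_simp = Gr_simps(1)
  have subt: "subgroup (tors E x) (FObj E x)" if "x \<in> Obj C" for x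
    using is_submodule_tors[OF mod(2)] that by (simp add: is_submodule_def ob_simp)
  have ihom: "group_hom (FObj F x) (FObj E x) (i x)" if "x \<in> Obj C" for x
    using module_maps_group_hom[OF i mod(1,2)] that by (simp add: ob_simp)
  \<comment> \<open>The submodule \<open>F\<close> of \<open>E\<close> contains no torsion.\<close>
  have tors_i: "m = \<one>\<^bsub>FObj F x\<^esub>" if x: "x \<in> Obj C" and m: "m \<in> carrier (FObj F x)" and im: "i x m \<in> tors E x"
    for x m
  proof (rule sheaf_torsion_free[OF mod(1) sh x])
    obtain T where T: "T \<in> J x"
      "\<And>y f. y \<in> Obj C \<Longrightarrow> f \<in> T y \<Longrightarrow> FArr E x y (emb y x f) (i x m) = \<one>\<^bsub>FObj E y\<^esub>"
      using im by (auto simp: tors_def)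
    have "FArr F x y (emb y x f) m = \<one>\<^bsub>FObj F y\<^esub>" if y: "y \<in> Obj C" and f: "f \<in> T y" for y f
    proof (rule kp(1)[OF y])
      note fx = cover_Hom[OF x T(1) y f]
      show "FArr F x y (emb y x f) m \<in> carrier (FObj F y)"
        using F.act_closed x y fx m by (simp add: ob_simp emb_in_Hom)
      show "i y (FArr F x y (emb y x f) m) = \<one>\<^bsub>FObj E y\<^esub>"
        using module_maps_natural[OF i, of x y "emb y x f" m] T(2)[OF y f] x y fx m
        by (simp add: ob_simp emb_in_Hom)
    qed
    then show "m \<in> tors F x" by (rule torsI[OF m T(1)])
  qed
  \<comment> \<open>Every element of \<open>E\<close> is congruent to a unique element of \<open>F\<close> modulo torsion: its restrictions
    to a cover come from \<open>F\<close>, and they glue there.\<close>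
  have ex: "\<exists>m \<in> carrier (FObj F x). inv\<^bsub>FObj E x\<^esub> i x m \<otimes>\<^bsub>FObj E x\<^esub> \<xi> \<in> tors E x"
    if x: "x \<in> Obj C" and \<xi>: "\<xi> \<in> carrier (FObj E x)" for x \<xi>
  proof -
    have "p x \<xi> \<in> tors B x"
      using tor module_maps_closed[OF p, of x \<xi>] x \<xi> unfolding torsion_iff[OF mod(3)]
      by (auto simp: ob_simp)
    then obtain T where T: "T \<in> J x"
      "\<And>y f. y \<in> Obj C \<Longrightarrow> f \<in> T y \<Longrightarrow> FArr B x y (emb y x f) (p x \<xi>) = \<one>\<^bsub>FObj B y\<^esub>"
      by (auto simp: tors_def)
    have res: "FArr E x y (emb y x f) \<xi> \<in> carrier (FObj E y)" if "y \<in> Obj C" "f \<in> T y" for y f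
      using E.act_closed cover_Hom[OF x T(1) that] x that \<xi> by (simp add: ob_simp emb_in_Hom)
    have "\<exists>n \<in> carrier (FObj F y). i y n = FArr E x y (emb y x f) \<xi>" if y: "y \<in> Obj C" and f: "f \<in> T y" for y f
      using module_maps_natural[OF p, of x y "emb y x f" \<xi>] T(2)[OF y f] x y cover_Hom[OF x T(1) y f] \<xi>
        kp(3)[OF y res[OF y f]]
      by (simp add: ob_simp emb_in_Hom)
    then obtain s where s: "\<And>y f. y \<in> Obj C \<Longrightarrow> f \<in> T y \<Longrightarrow> s y f \<in> carrier (FObj F y)"
      "\<And>y f. y \<in> Obj C \<Longrightarrow> f \<in> T y \<Longrightarrow> i y (s y f) = FArr E x y (emb y x f) \<xi>"
      by metis
    have "matching_family C (\<lambda>x. carrier (FObj F x)) (\<lambda>x y f. FArr F x y (emb y x f)) x T s"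
      unfolding matching_family_def
    proof (intro conjI ballI)
      fix y f assume y: "y \<in> Obj C" and f: "f \<in> T y"
      note fx = cover_Hom[OF x T(1) y f]
      show "s y f \<in> carrier (FObj F y)" using s y f by blast
      fix z g assume z: "z \<in> Obj C" and g: "g \<in> Hom C z y"
      have fg: "comp C z y x f g \<in> T z" using sieveD(2)[OF top.covering_sieve[OF x T(1)] y z f g] .
      interpret iz: group_hom "FObj F z" "FObj E z" "i z" using ihom[OF z] .
      have c: "FArr F y z (emb z y g) (s y f) \<in> carrier (FObj F z)"
        using F.act_closed s(1)[OF y f] y z g by (simp add: ob_simp emb_in_Hom)
      have "i z (FArr F y z (emb z y g) (s y f)) = i z (s z (comp C z y x f g))"
        using module_maps_natural[OF i, of y z "emb z y g" "s y f"] s[OF y f] s[OF z fg] y z g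
          act_emb_comp[OF mod(2) x y z fx g \<xi>] by (simp add: ob_simp emb_in_Hom)
      moreover have "inj_on (i z) (carrier (FObj F z))"
        using iz.inj_on_one_iff kp(1)[OF z] by blast
      ultimately show "FArr F y z (emb z y g) (s y f) = s z (comp C z y x f g)"
        using c s(1)[OF z fg] inj_onD by metis
    qed
    then obtain m where m: "m \<in> carrier (FObj F x)"
      "\<And>y f. y \<in> Obj C \<Longrightarrow> f \<in> T y \<Longrightarrow> FArr F x y (emb y x f) m = s y f"
      using sh x T(1) unfolding is_sheaf_def set_sheaf_def by blast
    interpret ix: group_hom "FObj F x" "FObj E x" "i x" using ihom[OF x] .
    have "FArr E x y (emb y x f) (inv\<^bsub>FObj E x\<^esub> i x m \<otimes>\<^bsub>FObj E x\<^esub> \<xi>) = \<one>\<^bsub>FObj E y\<^esub>"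
      if y: "y \<in> Obj C" and f: "f \<in> T y" for y f
    proof -
      note fx = cover_Hom[OF x T(1) y f]
      interpret Ey: group "FObj E y" using E.grp y by (simp add: ob_simp)
      have "FArr E x y (emb y x f) (i x m) = FArr E x y (emb y x f) \<xi>"
        using module_maps_natural[OF i, of x y "emb y x f" m] m s(2)[OF y f] x y f fx
        by (simp add: ob_simp emb_in_Hom)
      then show ?thesis
        using x y fx m(1) \<xi> res[OF y f] by (simp add: ob_simp emb_in_Hom E.act_mult E.act_inv)
    qed
    then have "inv\<^bsub>FObj E x\<^esub> i x m \<otimes>\<^bsub>FObj E x\<^esub> \<xi> \<in> tors E x"
      using m(1) \<xi> by (intro torsI[OF _ T(1)]) simp_all
    with m(1) show ?thesis by (rule bexI[rotated])
  qed
  have uniq: "m = m'" if x: "x \<in> Obj C" and \<xi>: "\<xi> \<in> carrier (FObj E x)"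
    and m: "m \<in> carrier (FObj F x)" "m' \<in> carrier (FObj F x)"
    and t: "inv\<^bsub>FObj E x\<^esub> i x m \<otimes>\<^bsub>FObj E x\<^esub> \<xi> \<in> tors E x" "inv\<^bsub>FObj E x\<^esub> i x m' \<otimes>\<^bsub>FObj E x\<^esub> \<xi> \<in> tors E x"
    for x \<xi> m m'
  proof -
    interpret ix: group_hom "FObj F x" "FObj E x" "i x" using ihom[OF x] .
    have "(inv\<^bsub>FObj E x\<^esub> i x m' \<otimes>\<^bsub>FObj E x\<^esub> \<xi>) \<otimes>\<^bsub>FObj E x\<^esub> inv\<^bsub>FObj E x\<^esub> (inv\<^bsub>FObj E x\<^esub> i x m \<otimes>\<^bsub>FObj E x\<^esub> \<xi>) \<in> tors E x"
      using subgroup.m_closed[OF subt[OF x] t(2) subgroup.m_inv_closed[OF subt[OF x] t(1)]] .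
    also have "(inv\<^bsub>FObj E x\<^esub> i x m' \<otimes>\<^bsub>FObj E x\<^esub> \<xi>) \<otimes>\<^bsub>FObj E x\<^esub> inv\<^bsub>FObj E x\<^esub> (inv\<^bsub>FObj E x\<^esub> i x m \<otimes>\<^bsub>FObj E x\<^esub> \<xi>)
      = i x (inv\<^bsub>FObj F x\<^esub> m' \<otimes>\<^bsub>FObj F x\<^esub> m)"
    proof -
      have "\<xi> \<otimes>\<^bsub>FObj E x\<^esub> (inv\<^bsub>FObj E x\<^esub> \<xi> \<otimes>\<^bsub>FObj E x\<^esub> i x m) = i x m"
        using \<xi> m by (simp flip: ix.H.m_assoc)
      then show ?thesis using \<xi> m by (simp add: ix.H.inv_mult_group ix.H.m_assoc)
    qed
    finally have "inv\<^bsub>FObj F x\<^esub> m' \<otimes>\<^bsub>FObj F x\<^esub> m = \<one>\<^bsub>FObj F x\<^esub>"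
      using tors_i[OF x] m by simp
    then show ?thesis using m by (metis ix.G.inv_equality ix.G.inv_inv ix.G.inv_closed)
  qed
  define q where "q = (\<lambda>x \<in> Obj C. \<lambda>\<xi> \<in> carrier (FObj E x).
    SOME m. m \<in> carrier (FObj F x) \<and> inv\<^bsub>FObj E x\<^esub> i x m \<otimes>\<^bsub>FObj E x\<^esub> \<xi> \<in> tors E x)"
  have q: "q x \<xi> \<in> carrier (FObj F x)" "inv\<^bsub>FObj E x\<^esub> i x (q x \<xi>) \<otimes>\<^bsub>FObj E x\<^esub> \<xi> \<in> tors E x"
    if "x \<in> Obj C" "\<xi> \<in> carrier (FObj E x)" for x \<xi>
    using someI_ex[of "\<lambda>m. m \<in> carrier (FObj F x) \<and> inv\<^bsub>FObj E x\<^esub> i x m \<otimes>\<^bsub>FObj E x\<^esub> \<xi> \<in> tors E x"]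
      ex[OF that] that by (auto simp: q_def)
  have qI: "q x \<xi> = m" if "x \<in> Obj C" "\<xi> \<in> carrier (FObj E x)" "m \<in> carrier (FObj F x)"
    "inv\<^bsub>FObj E x\<^esub> i x m \<otimes>\<^bsub>FObj E x\<^esub> \<xi> \<in> tors E x" for x \<xi> m
    using uniq[OF that(1,2) q(1)[OF that(1,2)] that(3) q(2)[OF that(1,2)] that(4)] .
  have qmap: "q \<in> module_maps gr E F"
  proof (rule module_mapsI; (unfold ob_simp)?)
    fix x \<xi> \<zeta> assume x: "x \<in> Obj C" and e: "\<xi> \<in> carrier (FObj E x)" "\<zeta> \<in> carrier (FObj E x)"
    interpret ix: group_hom "FObj F x" "FObj E x" "i x" using ihom[OF x] .
    interpret Ex: comm_group "FObj E x" using E.comm_grp x by (simp add: ob_simp)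
    note c = q(1)[OF x e(1)] q(1)[OF x e(2)]
    have "(inv\<^bsub>FObj E x\<^esub> i x (q x \<xi>) \<otimes>\<^bsub>FObj E x\<^esub> \<xi>) \<otimes>\<^bsub>FObj E x\<^esub> (inv\<^bsub>FObj E x\<^esub> i x (q x \<zeta>) \<otimes>\<^bsub>FObj E x\<^esub> \<zeta>) \<in> tors E x"
      using subgroup.m_closed[OF subt[OF x] q(2)[OF x e(1)] q(2)[OF x e(2)]] .
    also have "(inv\<^bsub>FObj E x\<^esub> i x (q x \<xi>) \<otimes>\<^bsub>FObj E x\<^esub> \<xi>) \<otimes>\<^bsub>FObj E x\<^esub> (inv\<^bsub>FObj E x\<^esub> i x (q x \<zeta>) \<otimes>\<^bsub>FObj E x\<^esub> \<zeta>)
      = inv\<^bsub>FObj E x\<^esub> i x (q x \<xi> \<otimes>\<^bsub>FObj F x\<^esub> q x \<zeta>) \<otimes>\<^bsub>FObj E x\<^esub> (\<xi> \<otimes>\<^bsub>FObj E x\<^esub> \<zeta>)"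
      using c e by (simp add: Ex.inv_mult Ex.m_ac)
    finally show "q x (\<xi> \<otimes>\<^bsub>FObj E x\<^esub> \<zeta>) = q x \<xi> \<otimes>\<^bsub>FObj F x\<^esub> q x \<zeta>"
      using c e by (intro qI[OF x]) simp_all
  next
    fix x y \<phi> \<xi> assume xy: "x \<in> Obj C" "y \<in> Obj C" "\<phi> \<in> Hom gr y x" and e: "\<xi> \<in> carrier (FObj E x)"
    interpret ix: group_hom "FObj F x" "FObj E x" "i x" using ihom[OF xy(1)] .
    note c = q(1)[OF xy(1) e]
    have "FArr E x y \<phi> (inv\<^bsub>FObj E x\<^esub> i x (q x \<xi>) \<otimes>\<^bsub>FObj E x\<^esub> \<xi>) \<in> tors E y"
      using is_submodule_tors[OF mod(2)] q(2)[OF xy(1) e] xy by (simp add: is_submodule_def ob_simp)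
    also have "FArr E x y \<phi> (inv\<^bsub>FObj E x\<^esub> i x (q x \<xi>) \<otimes>\<^bsub>FObj E x\<^esub> \<xi>)
      = inv\<^bsub>FObj E y\<^esub> i y (FArr F x y \<phi> (q x \<xi>)) \<otimes>\<^bsub>FObj E y\<^esub> FArr E x y \<phi> \<xi>"
      using xy e c module_maps_natural[OF i, of x y \<phi> "q x \<xi>"]
      by (simp add: ob_simp E.act_mult E.act_inv)
    finally show "q y (FArr E x y \<phi> \<xi>) = FArr F x y \<phi> (q x \<xi>)"
      using xy e c by (intro qI[OF xy(2)]) (simp_all add: ob_simp E.act_closed F.act_closed)
  qed (use q in \<open>auto simp: q_def\<close>)
  have "comp (ModCat U gr) F E F q i = ident (ModCat U gr) F"
    unfolding ModCat_simps ob_simp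
  proof (intro restrict_ext)
    fix x assume x: "x \<in> Obj C"
    interpret ix: group_hom "FObj F x" "FObj E x" "i x" using ihom[OF x] .
    show "compose (carrier (FObj F x)) (q x) (i x) = (\<lambda>m \<in> carrier (FObj F x). m)"
      unfolding compose_def
    proof (intro restrict_ext)
      fix m assume m: "m \<in> carrier (FObj F x)"
      show "q x (i x m) = m"
        using m subgroup.one_closed[OF subt[OF x]] by (intro qI[OF x]) simp_all
    qed
  qed
  then show ?thesis
    using M.cokernel_retraction_split[OF F E B cok, of q] qmap by (simp add: ModCat_simps(1))
qed

text \<open>The direct sum of \<open>F\<close> and \<open>B\<close>, moved into the universe. It is needed because an empty set of
  extensions would have no classes at all.\<close>

lemma split_extension_exists:
  fixes U :: "'m set set"
  assumes U: "size_universe U" and F: "F \<in> Obj (ModCat U gr)" and B: "B \<in> Obj (ModCat U gr)"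
  shows "extensions (ModCat U gr) B F \<noteq> {}"
proof -
  have mod: "amodule gr F" "amodule gr B"
    using F B by (auto simp: gr.Obj_ModCat_iff)
  note ob_simp = Gr_simps(1)
  define D where "D = prod_module F B"
  have D: "amodule gr D" unfolding D_def by (rule amodule_prod_module[OF mod])
  have "small U (carrier (FObj D x))" if "x \<in> Obj gr" for x
    using F B that small_Times[OF U small_in_universe small_in_universe]
    by (simp add: D_def prod_module_simps gr.Obj_ModCat_iff)
  then obtain E \<pi> where E: "E \<in> Obj (ModCat U gr)" and \<pi>: "\<pi> \<in> module_maps gr D E"
    and \<pi>surj: "\<And>x. x \<in> Obj gr \<Longrightarrow> \<pi> x ` carrier (FObj D x) = carrier (FObj E x)"
    and \<pi>ker: "\<And>x m. x \<in> Obj gr \<Longrightarrow> m \<in> carrier (FObj D x) \<Longrightarrow> \<pi> x m = \<one>\<^bsub>FObj E x\<^esub> \<longleftrightarrow> m \<in> {\<one>\<^bsub>FObj D x\<^esub>}"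
    using gr.quotient_in_universe[OF U D is_submodule_trivial[OF D]] by blast
  have mE: "amodule gr E" using E by (simp add: gr.Obj_ModCat_iff)
  define inj where "inj = (\<lambda>x \<in> Obj gr. \<lambda>m \<in> carrier (FObj F x). (m, \<one>\<^bsub>FObj B x\<^esub>))"
  define pr where "pr = (\<lambda>x \<in> Obj gr. \<lambda>m \<in> carrier (FObj F x) \<times> carrier (FObj B x). snd m)"
  have inj: "inj \<in> module_maps gr F D" and pr: "pr \<in> module_maps gr D B"
    using prod_module_maps[OF mod] by (simp_all add: inj_def pr_def D_def)
  define i where "i = (\<lambda>x \<in> Obj gr. compose (carrier (FObj F x)) (\<pi> x) (inj x))"
  have i: "i \<in> module_maps gr F E" unfolding i_def by (rule module_maps_comp[OF mod(1) inj \<pi>])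
  have prc: "pr x m = \<one>\<^bsub>FObj B x\<^esub>" if "x \<in> Obj gr" "m \<in> carrier (FObj D x)" "\<pi> x m = \<one>\<^bsub>FObj E x\<^esub>" for x m
    using \<pi>ker[OF that(1,2)] that group.is_monoid[OF amodule.grp[OF mod(1) that(1)]]
      group.is_monoid[OF amodule.grp[OF mod(2) that(1)]]
    by (auto simp: D_def prod_module_simps pr_def)
  obtain p where p: "p \<in> module_maps gr E B"
    and p\<pi>: "\<And>x m. x \<in> Obj gr \<Longrightarrow> m \<in> carrier (FObj D x) \<Longrightarrow> p x (\<pi> x m) = pr x m"
    using factor_through_surjection[OF D mE mod(2) \<pi> pr \<pi>surj prc] by blast
  have "(E, i, p) \<in> extensions (ModCat U gr) B F"
  proof (rule gr.exact_extension[OF F E B i p])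
    fix x assume x: "x \<in> Obj gr"
    interpret Fx: group "FObj F x" using amodule.grp[OF mod(1) x] .
    interpret Bx: group "FObj B x" using amodule.grp[OF mod(2) x] .
    have ival: "i x m = \<pi> x (m, \<one>\<^bsub>FObj B x\<^esub>)" if "m \<in> carrier (FObj F x)" for m
      using x that by (simp add: i_def compose_def inj_def)
    show "m = \<one>\<^bsub>FObj F x\<^esub>" if "m \<in> carrier (FObj F x)" "i x m = \<one>\<^bsub>FObj E x\<^esub>" for m
      using \<pi>ker[OF x, of "(m, \<one>\<^bsub>FObj B x\<^esub>)"] that by (simp add: ival D_def prod_module_simps)
    have lift: "\<exists>m b. m \<in> carrier (FObj F x) \<and> b \<in> carrier (FObj B x) \<and> e = \<pi> x (m, b)"
      if "e \<in> carrier (FObj E x)" for e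
      using that \<pi>surj[OF x, symmetric] by (auto simp: D_def prod_module_simps)
    have pval: "p x (\<pi> x (m, b)) = b" if "m \<in> carrier (FObj F x)" "b \<in> carrier (FObj B x)" for m b
      using p\<pi>[OF x, of "(m, b)"] that x by (simp add: D_def prod_module_simps pr_def)
    show "p x e = \<one>\<^bsub>FObj B x\<^esub> \<longleftrightarrow> e \<in> i x ` carrier (FObj F x)" if e: "e \<in> carrier (FObj E x)" for e
    proof -
      obtain m b where mb: "m \<in> carrier (FObj F x)" "b \<in> carrier (FObj B x)" "e = \<pi> x (m, b)"
        using lift[OF e] by metis
      show ?thesis
      proof
        assume "p x e = \<one>\<^bsub>FObj B x\<^esub>"
        then show "e \<in> i x ` carrier (FObj F x)" using mb pval[OF mb(1,2)] ival[OF mb(1)] by (metis image_eqI)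
      next
        assume "e \<in> i x ` carrier (FObj F x)"
        then show "p x e = \<one>\<^bsub>FObj B x\<^esub>" using ival pval by auto
      qed
    qed
    show "p x ` carrier (FObj E x) = carrier (FObj B x)"
    proof
      show "p x ` carrier (FObj E x) \<subseteq> carrier (FObj B x)" using module_maps_closed[OF p x] by blast
      show "carrier (FObj B x) \<subseteq> p x ` carrier (FObj E x)"
      proof
        fix b assume b: "b \<in> carrier (FObj B x)"
        then have "\<pi> x (\<one>\<^bsub>FObj F x\<^esub>, b) \<in> carrier (FObj E x)"
          using module_maps_closed[OF \<pi> x, of "(\<one>\<^bsub>FObj F x\<^esub>, b)"] by (simp add: D_def prod_module_simps)
        then show "b \<in> p x ` carrier (FObj E x)" using pval[of "\<one>\<^bsub>FObj F x\<^esub>" b] b by force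
      qed
    qed
  qed
  then show ?thesis by blast
qed

lemma Obj_right_perp_iff:
  fixes U :: "'m set set"
  shows "F \<in> Obj (right_perp (ModCat U gr) (Tors U gr lintop)) \<longleftrightarrow> F \<in> Obj (ModCat U gr) \<and>
    (\<forall>B \<in> Obj (ModCat U gr). torsion gr lintop B \<longrightarrow>
      Hom (ModCat U gr) B F = {hzero (ModCat U gr) B F} \<and>
      extensions (ModCat U gr) B F \<noteq> {} \<and>
      (\<forall>(E, i, p) \<in> extensions (ModCat U gr) B F.
        \<exists>s \<in> Hom (ModCat U gr) B E. comp (ModCat U gr) B E B p s = ident (ModCat U gr) B))"
proof -
  interpret M: preadditive "ModCat U gr" by (rule gr.preadditive_ModCat)
  have "F \<in> Obj (right_perp (ModCat U gr) (Tors U gr lintop)) \<longleftrightarrow> F \<in> Obj (ModCat U gr) \<and>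
    (\<forall>B \<in> Obj (ModCat U gr). torsion gr lintop B \<longrightarrow>
      Hom (ModCat U gr) B F = {hzero (ModCat U gr) B F} \<and>
      Ext1 (ModCat U gr) B F = {Ext1_zero (ModCat U gr) B F})"
    unfolding right_perp_def Tors_def full_subcategory_def by (simp add: Ball_def imp_conjL)
  then show ?thesis
    using M.Ext1_trivial_iff[of F] by (simp cong: conj_cong)
qed

lemma sheaf_in_right_perp:
  fixes U :: "'m set set"
  assumes U: "size_universe U" and F: "F \<in> Obj (ModCat U gr)" and sh: "is_sheaf F"
  shows "F \<in> Obj (right_perp (ModCat U gr) (Tors U gr lintop))"
  unfolding Obj_right_perp_iff
proof (rule conjI[OF F], rule ballI, rule impI)
  interpret M: preadditive "ModCat U gr" by (rule gr.preadditive_ModCat)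
  fix B assume B: "B \<in> Obj (ModCat U gr)" and tor: "torsion gr lintop B"
  have mod: "amodule gr F" "amodule gr B"
    using F B by (auto simp: gr.Obj_ModCat_iff)
  have "\<eta> = hzero (ModCat U gr) B F" if \<eta>: "\<eta> \<in> Hom (ModCat U gr) B F" for \<eta>
  proof -
    have \<eta>: "\<eta> \<in> module_maps gr B F" using \<eta> by (simp add: ModCat_simps)
    have 0: "hzero (ModCat U gr) B F \<in> module_maps gr B F"
      using M.hzero_in_Hom[OF B F] by (simp add: ModCat_simps(1))
    show ?thesis
    proof (rule module_maps_eqI[OF \<eta> 0])
      fix x m assume x: "x \<in> Obj gr" and m: "m \<in> carrier (FObj B x)"
      then have "m \<in> tors B x" using tor by (auto simp: torsion_iff[OF mod(2)] Gr_simps(1))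
      then have "\<eta> x m = \<one>\<^bsub>FObj F x\<^esub>"
        using sheaf_torsion_free[OF mod(1) sh _ tors_map[OF \<eta> mod(2,1)]] x by (simp add: Gr_simps(1))
      then show "\<eta> x m = hzero (ModCat U gr) B F x m" using x m by (simp add: ModCat_simps(6))
    qed
  qed
  then have "Hom (ModCat U gr) B F = {hzero (ModCat U gr) B F}"
    using M.hzero_in_Hom[OF B F] by blast
  moreover have "\<forall>(E, i, p) \<in> extensions (ModCat U gr) B F.
      \<exists>s \<in> Hom (ModCat U gr) B E. comp (ModCat U gr) B E B p s = ident (ModCat U gr) B"
    using sheaf_torsion_extension_splits[OF U F sh B tor] by blast
  ultimately show "Hom (ModCat U gr) B F = {hzero (ModCat U gr) B F} \<and>
      extensions (ModCat U gr) B F \<noteq> {} \<and>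
      (\<forall>(E, i, p) \<in> extensions (ModCat U gr) B F.
        \<exists>s \<in> Hom (ModCat U gr) B E. comp (ModCat U gr) B E B p s = ident (ModCat U gr) B)"
    using split_extension_exists[OF U F B] by (intro conjI)
qed

end

section \<open>Modules perpendicular to torsion modules are sheaves\<close>

context algebra_site
begin

text \<open>The torsion submodule is a torsion module, so its inclusion is the zero map.\<close>

lemma right_perp_torsion_free:
  fixes U :: "'m set set"
  assumes U: "size_universe U" and F: "F \<in> Obj (right_perp (ModCat U gr) (Tors U gr lintop))"
    and x: "x \<in> Obj C" and m: "m \<in> tors F x"
  shows "m = \<one>\<^bsub>FObj F x\<^esub>"
proof -
  have FM: "F \<in> Obj (ModCat U gr)" using F Obj_right_perp_iff by blast
  then have mF: "amodule gr F" by (simp add: gr.Obj_ModCat_iff)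
  note sub = is_submodule_tors[OF mF]
  define T where "T = sub_module F (tors F)"
  have T: "T \<in> Obj (ModCat U gr)" unfolding T_def by (rule gr.sub_module_in_ModCat[OF U FM sub])
  then have mT: "amodule gr T" by (simp add: gr.Obj_ModCat_iff)
  have "carrier (FObj T y) \<subseteq> tors T y" if y: "y \<in> Obj C" for y
  proof
    fix n assume n: "n \<in> carrier (FObj T y)"
    then have nF: "n \<in> tors F y" by (simp add: T_def sub_module_simps)
    then obtain S where S: "S \<in> J y"
      "\<And>z f. z \<in> Obj C \<Longrightarrow> f \<in> S z \<Longrightarrow> FArr F y z (emb z y f) n = \<one>\<^bsub>FObj F z\<^esub>"
      by (auto simp: tors_def)
    show "n \<in> tors T y"
      by (rule torsI[OF n S(1)]) (use S(2) nF in \<open>auto simp: T_def sub_module_simps\<close>)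
  qed
  then have "torsion gr lintop T" by (simp add: torsion_iff[OF mT])
  then have "Hom (ModCat U gr) T F = {hzero (ModCat U gr) T F}"
    using F T Obj_right_perp_iff by blast
  moreover have "(\<lambda>x \<in> Obj gr. \<lambda>m \<in> tors F x. m) \<in> Hom (ModCat U gr) T F"
    using sub_module_inclusion[OF mF sub] by (simp add: ModCat_simps(1) T_def)
  ultimately have "(\<lambda>x \<in> Obj gr. \<lambda>m \<in> tors F x. m) = hzero (ModCat U gr) T F" by blast
  then have "(\<lambda>x \<in> Obj gr. \<lambda>m \<in> tors F x. m) x m = hzero (ModCat U gr) T F x m" by simp
  then show ?thesis using x m by (simp add: ModCat_simps(6) Gr_simps(1) T_def sub_module_simps)
qed

text \<open>A family of elements of \<open>F(y)\<close> indexed by the morphisms \<open>f : y \<rightarrow> x\<close> extends additively to all of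
  \<open>Hom(y, x)\<close>, the entry \<open>r\<close> at \<open>f\<close> acting on the member at \<open>f\<close>.\<close>

lemma sum_lift_of_family:
  assumes F: "amodule gr F" and ob: "x \<in> Obj C" "y \<in> Obj C"
    and s: "\<And>f. f \<in> Hom C y x \<Longrightarrow> s f \<in> carrier (FObj F y)"
  defines "\<sigma> \<equiv> sum_lift (FObj F y) (\<lambda>f r. FArr F y y (monomial y y (ident C y) r) (s f)) (Hom C y x)"
  shows "\<sigma> \<in> hom (hgrp gr y x) (FObj F y)"
    and "f \<in> Hom C y x \<Longrightarrow> r \<in> carrier (FObj R y) \<Longrightarrow>
      \<sigma> (monomial y x f r) = FArr F y y (monomial y y (ident C y) r) (s f)"
proof -
  interpret F: amodule gr F by fact
  have cF: "comm_group (FObj F y)" using F.comm_grp ob by (simp add: Gr_simps(1))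
  have idy: "ident C y \<in> Hom C y y" using ident_in_Hom ob by blast
  have h: "(\<lambda>r. FArr F y y (monomial y y (ident C y) r) (s f)) \<in> hom (add_monoid (FObj R y)) (FObj F y)"
    if f: "f \<in> Hom C y x" for f
  proof (rule homI)
    fix r assume "r \<in> carrier (add_monoid (FObj R y))"
    then have r: "r \<in> carrier (FObj R y)" by simp
    show "FArr F y y (monomial y y (ident C y) r) (s f) \<in> carrier (FObj F y)"
      using F.act_closed[of y y "monomial y y (ident C y) r" "s f"] ob s[OF f] monomial_in_Hom[OF ob(2) idy r]
      by (simp add: Gr_simps(1))
    fix r' assume "r' \<in> carrier (add_monoid (FObj R y))"
    then have r': "r' \<in> carrier (FObj R y)" by simp
    show "FArr F y y (monomial y y (ident C y) (r \<otimes>\<^bsub>add_monoid (FObj R y)\<^esub> r')) (s f)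
      = FArr F y y (monomial y y (ident C y) r) (s f) \<otimes>\<^bsub>FObj F y\<^esub> FArr F y y (monomial y y (ident C y) r') (s f)"
      using F.act_add[of y y "monomial y y (ident C y) r" "monomial y y (ident C y) r'" "s f"] ob s[OF f]
        monomial_in_Hom[OF ob(2) idy r] monomial_in_Hom[OF ob(2) idy r']
      by (simp add: Gr_simps(1) monomial_add[OF ob(2)])
  qed
  have g: "group (add_monoid (FObj R y))" by (rule R_add_group[OF ob(2)])
  show "\<sigma> \<in> hom (hgrp gr y x) (FObj F y)"
    unfolding \<sigma>_def Gr_simps(3) using cF g h by (rule sum_lift_hom)
  show "\<sigma> (monomial y x f r) = FArr F y y (monomial y y (ident C y) r) (s f)"
    if "f \<in> Hom C y x" "r \<in> carrier (FObj R y)"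
    unfolding \<sigma>_def monomial_def[of y x]
    using sum_lift_single[OF cF, of "Hom C y x" "\<lambda>_. add_monoid (FObj R y)"
        "\<lambda>f r. FArr F y y (monomial y y (ident C y) r) (s f)" f r] g h that by simp
qed

text \<open>The map is defined on all of \<open>Hom(y, x)\<close>, with value zero on the entries outside of \<open>T\<close>, but it is
  natural only on the linear sieve generated by \<open>T\<close>. On monomials naturality is the matching
  condition.\<close>

lemma matching_family_extends:
  assumes F: "amodule gr F" and x: "x \<in> Obj C" and T: "T \<in> J x"
    and match: "matching_family C (\<lambda>x. carrier (FObj F x)) (\<lambda>x y f. FArr F x y (emb y x f)) x T s"
  obtains \<sigma> where "\<And>y. y \<in> Obj C \<Longrightarrow> \<sigma> y \<in> hom (hgrp gr y x) (FObj F y)"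
    "\<And>y f. y \<in> Obj C \<Longrightarrow> f \<in> T y \<Longrightarrow> \<sigma> y (emb y x f) = s y f"
    "\<And>y z \<phi> \<psi>. y \<in> Obj C \<Longrightarrow> z \<in> Obj C \<Longrightarrow> \<phi> \<in> lin x T y \<Longrightarrow> \<psi> \<in> Hom gr z y \<Longrightarrow>
      \<sigma> z (comp gr z y x \<phi> \<psi>) = FArr F y z \<psi> (\<sigma> y \<phi>)"
proof -
  interpret F: amodule gr F by fact
  note sT = top.covering_sieve[OF x T]
  have sc: "s y f \<in> carrier (FObj F y)" if "y \<in> Obj C" "f \<in> T y" for y f
    using match that by (auto simp: matching_family_def)
  have smatch: "FArr F y z (emb z y g) (s y f) = s z (comp C z y x f g)"
    if "y \<in> Obj C" "z \<in> Obj C" "f \<in> T y" "g \<in> Hom C z y" for y z f g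
    using match that by (auto simp: matching_family_def)
  have gF: "group (FObj F y)" if "y \<in> Obj C" for y using F.grp that by (simp add: Gr_simps(1))
  \<comment> \<open>The value zero outside of \<open>T\<close> provides a member at every morphism.\<close>
  define s' where "s' y f = (if f \<in> T y then s y f else \<one>\<^bsub>FObj F y\<^esub>)" for y f
  have s'c: "s' y f \<in> carrier (FObj F y)" if "y \<in> Obj C" for y f
    using that sc gF[OF that] by (simp add: s'_def group.is_monoid)
  define \<sigma> where "\<sigma> y =
    sum_lift (FObj F y) (\<lambda>f r. FArr F y y (monomial y y (ident C y) r) (s' y f)) (Hom C y x)" for y
  have hom: "\<sigma> y \<in> hom (hgrp gr y x) (FObj F y)" if "y \<in> Obj C" for y
    unfolding \<sigma>_def using sum_lift_of_family(1)[OF F x that, of "s' y"] s'c[OF that] by blast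
  have \<sigma>monomial: "\<sigma> y (monomial y x f r) = FArr F y y (monomial y y (ident C y) r) (s y f)"
    if "y \<in> Obj C" "f \<in> T y" "r \<in> carrier (FObj R y)" for y f r
    using sum_lift_of_family(2)[OF F x that(1), of "s' y" f r] s'c[OF that(1)] that
      sieveD(1)[OF sT that(1,2)] by (simp add: \<sigma>_def s'_def)
  have \<sigma>hom: "group_hom (hgrp gr y x) (FObj F y) (\<sigma> y)" if "y \<in> Obj C" for y
    using hom[OF that] Gr_group[OF that] gF[OF that] by (simp add: group_hom_def group_hom_axioms_def)
  have nat_mono: "\<sigma> z (comp gr z y x (monomial y x f r) \<psi>) = FArr F y z \<psi> (\<sigma> y (monomial y x f r))"
    if y: "y \<in> Obj C" and z: "z \<in> Obj C" and f: "f \<in> T y" and r: "r \<in> carrier (FObj R y)"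
      and \<psi>: "\<psi> \<in> Hom gr z y" for y z f r \<psi>
  proof -
    note fx = sieveD(1)[OF sT y f]
    have idy: "ident C y \<in> Hom C y y" using ident_in_Hom[OF y] .
    have idz: "ident C z \<in> Hom C z z" using ident_in_Hom[OF z] .
    note mr = monomial_in_Hom[OF y idy r] and mf = monomial_in_Hom[OF y fx r]
    have n: "\<sigma> y (monomial y x f r) \<in> carrier (FObj F y)"
      using hom_in_carrier[OF hom[OF y]] mf by (simp add: Gr_simps(2))
    interpret h: group_hom "hgrp gr z x" "FObj F z" "\<sigma> z" using \<sigma>hom[OF z] .
    show ?thesis
      using z \<psi>
    proof (induction rule: Gr_induct)
      case zero
      have "FArr F y z \<one>\<^bsub>hgrp gr z y\<^esub> (\<sigma> y (monomial y x f r)) = \<one>\<^bsub>FObj F z\<^esub>"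
        using group_hom.hom_one[OF F.act_on_hom[of y z]] y z n by (simp add: Gr_simps(1))
      then show ?case using Gr_hom_zero(2)[OF z y x mf] by simp
    next
      case (monomial g)
      let ?q = "\<psi> g"
      have rg: "FArr R y z g r \<in> carrier (FObj R z)" using R_closed[OF y z monomial(1) r] .
      have rq: "FArr R y z g r \<otimes>\<^bsub>FObj R z\<^esub> ?q \<in> carrier (FObj R z)"
        using monoid.m_closed[OF R_monoid[OF z] rg monomial(3)] .
      have fg: "comp C z y x f g \<in> T z" using sieveD(2)[OF sT y z f monomial(1)] .
      have "\<sigma> z (comp gr z y x (monomial y x f r) (monomial z y g ?q))
        = FArr F z z (monomial z z (ident C z) (FArr R y z g r \<otimes>\<^bsub>FObj R z\<^esub> ?q)) (s z (comp C z y x f g))"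
        by (simp add: Gr_comp_mono[OF z y x monomial(1) fx monomial(3) r] \<sigma>monomial[OF z fg rq])
      also have "s z (comp C z y x f g) = FArr F y z (emb z y g) (s y f)"
        using smatch[OF y z f monomial(1)] by simp
      also have "FArr F z z (monomial z z (ident C z) (FArr R y z g r \<otimes>\<^bsub>FObj R z\<^esub> ?q)) (FArr F y z (emb z y g) (s y f))
        = FArr F y z (monomial z y g (FArr R y z g r \<otimes>\<^bsub>FObj R z\<^esub> ?q)) (s y f)"
        using F.act_comp[of y z z "emb z y g" "monomial z z (ident C z) (FArr R y z g r \<otimes>\<^bsub>FObj R z\<^esub> ?q)" "s y f"]
          y z emb_in_Hom[OF z monomial(1)] monomial_in_Hom[OF z idz rq] sc[OF y f]
          emb_comp_scalar[OF y z monomial(1) rq] by (simp add: Gr_simps(1))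
      also have "monomial z y g (FArr R y z g r \<otimes>\<^bsub>FObj R z\<^esub> ?q)
        = comp gr z y y (monomial y y (ident C y) r) (monomial z y g ?q)"
        using Gr_comp_mono[OF z y y monomial(1) idy monomial(3) r] comp_ident_left[OF z y monomial(1)] by simp
      also have "FArr F y z (comp gr z y y (monomial y y (ident C y) r) (monomial z y g ?q)) (s y f)
        = FArr F y z (monomial z y g ?q) (\<sigma> y (monomial y x f r))"
        using F.act_comp[of y y z "monomial y y (ident C y) r" "monomial z y g ?q" "s y f"] y z mr
          monomial_in_Hom[OF z monomial(1,3)] sc[OF y f] by (simp add: Gr_simps(1) \<sigma>monomial[OF y f r])
      finally show ?case .
    next
      case (add u v)
      have "comp gr z y x (monomial y x f r) u \<in> Hom gr z x" "comp gr z y x (monomial y x f r) v \<in> Hom gr z x"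
        using Gr_comp_in_Hom[OF z y x] add mf by blast+
      then show ?case
        using add h.hom_mult F.act_add[of y z u v] y z n
        by (simp add: Gr_comp_add_right[OF z y x add(1,2) mf] Gr_simps(1) flip: Gr_simps(2))
    qed
  qed
  have nat: "\<sigma> z (comp gr z y x \<phi> \<psi>) = FArr F y z \<psi> (\<sigma> y \<phi>)"
    if y: "y \<in> Obj C" and z: "z \<in> Obj C" and \<phi>: "\<phi> \<in> lin x T y" and \<psi>: "\<psi> \<in> Hom gr z y" for y z \<phi> \<psi>
  proof -
    interpret hy: group_hom "hgrp gr y x" "FObj F y" "\<sigma> y" using \<sigma>hom[OF y] .
    interpret hz: group_hom "hgrp gr z x" "FObj F z" "\<sigma> z" using \<sigma>hom[OF z] .
    show ?thesis
      using y \<phi>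
    proof (induction rule: lin_induct)
      case zero
      show ?case using F.act_one[of y z \<psi>] y z \<psi> Gr_hom_zero(1)[OF z y x \<psi>] by (simp add: Gr_simps(1))
    next
      case (monomial f r)
      then show ?case using nat_mono[OF y z _ _ \<psi>] by blast
    next
      case (add u v)
      have "comp gr z y x u \<psi> \<in> Hom gr z x" "comp gr z y x v \<psi> \<in> Hom gr z x"
        using Gr_comp_in_Hom[OF z y x] add \<psi> by blast+
      then show ?case
        using add hz.hom_mult hy.hom_mult hy.hom_closed F.act_mult[of y z \<psi> "\<sigma> y u" "\<sigma> y v"] y z \<psi>
        by (simp add: Gr_comp_add_left[OF z y x \<psi> add(1,2)] Gr_simps(1) flip: Gr_simps(2))
    qed
  qed
  have "\<sigma> y (emb y x f) = s y f" if "y \<in> Obj C" "f \<in> T y" for y f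
    using \<sigma>monomial[OF that R_one_closed[OF that(1)]] F.act_ident[of y "s y f"] sc[OF that] that
    by (simp add: emb_def Gr_ident Gr_simps(1))
  then show thesis using that hom nat by blast
qed

text \<open>Here \<open>D\<close> is \<open>F \<oplus> Hom(-, x)\<close>, and \<open>L\<close> is the graph of \<open>-\<sigma>\<close> on the linear sieve generated by \<open>T\<close>, so that
  \<open>E = D/L\<close> is the pushout and identifies each \<open>\<phi>\<close> in the sieve with \<open>\<sigma>(\<phi>)\<close>. The quotient \<open>B\<close> of \<open>E\<close> by \<open>F\<close>
  is torsion because every \<open>\<phi>\<close> falls into the sieve after restriction to a cover. A retraction \<open>q\<close> of
  \<open>E\<close> to \<open>F\<close> sends the class of the identity of \<open>x\<close> to the glued element.\<close>

lemma right_perp_glue: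
  fixes U :: "'m set set"
  assumes U: "size_universe U" and F: "F \<in> Obj (right_perp (ModCat U gr) (Tors U gr lintop))"
    and small: "\<And>y. y \<in> Obj C \<Longrightarrow> small U (Hom gr y x)"
    and x: "x \<in> Obj C" and T: "T \<in> J x"
    and match: "matching_family C (\<lambda>x. carrier (FObj F x)) (\<lambda>x y f. FArr F x y (emb y x f)) x T s"
  shows "\<exists>m \<in> carrier (FObj F x). \<forall>y \<in> Obj C. \<forall>f \<in> T y. FArr F x y (emb y x f) m = s y f"
proof -
  interpret M: preadditive "ModCat U gr" by (rule gr.preadditive_ModCat)
  note ob_simp = Gr_simps(1)
  note sT = top.covering_sieve[OF x T]
  have FM: "F \<in> Obj (ModCat U gr)" using F Obj_right_perp_iff by blast
  then have mF: "amodule gr F" by (simp add: gr.Obj_ModCat_iff)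
  interpret F: amodule gr F by (rule mF)
  obtain \<sigma> where \<sigma>: "\<And>y. y \<in> Obj C \<Longrightarrow> \<sigma> y \<in> hom (hgrp gr y x) (FObj F y)"
    and \<sigma>emb: "\<And>y f. y \<in> Obj C \<Longrightarrow> f \<in> T y \<Longrightarrow> \<sigma> y (emb y x f) = s y f"
    and \<sigma>nat: "\<And>y z \<phi> \<psi>. y \<in> Obj C \<Longrightarrow> z \<in> Obj C \<Longrightarrow> \<phi> \<in> lin x T y \<Longrightarrow> \<psi> \<in> Hom gr z y \<Longrightarrow>
      \<sigma> z (comp gr z y x \<phi> \<psi>) = FArr F y z \<psi> (\<sigma> y \<phi>)"
    using matching_family_extends[OF mF x T match] by blast
  have \<sigma>hom: "group_hom (hgrp gr y x) (FObj F y) (\<sigma> y)" if "y \<in> Obj C" for y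
    using \<sigma>[OF that] Gr_group[OF that] F.grp[of y] that
    by (simp add: group_hom_def group_hom_axioms_def ob_simp)
  have mP: "amodule gr (representable gr x)" using gr.amodule_representable x by (simp add: ob_simp)
  define D where "D = prod_module F (representable gr x)"
  have mD: "amodule gr D" unfolding D_def by (rule amodule_prod_module[OF mF mP])
  have carD: "carrier (FObj D y) = carrier (FObj F y) \<times> Hom gr y x" for y
    by (simp add: D_def prod_module_simps representable_def Gr_simps(2))
  have multD: "(a, \<phi>) \<otimes>\<^bsub>FObj D y\<^esub> (b, \<psi>) = (a \<otimes>\<^bsub>FObj F y\<^esub> b, \<phi> \<otimes>\<^bsub>hgrp gr y x\<^esub> \<psi>)" for a b \<phi> \<psi> y
    by (simp add: D_def prod_module_simps representable_def)
  have oneD: "\<one>\<^bsub>FObj D y\<^esub> = (\<one>\<^bsub>FObj F y\<^esub>, \<one>\<^bsub>hgrp gr y x\<^esub>)" for y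
    by (simp add: D_def prod_module_simps representable_def)
  have actD: "FArr D y z \<psi> (a, \<phi>) = (FArr F y z \<psi> a, comp gr z y x \<phi> \<psi>)"
    if "a \<in> carrier (FObj F y)" "\<phi> \<in> Hom gr y x" for y z \<psi> a \<phi>
    using that by (simp add: D_def prod_module_def representable_def Gr_simps(2))
  \<comment> \<open>Dividing by \<open>L\<close> identifies \<open>(0, \<phi>)\<close> with \<open>(\<sigma>(\<phi>), 0)\<close> for \<open>\<phi>\<close> in the sieve.\<close>
  define L where "L y = {(inv\<^bsub>FObj F y\<^esub> \<sigma> y \<phi>, \<phi>) | \<phi>. \<phi> \<in> lin x T y}" for y
  have L: "is_submodule gr D L"
    unfolding is_submodule_def ob_simp
  proof (intro conjI ballI)
    fix y assume y: "y \<in> Obj C"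
    interpret h: group_hom "hgrp gr y x" "FObj F y" "\<sigma> y" using \<sigma>hom[OF y] .
    interpret Fy: comm_group "FObj F y" using F.comm_grp y by (simp add: ob_simp)
    interpret Dy: group "FObj D y" using amodule.grp[OF mD] y by (simp add: ob_simp)
    note lin = subgroup_lin[OF y, of x T]
    have linc: "\<phi> \<in> carrier (hgrp gr y x)" if "\<phi> \<in> lin x T y" for \<phi>
      using subgroup.mem_carrier[OF lin that] .
    show "subgroup (L y) (FObj D y)"
    proof (rule Dy.subgroupI)
      show "L y \<subseteq> carrier (FObj D y)" using linc by (auto simp: L_def carD Gr_simps(2))
      show "L y \<noteq> {}" using subgroup.one_closed[OF lin] by (auto simp: L_def)
      fix a assume "a \<in> L y"
      then obtain \<phi> where \<phi>: "\<phi> \<in> lin x T y" "a = (inv\<^bsub>FObj F y\<^esub> \<sigma> y \<phi>, \<phi>)" by (auto simp: L_def)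
      have "inv\<^bsub>FObj D y\<^esub> a = (inv\<^bsub>FObj F y\<^esub> \<sigma> y (inv\<^bsub>hgrp gr y x\<^esub> \<phi>), inv\<^bsub>hgrp gr y x\<^esub> \<phi>)"
        using linc[OF \<phi>(1)] by (intro Dy.inv_equality)
          (simp_all add: \<phi>(2) multD oneD carD Gr_simps(2))
      then show "inv\<^bsub>FObj D y\<^esub> a \<in> L y" using subgroup.m_inv_closed[OF lin \<phi>(1)] by (auto simp: L_def)
      fix b assume "b \<in> L y"
      then obtain \<psi> where \<psi>: "\<psi> \<in> lin x T y" "b = (inv\<^bsub>FObj F y\<^esub> \<sigma> y \<psi>, \<psi>)" by (auto simp: L_def)
      have "a \<otimes>\<^bsub>FObj D y\<^esub> b = (inv\<^bsub>FObj F y\<^esub> \<sigma> y (\<phi> \<otimes>\<^bsub>hgrp gr y x\<^esub> \<psi>), \<phi> \<otimes>\<^bsub>hgrp gr y x\<^esub> \<psi>)"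
        using linc[OF \<phi>(1)] linc[OF \<psi>(1)] by (simp add: \<phi>(2) \<psi>(2) multD Fy.inv_mult)
      then show "a \<otimes>\<^bsub>FObj D y\<^esub> b \<in> L y" using subgroup.m_closed[OF lin \<phi>(1) \<psi>(1)] by (auto simp: L_def)
    qed
    fix z \<psi> a assume z: "z \<in> Obj C" and \<psi>: "\<psi> \<in> Hom gr z y" and "a \<in> L y"
    then obtain \<phi> where \<phi>: "\<phi> \<in> lin x T y" "a = (inv\<^bsub>FObj F y\<^esub> \<sigma> y \<phi>, \<phi>)" by (auto simp: L_def)
    have "FArr D y z \<psi> a = (inv\<^bsub>FObj F z\<^esub> \<sigma> z (comp gr z y x \<phi> \<psi>), comp gr z y x \<phi> \<psi>)"
      using linc[OF \<phi>(1)] F.act_inv[of y z \<psi> "\<sigma> y \<phi>"] y z \<psi> \<sigma>nat[OF y z \<phi>(1) \<psi>]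
      by (simp add: \<phi>(2) actD ob_simp Gr_simps(2))
    then show "FArr D y z \<psi> a \<in> L z" using lin_comp[OF x y z sT \<phi>(1) \<psi>] by (auto simp: L_def)
  qed
  have "small U (carrier (FObj D y))" if "y \<in> Obj gr" for y
    using FM that small_Times[OF U small_in_universe small[of y]]
    by (simp add: carD ob_simp gr.Obj_ModCat_iff)
  then obtain E \<pi> where E: "E \<in> Obj (ModCat U gr)" and \<pi>: "\<pi> \<in> module_maps gr D E"
    and \<pi>surj: "\<And>y. y \<in> Obj gr \<Longrightarrow> \<pi> y ` carrier (FObj D y) = carrier (FObj E y)"
    and \<pi>ker: "\<And>y d. y \<in> Obj gr \<Longrightarrow> d \<in> carrier (FObj D y) \<Longrightarrow> \<pi> y d = \<one>\<^bsub>FObj E y\<^esub> \<longleftrightarrow> d \<in> L y"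
    using gr.quotient_in_universe[OF U mD L] by blast
  have mE: "amodule gr E" using E by (simp add: gr.Obj_ModCat_iff)
  interpret E: amodule gr E by (rule mE)
  define inj where "inj = (\<lambda>y \<in> Obj gr. \<lambda>m \<in> carrier (FObj F y). (m, \<one>\<^bsub>FObj (representable gr x) y\<^esub>))"
  have inj: "inj \<in> module_maps gr F D"
    unfolding inj_def D_def by (rule prod_module_in1[OF mF mP])
  define i where "i = (\<lambda>y \<in> Obj gr. compose (carrier (FObj F y)) (\<pi> y) (inj y))"
  have i: "i \<in> module_maps gr F E" unfolding i_def by (rule module_maps_comp[OF mF inj \<pi>])
  have ival: "i y m = \<pi> y (m, \<one>\<^bsub>hgrp gr y x\<^esub>)" if "y \<in> Obj C" "m \<in> carrier (FObj F y)" for y m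
    using that by (simp add: i_def compose_def inj_def representable_def ob_simp)
  \<comment> \<open>The identification, with an additional summand \<open>a\<close> from \<open>F\<close>.\<close>
  have \<pi>lin: "\<pi> y (a, \<phi>) = i y (\<sigma> y \<phi> \<otimes>\<^bsub>FObj F y\<^esub> a)"
    if y: "y \<in> Obj C" and a: "a \<in> carrier (FObj F y)" and \<phi>: "\<phi> \<in> lin x T y" for y a \<phi>
  proof -
    interpret h: group_hom "hgrp gr y x" "FObj F y" "\<sigma> y" using \<sigma>hom[OF y] .
    interpret Ey: group "FObj E y" using E.grp y by (simp add: ob_simp)
    have \<phi>c: "\<phi> \<in> carrier (hgrp gr y x)" using subgroup.mem_carrier[OF subgroup_lin[OF y] \<phi>] .
    let ?l = "(inv\<^bsub>FObj F y\<^esub> \<sigma> y \<phi>, \<phi>)" and ?n = "(\<sigma> y \<phi> \<otimes>\<^bsub>FObj F y\<^esub> a, \<one>\<^bsub>hgrp gr y x\<^esub>)"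
    have "?l \<otimes>\<^bsub>FObj D y\<^esub> ?n = (a, \<phi>)"
      using \<phi>c a by (simp add: multD flip: h.H.m_assoc)
    moreover have l: "?l \<in> carrier (FObj D y)" "?l \<in> L y"
      using \<phi>c \<phi> by (auto simp: carD Gr_simps(2) L_def)
    moreover have n: "?n \<in> carrier (FObj D y)"
      using \<phi>c a by (simp add: carD Gr_simps(2))
    ultimately have "\<pi> y (a, \<phi>) = \<one>\<^bsub>FObj E y\<^esub> \<otimes>\<^bsub>FObj E y\<^esub> \<pi> y ?n"
      using module_maps_mult[OF \<pi>, of y ?l ?n] \<pi>ker[of y ?l] y by (simp add: ob_simp)
    then show ?thesis
      using module_maps_closed[OF \<pi>, of y ?n] n y ival[OF y, of "\<sigma> y \<phi> \<otimes>\<^bsub>FObj F y\<^esub> a"] \<phi>c a by (simp add: ob_simp)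
  qed
  have "is_submodule gr E (\<lambda>y. i y ` carrier (FObj F y))" by (rule is_submodule_image[OF mF mE i])
  moreover have "small U (carrier (FObj E y))" if "y \<in> Obj gr" for y
    using E that small_in_universe by (auto simp: gr.Obj_ModCat_iff)
  ultimately obtain B p where B: "B \<in> Obj (ModCat U gr)" and p: "p \<in> module_maps gr E B"
    and psurj: "\<And>y. y \<in> Obj gr \<Longrightarrow> p y ` carrier (FObj E y) = carrier (FObj B y)"
    and pker: "\<And>y e. y \<in> Obj gr \<Longrightarrow> e \<in> carrier (FObj E y) \<Longrightarrow> p y e = \<one>\<^bsub>FObj B y\<^esub> \<longleftrightarrow> e \<in> i y ` carrier (FObj F y)"
    using gr.quotient_in_universe[OF U mE] by blast
  have mB: "amodule gr B" using B by (simp add: gr.Obj_ModCat_iff)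
  have ext: "(E, i, p) \<in> extensions (ModCat U gr) B F"
  proof (rule gr.exact_extension[OF FM E B i p _ pker psurj])
    fix y m assume y: "y \<in> Obj gr" and m: "m \<in> carrier (FObj F y)" and im: "i y m = \<one>\<^bsub>FObj E y\<^esub>"
    have yC: "y \<in> Obj C" using y by (simp add: ob_simp)
    interpret h: group_hom "hgrp gr y x" "FObj F y" "\<sigma> y" using \<sigma>hom[OF yC] .
    have "(m, \<one>\<^bsub>hgrp gr y x\<^esub>) \<in> L y"
      using \<pi>ker[OF y, of "(m, \<one>\<^bsub>hgrp gr y x\<^esub>)"] ival[OF yC m] im m Gr_zero_in_Hom[OF yC] by (simp add: carD)
    then show "m = \<one>\<^bsub>FObj F y\<^esub>" by (auto simp: L_def)
  qed
  have "carrier (FObj B y) \<subseteq> tors B y" if y: "y \<in> Obj C" for y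
  proof
    fix b assume b: "b \<in> carrier (FObj B y)"
    have yg: "y \<in> Obj gr" using y by (simp add: ob_simp)
    obtain e where e: "e \<in> carrier (FObj E y)" "b = p y e" using psurj[OF yg] b by (metis imageE)
    obtain d where d: "d \<in> carrier (FObj D y)" "e = \<pi> y d" using \<pi>surj[OF yg] e(1) by (metis imageE)
    obtain a \<phi> where a: "a \<in> carrier (FObj F y)" and \<phi>: "\<phi> \<in> Hom gr y x" and dd: "d = (a, \<phi>)"
      using d(1) by (auto simp: carD)
    obtain T' where T': "T' \<in> J y"
      "\<And>z g. z \<in> Obj C \<Longrightarrow> g \<in> T' z \<Longrightarrow> comp gr z y x \<phi> (emb z y g) \<in> lin x T z"
      using covering_pullback_Gr[OF x y T \<phi>] by blast
    show "b \<in> tors B y"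
    proof (rule torsI[OF b T'(1)])
      fix z g assume z: "z \<in> Obj C" and g: "g \<in> T' z"
      have zg: "z \<in> Obj gr" using z by (simp add: ob_simp)
      have ge: "emb z y g \<in> Hom gr z y" using emb_in_Hom[OF z cover_Hom[OF y T'(1) z g]] .
      interpret h: group_hom "hgrp gr z x" "FObj F z" "\<sigma> z" using \<sigma>hom[OF z] .
      have ac: "FArr F y z (emb z y g) a \<in> carrier (FObj F z)" using F.act_closed[OF yg zg ge a] .
      let ?\<phi> = "comp gr z y x \<phi> (emb z y g)"
      have \<phi>c: "?\<phi> \<in> carrier (hgrp gr z x)"
        using subgroup.mem_carrier[OF subgroup_lin[OF z] T'(2)[OF z g]] .
      have "FArr B y z (emb z y g) b = p z (FArr E y z (emb z y g) e)"
        using module_maps_natural[OF p yg zg ge e(1)] e(2) by simp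
      also have "FArr E y z (emb z y g) e = \<pi> z (FArr D y z (emb z y g) d)"
        using module_maps_natural[OF \<pi> yg zg ge d(1)] d(2) by simp
      also have "\<dots> = i z (\<sigma> z ?\<phi> \<otimes>\<^bsub>FObj F z\<^esub> FArr F y z (emb z y g) a)"
        unfolding dd actD[OF a \<phi>] by (rule \<pi>lin[OF z ac T'(2)[OF z g]])
      also have "p z (i z (\<sigma> z ?\<phi> \<otimes>\<^bsub>FObj F z\<^esub> FArr F y z (emb z y g) a)) = \<one>\<^bsub>FObj B z\<^esub>"
        using pker[OF zg module_maps_closed[OF i zg]] ac \<phi>c by simp
      finally show "FArr B y z (emb z y g) b = \<one>\<^bsub>FObj B z\<^esub>" .
    qed
  qed
  then have "torsion gr lintop B" by (simp add: torsion_iff[OF mB])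
  then obtain t where t: "t \<in> Hom (ModCat U gr) B E" "comp (ModCat U gr) B E B p t = ident (ModCat U gr) B"
    using F B ext unfolding Obj_right_perp_iff by blast
  have "is_kernel (ModCat U gr) F E B i p" using ext by (simp add: extensions_def)
  then obtain q where q: "q \<in> Hom (ModCat U gr) E F" "comp (ModCat U gr) F E F q i = ident (ModCat U gr) F"
    using M.kernel_section_biproduct[OF FM E B _ t] by metis
  have qm: "q \<in> module_maps gr E F" using q(1) by (simp add: ModCat_simps(1))
  have qi: "q y (i y m) = m" if "y \<in> Obj C" "m \<in> carrier (FObj F y)" for y m
    using ModCat_comp_apply[of y gr m F U E F q i] q(2) that by (simp add: ob_simp ModCat_simps(2))
  have xg: "x \<in> Obj gr" using x by (simp add: ob_simp)
  have idx: "ident gr x \<in> Hom gr x x" using gr.ident_in_Hom[OF xg] .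
  interpret Fx: group "FObj F x" using F.grp[OF xg] .
  have d: "(\<one>\<^bsub>FObj F x\<^esub>, ident gr x) \<in> carrier (FObj D x)" using idx by (simp add: carD)
  define m where "m = q x (\<pi> x (\<one>\<^bsub>FObj F x\<^esub>, ident gr x))"
  have "FArr F x y (emb y x f) m = s y f" if y: "y \<in> Obj C" and f: "f \<in> T y" for y f
  proof -
    have yg: "y \<in> Obj gr" using y by (simp add: ob_simp)
    note fx = sieveD(1)[OF sT y f]
    have fe: "emb y x f \<in> Hom gr y x" using emb_in_Hom[OF y fx] .
    interpret Fy: group "FObj F y" using F.grp[OF yg] .
    have sc: "s y f \<in> carrier (FObj F y)" using match y f by (auto simp: matching_family_def)
    have 1: "FArr F x y (emb y x f) m = q y (FArr E x y (emb y x f) (\<pi> x (\<one>\<^bsub>FObj F x\<^esub>, ident gr x)))"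
      using module_maps_natural[OF qm xg yg fe module_maps_closed[OF \<pi> xg d]] by (simp add: m_def)
    have 2: "FArr E x y (emb y x f) (\<pi> x (\<one>\<^bsub>FObj F x\<^esub>, ident gr x))
      = \<pi> y (FArr D x y (emb y x f) (\<one>\<^bsub>FObj F x\<^esub>, ident gr x))"
      using module_maps_natural[OF \<pi> xg yg fe d] by simp
    have 3: "FArr D x y (emb y x f) (\<one>\<^bsub>FObj F x\<^esub>, ident gr x) = (\<one>\<^bsub>FObj F y\<^esub>, emb y x f)"
      unfolding actD[OF Fx.one_closed idx] F.act_one[OF xg yg fe] gr.comp_ident_left[OF yg xg fe] ..
    have lf: "emb y x f \<in> lin x T y"
      unfolding emb_def using y fx f R_one_closed[OF y] by (rule monomial_in_lin)
    show ?thesis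
      unfolding 1 2 3 \<pi>lin[OF y Fy.one_closed lf] \<sigma>emb[OF y f] Fy.r_one[OF sc] by (rule qi[OF y sc])
  qed
  moreover have "m \<in> carrier (FObj F x)"
    unfolding m_def using module_maps_closed[OF qm xg module_maps_closed[OF \<pi> xg d]] .
  ultimately show ?thesis by blast
qed

lemma right_perp_is_sheaf:
  fixes U :: "'m set set"
  assumes U: "size_universe U" and F: "F \<in> Obj (right_perp (ModCat U gr) (Tors U gr lintop))"
    and small: "\<And>x y. x \<in> Obj C \<Longrightarrow> y \<in> Obj C \<Longrightarrow> small U (Hom gr y x)"
  shows "is_sheaf F"
  unfolding is_sheaf_def set_sheaf_def
proof (intro ballI allI impI)
  fix x T s assume x: "x \<in> Obj C" and T: "T \<in> J x"
    and match: "matching_family C (\<lambda>x. carrier (FObj F x)) (\<lambda>x y f. FArr F x y (emb y x f)) x T s"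
  have "F \<in> Obj (ModCat U gr)" using F Obj_right_perp_iff by blast
  then have mF: "amodule gr F" by (simp add: gr.Obj_ModCat_iff)
  interpret F: amodule gr F by (rule mF)
  have xg: "x \<in> Obj gr" using x by (simp add: Gr_simps(1))
  interpret Fx: group "FObj F x" using F.grp[OF xg] .
  obtain m where m: "m \<in> carrier (FObj F x)"
    "\<And>y f. y \<in> Obj C \<Longrightarrow> f \<in> T y \<Longrightarrow> FArr F x y (emb y x f) m = s y f"
    using right_perp_glue[OF U F small[OF x] x T match] by blast
  have uniq: "n = m" if n: "n \<in> carrier (FObj F x)" "\<forall>y \<in> Obj C. \<forall>f \<in> T y. FArr F x y (emb y x f) n = s y f" for n
  proof -
    have "n \<otimes>\<^bsub>FObj F x\<^esub> inv\<^bsub>FObj F x\<^esub> m \<in> tors F x"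
    proof (rule torsI[OF _ T])
      show "n \<otimes>\<^bsub>FObj F x\<^esub> inv\<^bsub>FObj F x\<^esub> m \<in> carrier (FObj F x)" using n(1) m(1) by simp
      fix y f assume y: "y \<in> Obj C" and f: "f \<in> T y"
      have yg: "y \<in> Obj gr" using y by (simp add: Gr_simps(1))
      have fe: "emb y x f \<in> Hom gr y x" using emb_in_Hom[OF y cover_Hom[OF x T y f]] .
      interpret Fy: group "FObj F y" using F.grp[OF yg] .
      have "s y f \<in> carrier (FObj F y)" using match y f by (auto simp: matching_family_def)
      then show "FArr F x y (emb y x f) (n \<otimes>\<^bsub>FObj F x\<^esub> inv\<^bsub>FObj F x\<^esub> m) = \<one>\<^bsub>FObj F y\<^esub>"
        using n m y f by (simp add: F.act_mult[OF xg yg fe] F.act_inv[OF xg yg fe])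
    qed
    then have "n \<otimes>\<^bsub>FObj F x\<^esub> inv\<^bsub>FObj F x\<^esub> m = \<one>\<^bsub>FObj F x\<^esub>"
      using right_perp_torsion_free[OF U F x] by blast
    then show ?thesis using n(1) m(1) by (metis Fx.inv_equality Fx.inv_inv Fx.inv_closed)
  qed
  show "\<exists>!m. m \<in> carrier (FObj F x) \<and> (\<forall>y \<in> Obj C. \<forall>f \<in> T y. FArr F x y (emb y x f) m = s y f)"
    by (rule ex1I[of _ m]) (use m in blast, rule uniq, blast+)
qed

end

section \<open>Presheaves of modules as modules over the linear Grothendieck construction\<close>

lemma comm_group_cong:
  assumes G: "comm_group G"
    and "carrier H = carrier G" "mult H = mult G" "one H = one G"
  shows "comm_group H"
proof -
  interpret comm_group G by fact
  have "group H"
    by (rule groupI) (use assms in \<open>auto simp: m_assoc intro: l_inv_ex\<close>)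
  then show ?thesis
    by (rule group.group_comm_groupI) (simp add: assms m_comm)
qed

lemma presheaf_hom_iff:
  "\<eta> \<in> presheaf_of_modules_hom U K C R M N \<longleftrightarrow>
    \<eta> \<in> extensional (Obj C) \<and>
    (\<forall>x \<in> Obj C. \<eta> x \<in> extensional (carrier (FObj M x)) \<and>
      (\<forall>m \<in> carrier (FObj M x). \<eta> x m \<in> carrier (FObj N x)) \<and>
      (\<forall>m \<in> carrier (FObj M x). \<forall>n \<in> carrier (FObj M x).
        \<eta> x (m \<oplus>\<^bsub>FObj M x\<^esub> n) = \<eta> x m \<oplus>\<^bsub>FObj N x\<^esub> \<eta> x n) \<and>
      (\<forall>c \<in> carrier K. \<forall>m \<in> carrier (FObj M x). \<eta> x (c \<odot>\<^bsub>FObj M x\<^esub> m) = c \<odot>\<^bsub>FObj N x\<^esub> \<eta> x m)) \<and>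
    (\<forall>x \<in> Obj C. \<forall>y \<in> Obj C. \<forall>f \<in> Hom C y x. \<forall>m \<in> carrier (FObj M x).
      \<eta> y (FArr M x y f m) = FArr N x y f (\<eta> x m)) \<and>
    (\<forall>x \<in> Obj C. \<forall>m \<in> carrier (FObj M x). \<forall>r \<in> carrier (FObj R x).
      \<eta> x (act M x m r) = act N x (\<eta> x m) r)"
proof -
  have comp_eq: "compose S g f = compose S g' f' \<longleftrightarrow> (\<forall>m \<in> S. g (f m) = g' (f' m))"
    for S :: "'s set" and f :: "'s \<Rightarrow> 't" and g :: "'t \<Rightarrow> 'u" and f' :: "'s \<Rightarrow> 't'" and g' :: "'t' \<Rightarrow> 'u"
    by (auto simp: compose_def fun_eq_iff restrict_def)
  show ?thesis
    unfolding presheaf_of_modules_hom_def nat_transformations_def opp_simps KMod_def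
    by (auto simp: comp_eq PiE_iff hom_def Pi_iff)
qed

locale module_presheaf = algebra_presheaf C K R
  for C :: "('o, 'a) category" and K :: "'k ring"
    and R :: "('o, 'a, ('k, 'r) module, 'r \<Rightarrow> 'r) cfunctor" +
  fixes U :: "'m set set" and M :: "('o, 'a, 'k, 'r, 'm) rmodule_data"
  assumes presheaf: "presheaf_of_modules U K C R M"
begin

lemma M_functor: "cfunctor (opp C) (KMod U K) M"
  using presheaf by (simp add: presheaf_of_modules_def)

lemma M_module: "x \<in> Obj C \<Longrightarrow> module K (FObj M x)"
  and M_carrier: "x \<in> Obj C \<Longrightarrow> carrier (FObj M x) \<in> U"
  using cfunctor.FObj_in_Obj[OF M_functor, of x] by (simp_all add: opp_simps KMod_def)

lemma M_abelian: "x \<in> Obj C \<Longrightarrow> abelian_group (FObj M x)"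
  using M_module module.axioms(2) by blast

lemma M_restrict:
  assumes "x \<in> Obj C" "y \<in> Obj C" "f \<in> Hom C y x"
  shows M_closed: "m \<in> carrier (FObj M x) \<Longrightarrow> FArr M x y f m \<in> carrier (FObj M y)"
    and M_add: "m \<in> carrier (FObj M x) \<Longrightarrow> n \<in> carrier (FObj M x) \<Longrightarrow>
      FArr M x y f (m \<oplus>\<^bsub>FObj M x\<^esub> n) = FArr M x y f m \<oplus>\<^bsub>FObj M y\<^esub> FArr M x y f n"
  using cfunctor.FArr_in_Hom[OF M_functor, of x y f] assms
  by (auto simp: opp_simps KMod_def hom_def)

lemma M_ident: "x \<in> Obj C \<Longrightarrow> m \<in> carrier (FObj M x) \<Longrightarrow> FArr M x x (ident C x) m = m"
  using cfunctor.FArr_ident[OF M_functor, of x] by (simp add: opp_simps KMod_def)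

lemma M_comp:
  assumes "x \<in> Obj C" "y \<in> Obj C" "z \<in> Obj C" "f \<in> Hom C y x" "g \<in> Hom C z y" "m \<in> carrier (FObj M x)"
  shows "FArr M x z (comp C z y x f g) m = FArr M y z g (FArr M x y f m)"
  using cfunctor.FArr_comp[OF M_functor, of x y z f g] assms
  by (simp add: opp_simps KMod_def compose_def)

lemma M_right_module: "x \<in> Obj C \<Longrightarrow> right_module K (FObj R x) (FObj M x) (act M x)"
  using presheaf by (simp add: presheaf_of_modules_def)

lemma M_act:
  assumes "x \<in> Obj C" "m \<in> carrier (FObj M x)"
  shows M_act_closed: "r \<in> carrier (FObj R x) \<Longrightarrow> act M x m r \<in> carrier (FObj M x)"
    and M_act_add_left: "n \<in> carrier (FObj M x) \<Longrightarrow> r \<in> carrier (FObj R x) \<Longrightarrow>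
      act M x (m \<oplus>\<^bsub>FObj M x\<^esub> n) r = act M x m r \<oplus>\<^bsub>FObj M x\<^esub> act M x n r"
    and M_act_add: "r \<in> carrier (FObj R x) \<Longrightarrow> s \<in> carrier (FObj R x) \<Longrightarrow>
      act M x m (r \<oplus>\<^bsub>FObj R x\<^esub> s) = act M x m r \<oplus>\<^bsub>FObj M x\<^esub> act M x m s"
    and M_act_mult: "r \<in> carrier (FObj R x) \<Longrightarrow> s \<in> carrier (FObj R x) \<Longrightarrow>
      act M x m (r \<otimes>\<^bsub>FObj R x\<^esub> s) = act M x (act M x m r) s"
    and M_act_one: "act M x m \<one>\<^bsub>FObj R x\<^esub> = m"
    and M_act_smult: "c \<in> carrier K \<Longrightarrow> r \<in> carrier (FObj R x) \<Longrightarrow>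
      act M x m (c \<odot>\<^bsub>FObj R x\<^esub> r) = c \<odot>\<^bsub>FObj M x\<^esub> act M x m r"
  using M_right_module[OF assms(1)] assms(2) by (auto simp: right_module_def)

lemma M_act_restrict:
  assumes "x \<in> Obj C" "y \<in> Obj C" "f \<in> Hom C y x" "m \<in> carrier (FObj M x)" "r \<in> carrier (FObj R x)"
  shows "FArr M x y f (act M x m r) = act M y (FArr M x y f m) (FArr R x y f r)"
  using presheaf assms by (simp add: presheaf_of_modules_def)

end

definition add_grp :: "('m, 'z) ring_scheme \<Rightarrow> 'm monoid" where
  "add_grp M = \<lparr>carrier = carrier M, monoid.mult = (\<oplus>\<^bsub>M\<^esub>), one = \<zero>\<^bsub>M\<^esub>\<rparr>"

lemma add_grp_simps:
  "carrier (add_grp M) = carrier M" "mult (add_grp M) = add M" "\<one>\<^bsub>add_grp M\<^esub> = \<zero>\<^bsub>M\<^esub>"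
  by (simp_all add: add_grp_def)

lemma comm_group_add_grp: "abelian_group M \<Longrightarrow> comm_group (add_grp M)"
  by (rule comm_group_cong[OF abelian_group.a_comm_group]) (simp_all add: add_grp_simps)

text \<open>A family \<open>(r\<^sub>f)\<close> acts on \<open>m\<close> by \<open>\<Sum>\<^sub>f (m|\<^sub>f) r\<^sub>f\<close>.\<close>

definition to_gr ::
  "('o, 'a) category \<Rightarrow> ('o, 'a, 'k, 'r, 'm) rmodule_data \<Rightarrow>
   ('o, 'a \<Rightarrow> 'r, 'm monoid, 'm \<Rightarrow> 'm) cfunctor" where
  "to_gr C M = \<lparr>FObj = (\<lambda>x. add_grp (FObj M x)),
    FArr = (\<lambda>x y \<phi>. \<lambda>m \<in> carrier (FObj M x).
      sum_lift (add_grp (FObj M y)) (\<lambda>f. act M y (FArr M x y f m)) (Hom C y x) \<phi>)\<rparr>"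

lemma to_gr_simps:
  "carrier (FObj (to_gr C M) x) = carrier (FObj M x)"
  "m \<otimes>\<^bsub>FObj (to_gr C M) x\<^esub> n = m \<oplus>\<^bsub>FObj M x\<^esub> n"
  "\<one>\<^bsub>FObj (to_gr C M) x\<^esub> = \<zero>\<^bsub>FObj M x\<^esub>"
  "FObj (to_gr C M) x = add_grp (FObj M x)"
  by (simp_all add: to_gr_def add_grp_simps)

context module_presheaf
begin

lemma to_gr_hom:
  assumes "x \<in> Obj C" "y \<in> Obj C" "m \<in> carrier (FObj M x)"
  shows "group_hom (hgrp gr y x) (add_grp (FObj M y)) (\<lambda>\<phi>. FArr (to_gr C M) x y \<phi> m)"
    and to_gr_mono: "f \<in> Hom C y x \<Longrightarrow> r \<in> carrier (FObj R y) \<Longrightarrow>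
      FArr (to_gr C M) x y (monomial y x f r) m = act M y (FArr M x y f m) r"
proof -
  have cg: "comm_group (add_grp (FObj M y))" using comm_group_add_grp M_abelian assms(2) by blast
  have h: "act M y (FArr M x y f m) \<in> hom (add_monoid (FObj R y)) (add_grp (FObj M y))"
    if "f \<in> Hom C y x" for f
    using M_act_closed[OF assms(2) M_closed[OF assms(1,2) that assms(3)]]
      M_act_add[OF assms(2) M_closed[OF assms(1,2) that assms(3)]]
    by (intro homI) (simp_all add: add_grp_simps)
  have g: "group (add_monoid (FObj R y))" by (rule R_add_group[OF assms(2)])
  have eq: "FArr (to_gr C M) x y \<phi> m
    = sum_lift (add_grp (FObj M y)) (\<lambda>f. act M y (FArr M x y f m)) (Hom C y x) \<phi>" for \<phi>
    using assms(3) by (simp add: to_gr_def)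
  have "(\<lambda>\<phi>. FArr (to_gr C M) x y \<phi> m) \<in> hom (hgrp gr y x) (add_grp (FObj M y))"
    unfolding eq Gr_simps(3) using cg g h by (rule sum_lift_hom)
  then show "group_hom (hgrp gr y x) (add_grp (FObj M y)) (\<lambda>\<phi>. FArr (to_gr C M) x y \<phi> m)"
    using Gr_group[OF assms(2)] cg by (simp add: group_hom_def group_hom_axioms_def comm_group_def)
  show "FArr (to_gr C M) x y (monomial y x f r) m = act M y (FArr M x y f m) r"
    if "f \<in> Hom C y x" "r \<in> carrier (FObj R y)"
    unfolding eq monomial_def
    using sum_lift_single[OF cg, of "Hom C y x" "\<lambda>_. add_monoid (FObj R y)"
        "\<lambda>f. act M y (FArr M x y f m)" f r] g h that by simp
qed

lemma to_gr_zero: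
  assumes "x \<in> Obj C" "y \<in> Obj C" "m \<in> carrier (FObj M x)"
  shows "FArr (to_gr C M) x y \<one>\<^bsub>hgrp gr y x\<^esub> m = \<zero>\<^bsub>FObj M y\<^esub>"
  using group_hom.hom_one[OF to_gr_hom(1)[OF assms]] by (simp add: add_grp_simps)

lemma to_gr_add:
  assumes "x \<in> Obj C" "y \<in> Obj C" "m \<in> carrier (FObj M x)" "\<phi> \<in> Hom gr y x" "\<psi> \<in> Hom gr y x"
  shows "FArr (to_gr C M) x y (\<phi> \<otimes>\<^bsub>hgrp gr y x\<^esub> \<psi>) m
    = FArr (to_gr C M) x y \<phi> m \<oplus>\<^bsub>FObj M y\<^esub> FArr (to_gr C M) x y \<psi> m"
  using group_hom.hom_mult[OF to_gr_hom(1)[OF assms(1-3)], of \<phi> \<psi>] assms(4,5)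
  by (simp add: add_grp_simps Gr_simps(2))

lemma to_gr_closed:
  assumes "x \<in> Obj C" "y \<in> Obj C" "m \<in> carrier (FObj M x)" "\<phi> \<in> Hom gr y x"
  shows "FArr (to_gr C M) x y \<phi> m \<in> carrier (FObj M y)"
  using group_hom.hom_closed[OF to_gr_hom(1)[OF assms(1-3)], of \<phi>] assms(4)
  by (simp add: add_grp_simps Gr_simps(2))

lemma to_gr_emb:
  assumes "x \<in> Obj C" "y \<in> Obj C" "m \<in> carrier (FObj M x)" "f \<in> Hom C y x"
  shows "FArr (to_gr C M) x y (monomial y x f \<one>\<^bsub>FObj R y\<^esub>) m = FArr M x y f m"
  using to_gr_mono[OF assms(1-4)] M_act_one[OF assms(2) M_closed[OF assms(1,2,4,3)]]
    monoid.one_closed[OF ring.is_monoid[OF R_ring[OF assms(2)]]] by simp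

lemma to_gr_mult:
  assumes ob: "x \<in> Obj C" "y \<in> Obj C" and m: "m \<in> carrier (FObj M x)" "n \<in> carrier (FObj M x)"
    and \<phi>: "\<phi> \<in> Hom gr y x"
  shows "FArr (to_gr C M) x y \<phi> (m \<oplus>\<^bsub>FObj M x\<^esub> n)
    = FArr (to_gr C M) x y \<phi> m \<oplus>\<^bsub>FObj M y\<^esub> FArr (to_gr C M) x y \<phi> n"
proof -
  interpret Mx: abelian_group "FObj M x" using M_abelian ob by blast
  interpret My: abelian_group "FObj M y" using M_abelian ob by blast
  have mn: "m \<oplus>\<^bsub>FObj M x\<^esub> n \<in> carrier (FObj M x)" using m by simp
  show ?thesis
    using ob(2) \<phi>
  proof (induction rule: Gr_induct)
    case zero then show ?case using m mn by (simp add: to_gr_zero ob)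
  next
    case (monomial f)
    then show ?case
      using m mn ob M_closed[OF ob monomial(1)] by (simp add: to_gr_mono M_add M_act_add_left)
  next
    case (add u v)
    then show ?case
      using m mn ob to_gr_closed[OF ob] by (simp add: to_gr_add My.a_ac)
  qed
qed

text \<open>On monomials this is the compatibility of the action with restriction; additivity in \<open>\<phi>\<close>, in \<open>\<psi>\<close> and
  in \<open>m\<close> does the rest.\<close>

lemma to_gr_comp:
  assumes ob: "x \<in> Obj C" "y \<in> Obj C" "z \<in> Obj C" and m: "m \<in> carrier (FObj M x)"
    and \<phi>: "\<phi> \<in> Hom gr y x" and \<psi>: "\<psi> \<in> Hom gr z y"
  shows "FArr (to_gr C M) x z (comp gr z y x \<phi> \<psi>) m = FArr (to_gr C M) y z \<psi> (FArr (to_gr C M) x y \<phi> m)"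
proof -
  interpret My: abelian_group "FObj M y" using M_abelian ob by blast
  interpret Mz: abelian_group "FObj M z" using M_abelian ob by blast
  have act_zero: "FArr (to_gr C M) y z \<theta> \<zero>\<^bsub>FObj M y\<^esub> = \<zero>\<^bsub>FObj M z\<^esub>" if "\<theta> \<in> Hom gr z y" for \<theta>
  proof -
    have "FArr (to_gr C M) y z \<theta> (\<zero>\<^bsub>FObj M y\<^esub> \<oplus>\<^bsub>FObj M y\<^esub> \<zero>\<^bsub>FObj M y\<^esub>)
      = FArr (to_gr C M) y z \<theta> \<zero>\<^bsub>FObj M y\<^esub> \<oplus>\<^bsub>FObj M z\<^esub> FArr (to_gr C M) y z \<theta> \<zero>\<^bsub>FObj M y\<^esub>"
      by (rule to_gr_mult[OF ob(2,3) My.zero_closed My.zero_closed that])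
    then show ?thesis
      using to_gr_closed[OF ob(2,3) My.zero_closed that] Mz.add.r_cancel_one' by simp
  qed
  have *: "FArr (to_gr C M) x z (comp gr z y x (monomial y x f r) \<psi>) m
      = FArr (to_gr C M) y z \<psi> (FArr (to_gr C M) x y (monomial y x f r) m)"
    if f: "f \<in> Hom C y x" and r: "r \<in> carrier (FObj R y)" for f r
  proof -
    note mf = monomial_in_Hom[OF ob(2) f r] and fm = M_closed[OF ob(1,2) f m]
    have am: "act M y (FArr M x y f m) r \<in> carrier (FObj M y)" using M_act_closed[OF ob(2) fm r] .
    show ?thesis
      using ob(3) \<psi>
    proof (induction rule: Gr_induct)
      case zero
      then show ?case
        using to_gr_zero[OF ob(2,3) am] m ob f r
        by (simp add: Gr_hom_zero(2)[OF ob(3,2,1) mf] to_gr_zero to_gr_mono)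
    next
      case (monomial g)
      then show ?case
        using m ob f r am fm comp_in_Hom[OF ob(3,2,1) monomial(1) f] R_closed[OF ob(2,3) monomial(1) r]
          monoid.m_closed[OF ring.is_monoid[OF R_ring[OF ob(3)]] R_closed[OF ob(2,3) monomial(1) r] monomial(3)]
          M_closed[OF ob(2,3) monomial(1) fm]
        by (simp add: Gr_comp_mono to_gr_mono M_comp M_act_restrict M_act_mult)
    next
      case (add u v)
      then show ?case
        using m ob f r am Gr_comp_in_Hom[OF ob(3,2,1) _ mf]
        by (simp add: Gr_comp_add_right[OF ob(3,2,1) _ _ mf] to_gr_add to_gr_mono)
    qed
  qed
  show ?thesis
    using ob(2) \<phi>
  proof (induction rule: Gr_induct)
    case zero
    then show ?case using \<psi> m ob by (simp add: Gr_hom_zero(1)[OF ob(3,2,1) \<psi>] to_gr_zero act_zero)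
  next
    case (monomial f) then show ?case by (intro *)
  next
    case (add u v)
    then show ?case
      using \<psi> m ob Gr_comp_in_Hom[OF ob(3,2,1) \<psi>] to_gr_closed[OF ob(1,2) m]
      by (simp add: Gr_comp_add_left[OF ob(3,2,1) \<psi>] to_gr_add to_gr_mult)
  qed
qed

lemma amodule_to_gr: "amodule gr (to_gr C M)"
proof (intro amodule.intro amodule_axioms.intro gr.preadditive_axioms; unfold Gr_simps(1) to_gr_simps(1,2))
  fix x assume x: "x \<in> Obj C"
  show "comm_group (FObj (to_gr C M) x)"
    unfolding to_gr_simps using comm_group_add_grp M_abelian x by blast
  fix y assume y: "y \<in> Obj C"
  show "FArr (to_gr C M) x y \<phi> \<in> group_maps (FObj (to_gr C M) x) (FObj (to_gr C M) y)"
    if "\<phi> \<in> Hom gr y x" for \<phi>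
  proof -
    have "FArr (to_gr C M) x y \<phi> \<in> extensional (carrier (FObj M x))" by (simp add: to_gr_def)
    then show ?thesis
      using to_gr_closed[OF x y _ that] to_gr_mult[OF x y _ _ that]
      by (auto simp: group_maps_def to_gr_simps(1,2) intro!: homI)
  qed
next
  fix x m assume x: "x \<in> Obj C" and m: "m \<in> carrier (FObj M x)"
  show "FArr (to_gr C M) x x (ident gr x) m = m"
    unfolding Gr_ident using to_gr_emb[OF x x m ident_in_Hom[OF x]] M_ident[OF x m] by simp
qed (simp_all add: to_gr_comp to_gr_add)

end

section \<open>Modules over the linear Grothendieck construction as presheaves of modules\<close>

context algebra_site
begin

text \<open>Multiplication by \<open>r \<in> R(x)\<close> is the action of the monomial with entry \<open>r\<close> at the identity.\<close>

definition scal :: "('o, 'a \<Rightarrow> 'r, 'm monoid, 'm \<Rightarrow> 'm) cfunctor \<Rightarrow> 'o \<Rightarrow> 'r \<Rightarrow> 'm \<Rightarrow> 'm" where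
  "scal F x r = FArr F x x (monomial x x (ident C x) r)"

text \<open>Scalars from \<open>K\<close> act through their images in \<open>R(x)\<close>, as the compatibility of the two actions
  enforces. The multiplicative fields of the record carry no information.\<close>

definition from_gr ::
  "('o, 'a \<Rightarrow> 'r, 'm monoid, 'm \<Rightarrow> 'm) cfunctor \<Rightarrow> ('o, 'a, 'k, 'r, 'm) rmodule_data" where
  "from_gr F = \<lparr>FObj = (\<lambda>x. \<lparr>carrier = carrier (FObj F x), monoid.mult = undefined, one = undefined,
      ring.zero = \<one>\<^bsub>FObj F x\<^esub>, add = (\<otimes>\<^bsub>FObj F x\<^esub>),
      smult = (\<lambda>c. scal F x (c \<odot>\<^bsub>FObj R x\<^esub> \<one>\<^bsub>FObj R x\<^esub>))\<rparr>),
    FArr = (\<lambda>x y f. FArr F x y (emb y x f)),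
    act = (\<lambda>x m r. scal F x r m)\<rparr>"

lemma from_gr_simps:
  "carrier (FObj (from_gr F) x) = carrier (FObj F x)"
  "\<zero>\<^bsub>FObj (from_gr F) x\<^esub> = \<one>\<^bsub>FObj F x\<^esub>"
  "m \<oplus>\<^bsub>FObj (from_gr F) x\<^esub> n = m \<otimes>\<^bsub>FObj F x\<^esub> n"
  "c \<odot>\<^bsub>FObj (from_gr F) x\<^esub> m = scal F x (c \<odot>\<^bsub>FObj R x\<^esub> \<one>\<^bsub>FObj R x\<^esub>) m"
  "FArr (from_gr F) x y f = FArr F x y (emb y x f)"
  "act (from_gr F) x m r = scal F x r m"
  by (simp_all add: from_gr_def)

lemma R_module: "x \<in> Obj C \<Longrightarrow> module K (FObj R x)"
  using R_algebra by (simp add: k_algebra_def)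

lemma R_unit_scalar:
  assumes "x \<in> Obj C" "c \<in> carrier K"
  shows R_smult_one_closed: "c \<odot>\<^bsub>FObj R x\<^esub> \<one>\<^bsub>FObj R x\<^esub> \<in> carrier (FObj R x)"
    and R_smult_one_left: "r \<in> carrier (FObj R x) \<Longrightarrow>
      (c \<odot>\<^bsub>FObj R x\<^esub> \<one>\<^bsub>FObj R x\<^esub>) \<otimes>\<^bsub>FObj R x\<^esub> r = c \<odot>\<^bsub>FObj R x\<^esub> r"
    and R_smult_one_right: "r \<in> carrier (FObj R x) \<Longrightarrow>
      r \<otimes>\<^bsub>FObj R x\<^esub> (c \<odot>\<^bsub>FObj R x\<^esub> \<one>\<^bsub>FObj R x\<^esub>) = c \<odot>\<^bsub>FObj R x\<^esub> r"
proof -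
  interpret ring "FObj R x" by (rule R_ring[OF assms(1)])
  show "c \<odot>\<^bsub>FObj R x\<^esub> \<one>\<^bsub>FObj R x\<^esub> \<in> carrier (FObj R x)"
    using module.smult_closed[OF R_module[OF assms(1)] assms(2)] by blast
  show "(c \<odot>\<^bsub>FObj R x\<^esub> \<one>\<^bsub>FObj R x\<^esub>) \<otimes>\<^bsub>FObj R x\<^esub> r = c \<odot>\<^bsub>FObj R x\<^esub> r"
    "r \<otimes>\<^bsub>FObj R x\<^esub> (c \<odot>\<^bsub>FObj R x\<^esub> \<one>\<^bsub>FObj R x\<^esub>) = c \<odot>\<^bsub>FObj R x\<^esub> r" if "r \<in> carrier (FObj R x)"
    using R_algebra[OF assms(1)] assms(2) that by (auto simp: k_algebra_def)
qed

lemma scal_facts: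
  assumes F: "amodule gr F" and x: "x \<in> Obj C" and r: "r \<in> carrier (FObj R x)" and m: "m \<in> carrier (FObj F x)"
  shows scal_closed: "scal F x r m \<in> carrier (FObj F x)"
    and scal_mult: "n \<in> carrier (FObj F x) \<Longrightarrow>
      scal F x r (m \<otimes>\<^bsub>FObj F x\<^esub> n) = scal F x r m \<otimes>\<^bsub>FObj F x\<^esub> scal F x r n"
    and scal_add: "s \<in> carrier (FObj R x) \<Longrightarrow>
      scal F x (r \<oplus>\<^bsub>FObj R x\<^esub> s) m = scal F x r m \<otimes>\<^bsub>FObj F x\<^esub> scal F x s m"
    and scal_scal: "s \<in> carrier (FObj R x) \<Longrightarrow> scal F x s (scal F x r m) = scal F x (r \<otimes>\<^bsub>FObj R x\<^esub> s) m"
proof -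
  interpret F: amodule gr F by fact
  have xg: "x \<in> Obj gr" using x by (simp add: Gr_simps(1))
  note id = ident_in_Hom[OF x]
  note mr = monomial_in_Hom[OF x id r]
  show "scal F x r m \<in> carrier (FObj F x)" unfolding scal_def using F.act_closed[OF xg xg mr m] .
  show "n \<in> carrier (FObj F x) \<Longrightarrow>
      scal F x r (m \<otimes>\<^bsub>FObj F x\<^esub> n) = scal F x r m \<otimes>\<^bsub>FObj F x\<^esub> scal F x r n"
    unfolding scal_def using F.act_mult[OF xg xg mr m] .
  assume s: "s \<in> carrier (FObj R x)"
  show "scal F x (r \<oplus>\<^bsub>FObj R x\<^esub> s) m = scal F x r m \<otimes>\<^bsub>FObj F x\<^esub> scal F x s m"
    unfolding scal_def using F.act_add[OF xg xg mr monomial_in_Hom[OF x id s] m] by (simp add: monomial_add[OF x])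
  show "scal F x s (scal F x r m) = scal F x (r \<otimes>\<^bsub>FObj R x\<^esub> s) m"
    unfolding scal_def
    using F.act_comp[OF xg xg xg mr monomial_in_Hom[OF x id s] m] x id
    by (simp add: Gr_comp_mono[OF x x x id id s r] R_ident r comp_ident_left)
qed

lemma scal_one:
  assumes F: "amodule gr F" and x: "x \<in> Obj C" and m: "m \<in> carrier (FObj F x)"
  shows "scal F x \<one>\<^bsub>FObj R x\<^esub> m = m"
  using amodule.act_ident[OF F, of x m] x m by (simp add: scal_def Gr_ident Gr_simps(1))

lemma scal_emb:
  assumes F: "amodule gr F" and ob: "x \<in> Obj C" "y \<in> Obj C" and f: "f \<in> Hom C y x"
    and m: "m \<in> carrier (FObj F x)" and r: "r \<in> carrier (FObj R y)"
  shows "scal F y r (FArr F x y (emb y x f) m) = FArr F x y (monomial y x f r) m"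
  using amodule.act_comp[OF F, of x y y "emb y x f" "monomial y y (ident C y) r" m] ob m
    emb_in_Hom[OF ob(2) f] monomial_in_Hom[OF ob(2) ident_in_Hom[OF ob(2)] r] emb_comp_scalar[OF ob f r]
  by (simp add: scal_def Gr_simps(1))

lemma emb_scal:
  assumes F: "amodule gr F" and ob: "x \<in> Obj C" "y \<in> Obj C" and f: "f \<in> Hom C y x"
    and m: "m \<in> carrier (FObj F x)" and r: "r \<in> carrier (FObj R x)"
  shows "FArr F x y (emb y x f) (scal F x r m) = scal F y (FArr R x y f r) (FArr F x y (emb y x f) m)"
proof -
  have "comp gr y x x (monomial x x (ident C x) r) (emb y x f) = monomial y x f (FArr R x y f r)"
    using ob f r by (simp add: emb_def Gr_comp_mono ident_in_Hom R_one_closed comp_ident_left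
        R_closed monoid.r_one[OF R_monoid])
  then have "FArr F x y (emb y x f) (scal F x r m) = FArr F x y (monomial y x f (FArr R x y f r)) m"
    using amodule.act_comp[OF F, of x x y "monomial x x (ident C x) r" "emb y x f" m] ob m
      emb_in_Hom[OF ob(2) f] monomial_in_Hom[OF ob(1) ident_in_Hom[OF ob(1)] r]
    by (simp add: scal_def Gr_simps(1))
  then show ?thesis using scal_emb[OF F ob f m R_closed[OF ob f r]] by simp
qed

lemma presheaf_from_gr:
  fixes U :: "'m set set"
  assumes F: "F \<in> Obj (ModCat U gr)" and K: "cring K"
  shows "presheaf_of_modules U K C R (from_gr F)"
proof -
  have mF: "amodule gr F" and U: "\<And>x. x \<in> Obj C \<Longrightarrow> carrier (FObj F x) \<in> U"
    using F by (auto simp: gr.Obj_ModCat_iff Gr_simps(1))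
  interpret F: amodule gr F by (rule mF)
  interpret K: cring K by (rule K)
  note s1 = R_smult_one_closed
  have mod: "module K (FObj (from_gr F) x)" if x: "x \<in> Obj C" for x
  proof (rule moduleI; (unfold from_gr_simps)?)
    interpret Fx: comm_group "FObj F x" using F.comm_grp x by (simp add: Gr_simps(1))
    interpret RM: module K "FObj R x" by (rule R_module[OF x])
    interpret Rx: ring "FObj R x" by (rule R_ring[OF x])
    show "cring K" by (rule K)
    show "abelian_group (FObj (from_gr F) x)"
      by (rule abelian_groupI) (auto simp: from_gr_simps Fx.m_ac intro: Fx.l_inv_ex)
    fix c m assume c: "c \<in> carrier K" and m: "m \<in> carrier (FObj F x)"
    show "scal F x (c \<odot>\<^bsub>FObj R x\<^esub> \<one>\<^bsub>FObj R x\<^esub>) m \<in> carrier (FObj F x)"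
      using scal_closed[OF mF x s1[OF x c] m] .
    show "scal F x (c \<odot>\<^bsub>FObj R x\<^esub> \<one>\<^bsub>FObj R x\<^esub>) (m \<otimes>\<^bsub>FObj F x\<^esub> n)
      = scal F x (c \<odot>\<^bsub>FObj R x\<^esub> \<one>\<^bsub>FObj R x\<^esub>) m \<otimes>\<^bsub>FObj F x\<^esub> scal F x (c \<odot>\<^bsub>FObj R x\<^esub> \<one>\<^bsub>FObj R x\<^esub>) n"
      if "n \<in> carrier (FObj F x)" for n
      using scal_mult[OF mF x s1[OF x c] m that] .
    fix d assume d: "d \<in> carrier K"
    show "scal F x ((c \<oplus>\<^bsub>K\<^esub> d) \<odot>\<^bsub>FObj R x\<^esub> \<one>\<^bsub>FObj R x\<^esub>) m
      = scal F x (c \<odot>\<^bsub>FObj R x\<^esub> \<one>\<^bsub>FObj R x\<^esub>) m \<otimes>\<^bsub>FObj F x\<^esub> scal F x (d \<odot>\<^bsub>FObj R x\<^esub> \<one>\<^bsub>FObj R x\<^esub>) m"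
      using scal_add[OF mF x s1[OF x c] m s1[OF x d]] c d by (simp add: RM.smult_l_distr)
    show "scal F x ((c \<otimes>\<^bsub>K\<^esub> d) \<odot>\<^bsub>FObj R x\<^esub> \<one>\<^bsub>FObj R x\<^esub>) m
      = scal F x (c \<odot>\<^bsub>FObj R x\<^esub> \<one>\<^bsub>FObj R x\<^esub>) (scal F x (d \<odot>\<^bsub>FObj R x\<^esub> \<one>\<^bsub>FObj R x\<^esub>) m)"
      using scal_scal[OF mF x s1[OF x d] m s1[OF x c]] c d x
      by (simp add: RM.smult_assoc1 R_smult_one_right[OF x c s1[OF x d]])
  next
    fix m assume m: "m \<in> carrier (FObj F x)"
    interpret RM: module K "FObj R x" by (rule R_module[OF x])
    show "scal F x (\<one>\<^bsub>K\<^esub> \<odot>\<^bsub>FObj R x\<^esub> \<one>\<^bsub>FObj R x\<^esub>) m = m"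
      using scal_one[OF mF x m] R_one_closed[OF x] by simp
  qed
  have rmod: "right_module K (FObj R x) (FObj (from_gr F) x) (act (from_gr F) x)" if x: "x \<in> Obj C" for x
    unfolding right_module_def from_gr_simps
    using mod[OF x] scal_closed[OF mF x] scal_mult[OF mF x] scal_add[OF mF x] scal_scal[OF mF x]
      scal_one[OF mF x] s1[OF x] R_smult_one_left[OF x] R_smult_one_right[OF x]
      module.smult_closed[OF R_module[OF x]]
    by simp
  have maps: "FArr F x y (emb y x f) \<in> Hom (KMod U K) (FObj (from_gr F) x) (FObj (from_gr F) y)"
    if ob: "x \<in> Obj C" "y \<in> Obj C" and f: "f \<in> Hom C y x" for x y f
  proof -
    have g: "x \<in> Obj gr" "y \<in> Obj gr" "emb y x f \<in> Hom gr y x"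
      using ob emb_in_Hom[OF ob(2) f] by (simp_all add: Gr_simps(1))
    have "FArr F x y (emb y x f) (scal F x (c \<odot>\<^bsub>FObj R x\<^esub> \<one>\<^bsub>FObj R x\<^esub>) m)
      = scal F y (c \<odot>\<^bsub>FObj R y\<^esub> \<one>\<^bsub>FObj R y\<^esub>) (FArr F x y (emb y x f) m)"
      if "c \<in> carrier K" "m \<in> carrier (FObj F x)" for c m
      using emb_scal[OF mF ob f that(2) s1[OF ob(1) that(1)]]
        R_restrict_smult[OF ob f that(1) R_one_closed[OF ob(1)]] R_one[OF ob f] by simp
    then show ?thesis
      using F.act_closed[OF g] F.act_mult[OF g] F.act_extensional[OF g]
      by (auto simp: KMod_def from_gr_simps intro!: homI)
  qed
  have "cfunctor (opp C) (KMod U K) (from_gr F)"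
  proof (intro cfunctor.intro; unfold opp_simps)
    fix x assume x: "x \<in> Obj C"
    have xg: "x \<in> Obj gr" using x by (simp add: Gr_simps(1))
    show "FObj (from_gr F) x \<in> Obj (KMod U K)"
      using mod[OF x] U[OF x] by (simp add: KMod_def from_gr_simps(1))
    show "FArr (from_gr F) x x (ident C x) = ident (KMod U K) (FObj (from_gr F) x)"
    proof (rule extensionalityI[of _ "carrier (FObj F x)"])
      show "FArr (from_gr F) x x (ident C x) \<in> extensional (carrier (FObj F x))"
        unfolding from_gr_simps using F.act_extensional[OF xg xg] emb_in_Hom[OF x ident_in_Hom[OF x]] .
      show "FArr (from_gr F) x x (ident C x) m = ident (KMod U K) (FObj (from_gr F) x) m"
        if "m \<in> carrier (FObj F x)" for m
        using F.act_ident[OF xg that] that by (simp add: KMod_def from_gr_simps Gr_ident emb_def)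
    qed (simp add: KMod_def from_gr_simps)
    fix y f assume y: "y \<in> Obj C" and f: "f \<in> Hom C y x"
    have yg: "y \<in> Obj gr" using y by (simp add: Gr_simps(1))
    show "FArr (from_gr F) x y f \<in> Hom (KMod U K) (FObj (from_gr F) x) (FObj (from_gr F) y)"
      using maps[OF x y f] by (simp add: from_gr_simps)
    fix z g assume z: "z \<in> Obj C" and g: "g \<in> Hom C z y"
    have zg: "z \<in> Obj gr" using z by (simp add: Gr_simps(1))
    show "FArr (from_gr F) x z (comp C z y x f g) =
      comp (KMod U K) (FObj (from_gr F) x) (FObj (from_gr F) y) (FObj (from_gr F) z)
        (FArr (from_gr F) y z g) (FArr (from_gr F) x y f)"
    proof (rule extensionalityI[of _ "carrier (FObj F x)"])
      show "FArr (from_gr F) x z (comp C z y x f g) \<in> extensional (carrier (FObj F x))"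
        unfolding from_gr_simps
        using F.act_extensional[OF xg zg emb_in_Hom[OF z comp_in_Hom[OF z y x g f]]] .
    qed (use act_emb_comp[OF mF x y z f g] in \<open>simp_all add: KMod_def from_gr_simps compose_def\<close>)
  qed
  then show ?thesis
    using rmod emb_scal[OF mF] unfolding presheaf_of_modules_def from_gr_simps by simp
qed

end

section \<open>The equivalence\<close>

lemma category_full_subcategory: "category C \<Longrightarrow> category (full_subcategory C P)"
  unfolding category_def full_subcategory_def by simp

text \<open>The sheaf condition only evaluates restriction maps on morphisms of the category and on sections.\<close>

lemma set_sheaf_cong:
  assumes J: "\<And>x S. x \<in> Obj C \<Longrightarrow> S \<in> J x \<Longrightarrow> sieve C x S"
    and eq: "\<And>x y f m. x \<in> Obj C \<Longrightarrow> y \<in> Obj C \<Longrightarrow> f \<in> Hom C y x \<Longrightarrow> m \<in> X x \<Longrightarrow> \<rho> x y f m = \<rho>' x y f m"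
    and sh: "set_sheaf C J X \<rho>"
  shows "set_sheaf C J X \<rho>'"
  unfolding set_sheaf_def
proof (intro ballI allI impI)
  fix x S s assume x: "x \<in> Obj C" and S: "S \<in> J x" and s: "matching_family C X \<rho>' x S s"
  have "matching_family C X \<rho> x S s"
    using s eq by (simp add: matching_family_def)
  then have "\<exists>!m. m \<in> X x \<and> (\<forall>y \<in> Obj C. \<forall>f \<in> S y. \<rho> x y f m = s y f)"
    using sh x S by (simp add: set_sheaf_def)
  moreover have "\<rho> x y f m = \<rho>' x y f m" if "m \<in> X x" "y \<in> Obj C" "f \<in> S y" for m y f
    using eq[OF x that(2) sieveD(1)[OF J[OF x S] that(2,3)] that(1)] .
  then have "(m \<in> X x \<and> (\<forall>y \<in> Obj C. \<forall>f \<in> S y. \<rho> x y f m = s y f)) \<longleftrightarrow>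
    (m \<in> X x \<and> (\<forall>y \<in> Obj C. \<forall>f \<in> S y. \<rho>' x y f m = s y f))" for m
    by (intro conj_cong refl ball_cong) simp
  ultimately show "\<exists>!m. m \<in> X x \<and> (\<forall>y \<in> Obj C. \<forall>f \<in> S y. \<rho>' x y f m = s y f)"
    by simp
qed

lemma ShMod_simps:
  "Obj (ShMod U K C J R) = {M. presheaf_of_modules U K C R M \<and>
      set_sheaf C J (\<lambda>x. carrier (FObj M x)) (FArr M)}"
  "Hom (ShMod U K C J R) = presheaf_of_modules_hom U K C R"
  "ident (ShMod U K C J R) = (\<lambda>M. \<lambda>x \<in> Obj C. \<lambda>m \<in> carrier (FObj M x). m)"
  "comp (ShMod U K C J R) =
    (\<lambda>M N L \<theta> \<eta>. \<lambda>x \<in> Obj C. compose (carrier (FObj M x)) (\<theta> x) (\<eta> x))"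
  by (simp_all add: ShMod_def)

lemma right_perp_simps:
  "Hom (right_perp G B) = Hom G" "ident (right_perp G B) = ident G" "comp (right_perp G B) = comp G"
  by (simp_all add: right_perp_def full_subcategory_def)

context algebra_site
begin

lemma module_presheafI: "presheaf_of_modules U K C R M \<Longrightarrow> module_presheaf C K R U M"
  by (intro module_presheaf.intro module_presheaf_axioms.intro algebra_presheaf_axioms)

lemma presheaf_closed:
  assumes M: "presheaf_of_modules U K C R M" and x: "x \<in> Obj C"
  shows "m \<in> carrier (FObj M x) \<Longrightarrow> n \<in> carrier (FObj M x) \<Longrightarrow> m \<oplus>\<^bsub>FObj M x\<^esub> n \<in> carrier (FObj M x)"
    and "c \<in> carrier K \<Longrightarrow> m \<in> carrier (FObj M x) \<Longrightarrow> c \<odot>\<^bsub>FObj M x\<^esub> m \<in> carrier (FObj M x)"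
    and "m \<in> carrier (FObj M x) \<Longrightarrow> r \<in> carrier (FObj R x) \<Longrightarrow> act M x m r \<in> carrier (FObj M x)"
    and "y \<in> Obj C \<Longrightarrow> f \<in> Hom C y x \<Longrightarrow> m \<in> carrier (FObj M x) \<Longrightarrow> FArr M x y f m \<in> carrier (FObj M y)"
proof -
  interpret M: module_presheaf C K R U M by (rule module_presheafI[OF M])
  interpret Mx: module K "FObj M x" by (rule M.M_module[OF x])
  show "m \<in> carrier (FObj M x) \<Longrightarrow> n \<in> carrier (FObj M x) \<Longrightarrow> m \<oplus>\<^bsub>FObj M x\<^esub> n \<in> carrier (FObj M x)"
    "c \<in> carrier K \<Longrightarrow> m \<in> carrier (FObj M x) \<Longrightarrow> c \<odot>\<^bsub>FObj M x\<^esub> m \<in> carrier (FObj M x)"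
    "m \<in> carrier (FObj M x) \<Longrightarrow> r \<in> carrier (FObj R x) \<Longrightarrow> act M x m r \<in> carrier (FObj M x)"
    "y \<in> Obj C \<Longrightarrow> f \<in> Hom C y x \<Longrightarrow> m \<in> carrier (FObj M x) \<Longrightarrow> FArr M x y f m \<in> carrier (FObj M y)"
    using M.M_act_closed M.M_closed x by simp_all
qed

text \<open>Presheaves of modules that agree in all operations on the carriers need not be equal as records;
  the identity of the underlying sets then compares them.\<close>

lemma presheaf_identity_hom:
  assumes M: "presheaf_of_modules U K C R M"
    and "\<And>x. x \<in> Obj C \<Longrightarrow> carrier (FObj N x) = carrier (FObj M x)"
    and "\<And>x m n. x \<in> Obj C \<Longrightarrow> m \<in> carrier (FObj M x) \<Longrightarrow> n \<in> carrier (FObj M x) \<Longrightarrow>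
      m \<oplus>\<^bsub>FObj N x\<^esub> n = m \<oplus>\<^bsub>FObj M x\<^esub> n"
    and "\<And>x c m. x \<in> Obj C \<Longrightarrow> c \<in> carrier K \<Longrightarrow> m \<in> carrier (FObj M x) \<Longrightarrow>
      c \<odot>\<^bsub>FObj N x\<^esub> m = c \<odot>\<^bsub>FObj M x\<^esub> m"
    and "\<And>x y f m. x \<in> Obj C \<Longrightarrow> y \<in> Obj C \<Longrightarrow> f \<in> Hom C y x \<Longrightarrow> m \<in> carrier (FObj M x) \<Longrightarrow>
      FArr N x y f m = FArr M x y f m"
    and "\<And>x m r. x \<in> Obj C \<Longrightarrow> m \<in> carrier (FObj M x) \<Longrightarrow> r \<in> carrier (FObj R x) \<Longrightarrow>
      act N x m r = act M x m r"
  shows "(\<lambda>x \<in> Obj C. \<lambda>m \<in> carrier (FObj M x). m) \<in> presheaf_of_modules_hom U K C R M N"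
  unfolding presheaf_hom_iff using assms presheaf_closed[OF M] by simp

lemma presheaf_hom_comp:
  assumes M: "presheaf_of_modules U K C R M"
    and "\<eta> \<in> presheaf_of_modules_hom U K C R M N" "\<theta> \<in> presheaf_of_modules_hom U K C R N L"
  shows "(\<lambda>x \<in> Obj C. compose (carrier (FObj M x)) (\<theta> x) (\<eta> x)) \<in> presheaf_of_modules_hom U K C R M L"
  using assms(2,3) presheaf_closed[OF M] unfolding presheaf_hom_iff by (simp add: compose_def)

lemma presheaf_homD:
  assumes "\<eta> \<in> presheaf_of_modules_hom U K C R M N" "x \<in> Obj C"
  shows "m \<in> carrier (FObj M x) \<Longrightarrow> \<eta> x m \<in> carrier (FObj N x)"
    and "\<eta> x \<in> extensional (carrier (FObj M x))" "\<eta> \<in> extensional (Obj C)"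
  using assms unfolding presheaf_hom_iff by auto

lemma presheaf_hom_ext:
  assumes \<eta>: "\<eta> \<in> presheaf_of_modules_hom U K C R M N"
    and \<theta>: "\<And>x. x \<in> Obj C \<Longrightarrow> \<theta> x \<in> extensional (carrier (FObj M x))" "\<theta> \<in> extensional (Obj C)"
    and eq: "\<And>x m. x \<in> Obj C \<Longrightarrow> m \<in> carrier (FObj M x) \<Longrightarrow> \<theta> x m = \<eta> x m"
  shows "\<theta> = \<eta>"
proof (rule extensionalityI[OF \<theta>(2)])
  show "\<eta> \<in> extensional (Obj C)" using \<eta> unfolding presheaf_hom_iff by blast
  show "\<theta> x = \<eta> x" if "x \<in> Obj C" for x
    using extensionalityI[OF \<theta>(1)[OF that] presheaf_homD(2)[OF \<eta> that]] eq[OF that] by blast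
qed

lemma category_ShMod: "category (ShMod U K C J R)"
proof (intro category.intro; unfold ShMod_simps mem_Collect_eq)
  fix M assume M: "presheaf_of_modules U K C R M \<and> set_sheaf C J (\<lambda>x. carrier (FObj M x)) (FArr M)"
  then have pM: "presheaf_of_modules U K C R M" by blast
  show "(\<lambda>x \<in> Obj C. \<lambda>m \<in> carrier (FObj M x). m) \<in> presheaf_of_modules_hom U K C R M M"
    by (rule presheaf_identity_hom[OF pM]) simp_all
  fix N assume "presheaf_of_modules U K C R N \<and> set_sheaf C J (\<lambda>x. carrier (FObj N x)) (FArr N)"
  fix \<eta> assume \<eta>: "\<eta> \<in> presheaf_of_modules_hom U K C R M N"
  show "(\<lambda>x \<in> Obj C. compose (carrier (FObj M x)) ((\<lambda>x \<in> Obj C. \<lambda>m \<in> carrier (FObj N x). m) x) (\<eta> x)) = \<eta>"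
    by (rule presheaf_hom_ext[OF \<eta>]) (use presheaf_homD(1)[OF \<eta>] in \<open>simp_all add: compose_def\<close>)
  show "(\<lambda>x \<in> Obj C. compose (carrier (FObj M x)) (\<eta> x) ((\<lambda>x \<in> Obj C. \<lambda>m \<in> carrier (FObj M x). m) x)) = \<eta>"
    by (rule presheaf_hom_ext[OF \<eta>]) (simp_all add: compose_def)
  fix L \<theta> assume \<theta>: "\<theta> \<in> presheaf_of_modules_hom U K C R N L"
  show "(\<lambda>x \<in> Obj C. compose (carrier (FObj M x)) (\<theta> x) (\<eta> x)) \<in> presheaf_of_modules_hom U K C R M L"
    by (rule presheaf_hom_comp[OF pM \<eta> \<theta>])
  fix P \<zeta> assume "\<zeta> \<in> presheaf_of_modules_hom U K C R L P"
  show "(\<lambda>x \<in> Obj C. compose (carrier (FObj M x)) (\<zeta> x)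
        ((\<lambda>x \<in> Obj C. compose (carrier (FObj M x)) (\<theta> x) (\<eta> x)) x))
      = (\<lambda>x \<in> Obj C. compose (carrier (FObj M x))
        ((\<lambda>x \<in> Obj C. compose (carrier (FObj N x)) (\<zeta> x) (\<theta> x)) x) (\<eta> x))"
    using presheaf_homD(1)[OF \<eta>] by (intro restrict_ext) (auto simp: compose_def)
qed

lemma to_gr_map:
  assumes M: "presheaf_of_modules U K C R M" and N: "presheaf_of_modules U K C R N"
    and \<eta>: "\<eta> \<in> presheaf_of_modules_hom U K C R M N"
  shows "\<eta> \<in> module_maps gr (to_gr C M) (to_gr C N)"
proof -
  interpret M: module_presheaf C K R U M by (rule module_presheafI[OF M])
  interpret N: module_presheaf C K R U N by (rule module_presheafI[OF N])
  note \<eta>' = \<eta>[unfolded presheaf_hom_iff]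
  show ?thesis
  proof (rule module_mapsI; (unfold Gr_simps(1) to_gr_simps(1,2))?)
    fix x y \<phi> m assume ob: "x \<in> Obj C" "y \<in> Obj C" and \<phi>: "\<phi> \<in> Hom gr y x" and m: "m \<in> carrier (FObj M x)"
    have \<eta>m: "\<eta> x m \<in> carrier (FObj N x)" using \<eta>' ob m by blast
    interpret My: abelian_group "FObj M y" by (rule M.M_abelian[OF ob(2)])
    interpret Ny: abelian_group "FObj N y" by (rule N.M_abelian[OF ob(2)])
    interpret h: group_hom "add_monoid (FObj M y)" "add_monoid (FObj N y)" "\<eta> y"
      using \<eta>' ob by (intro group_hom.intro group_hom_axioms.intro homI) (auto intro: My.a_group Ny.a_group)
    show "\<eta> y (FArr (to_gr C M) x y \<phi> m) = FArr (to_gr C N) x y \<phi> (\<eta> x m)"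
      using ob(2) \<phi>
    proof (induction rule: Gr_induct)
      case zero
      then show ?case using h.hom_one by (simp add: M.to_gr_zero[OF ob m] N.to_gr_zero[OF ob \<eta>m])
    next
      case (monomial f)
      then show ?case
        using \<eta>' ob m \<eta>m M.M_closed[OF ob monomial(1) m] by (simp add: M.to_gr_mono N.to_gr_mono)
    next
      case (add u v)
      then show ?case
        using \<eta>' ob m \<eta>m M.to_gr_closed[OF ob m] by (simp add: M.to_gr_add N.to_gr_add)
    qed
  qed (use \<eta>' in auto)
qed

lemma from_gr_map:
  assumes F: "amodule gr F" and G: "amodule gr G" and \<eta>: "\<eta> \<in> module_maps gr F G"
  shows "\<eta> \<in> presheaf_of_modules_hom U K C R (from_gr F) (from_gr G)"
proof -
  note \<eta>' = module_maps_extensional[OF \<eta>] module_maps_closed[OF \<eta>] module_maps_mult[OF \<eta>]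
    module_maps_natural[OF \<eta>]
  have scal: "\<eta> x (scal F x r m) = scal G x r (\<eta> x m)"
    if "x \<in> Obj C" "r \<in> carrier (FObj R x)" "m \<in> carrier (FObj F x)" for x r m
    using \<eta>'(4)[of x x "monomial x x (ident C x) r" m] that monomial_in_Hom[OF that(1) ident_in_Hom[OF that(1)] that(2)]
    by (simp add: scal_def Gr_simps(1))
  have "\<eta> x \<in> extensional (carrier (FObj F x))" if "x \<in> Obj C" for x
    using module_maps_group_maps[OF \<eta>, of x] that by (simp add: Gr_simps(1) group_maps_def)
  then show ?thesis
    unfolding presheaf_hom_iff from_gr_simps
    using \<eta>' scal R_smult_one_closed emb_in_Hom by (simp add: Gr_simps(1))
qed

lemma from_gr_to_gr:
  assumes M: "presheaf_of_modules U K C R M" and x: "x \<in> Obj C" and m: "m \<in> carrier (FObj M x)"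
  shows "r \<in> carrier (FObj R x) \<Longrightarrow> act (from_gr (to_gr C M)) x m r = act M x m r"
    and "c \<in> carrier K \<Longrightarrow> c \<odot>\<^bsub>FObj (from_gr (to_gr C M)) x\<^esub> m = c \<odot>\<^bsub>FObj M x\<^esub> m"
    and "y \<in> Obj C \<Longrightarrow> f \<in> Hom C y x \<Longrightarrow> FArr (from_gr (to_gr C M)) x y f m = FArr M x y f m"
proof -
  interpret M: module_presheaf C K R U M by (rule module_presheafI[OF M])
  note id = ident_in_Hom[OF x]
  show act: "act (from_gr (to_gr C M)) x m r = act M x m r" if "r \<in> carrier (FObj R x)" for r
    using M.to_gr_mono[OF x x m id that] M.M_ident[OF x m] by (simp add: from_gr_simps scal_def)
  show "c \<odot>\<^bsub>FObj (from_gr (to_gr C M)) x\<^esub> m = c \<odot>\<^bsub>FObj M x\<^esub> m" if c: "c \<in> carrier K"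
    using act[OF R_smult_one_closed[OF x c]] M.M_act_smult[OF x m c R_one_closed[OF x]] M.M_act_one[OF x m]
    by (simp add: from_gr_simps)
  show "y \<in> Obj C \<Longrightarrow> f \<in> Hom C y x \<Longrightarrow> FArr (from_gr (to_gr C M)) x y f m = FArr M x y f m"
    using M.to_gr_emb[OF x _ m] by (simp add: from_gr_simps emb_def)
qed

lemma to_gr_from_gr:
  fixes U :: "'m set set"
  assumes F: "F \<in> Obj (ModCat U gr)" and K: "cring K" and ob: "x \<in> Obj C" "y \<in> Obj C"
    and \<phi>: "\<phi> \<in> Hom gr y x" and m: "m \<in> carrier (FObj F x)"
  shows "FArr (to_gr C (from_gr F)) x y \<phi> m = FArr F x y \<phi> m"
proof -
  have mF: "amodule gr F" using F by (simp add: gr.Obj_ModCat_iff)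
  interpret F: amodule gr F by (rule mF)
  interpret M: module_presheaf C K R U "from_gr F"
    by (rule module_presheafI[OF presheaf_from_gr[OF F K]])
  have m': "m \<in> carrier (FObj (from_gr F) x)" using m by (simp add: from_gr_simps)
  have g: "x \<in> Obj gr" "y \<in> Obj gr" using ob by (simp_all add: Gr_simps(1))
  interpret h: group_hom "hgrp gr y x" "FObj F y" "\<lambda>\<phi>. FArr F x y \<phi> m"
    using F.act_on_hom[OF g m] .
  show ?thesis
    using ob(2) \<phi>
  proof (induction rule: Gr_induct)
    case zero
    then show ?case using h.hom_one M.to_gr_zero[OF ob m'] by (simp add: from_gr_simps)
  next
    case (monomial f)
    then show ?case
      using M.to_gr_mono[OF ob m' monomial(1,3)] scal_emb[OF mF ob monomial(1) m monomial(3)] by (simp add: from_gr_simps)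
  next
    case (add u v)
    then show ?case
      using M.to_gr_add[OF ob m' add(1,2)] F.act_add[OF g add(1,2) m] by (simp add: from_gr_simps)
  qed
qed

lemma to_gr_in_right_perp:
  fixes U :: "'m set set"
  assumes U: "size_universe U" and M: "M \<in> Obj (ShMod U K C J R)"
  shows "to_gr C M \<in> Obj (right_perp (ModCat U gr) (Tors U gr lintop))"
proof -
  have pM: "presheaf_of_modules U K C R M" and sh: "set_sheaf C J (\<lambda>x. carrier (FObj M x)) (FArr M)"
    using M by (auto simp: ShMod_simps)
  interpret M: module_presheaf C K R U M by (rule module_presheafI[OF pM])
  have "to_gr C M \<in> Obj (ModCat U gr)"
    using M.amodule_to_gr M.M_carrier by (simp add: gr.Obj_ModCat_iff Gr_simps(1) to_gr_simps(1))
  moreover have "is_sheaf (to_gr C M)"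
    unfolding is_sheaf_def to_gr_simps(1)
    by (rule set_sheaf_cong[OF top.covering_sieve _ sh])
      (simp_all add: emb_def M.to_gr_emb)
  ultimately show ?thesis by (rule sheaf_in_right_perp[OF U])
qed

lemma from_gr_in_ShMod:
  fixes U :: "'m set set"
  assumes U: "size_universe U" and K: "cring K"
    and small: "\<And>x y. x \<in> Obj C \<Longrightarrow> y \<in> Obj C \<Longrightarrow> small U (Hom gr y x)"
    and F: "F \<in> Obj (right_perp (ModCat U gr) (Tors U gr lintop))"
  shows "from_gr F \<in> Obj (ShMod U K C J R)"
proof -
  have "F \<in> Obj (ModCat U gr)" using F Obj_right_perp_iff by blast
  moreover have "set_sheaf C J (\<lambda>x. carrier (FObj F x)) (\<lambda>x y f. FArr F x y (emb y x f))"
    using right_perp_is_sheaf[OF U F small] by (simp add: is_sheaf_def)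
  moreover have "FArr (from_gr F) = (\<lambda>x y f. FArr F x y (emb y x f))" by (simp add: from_gr_def)
  ultimately show ?thesis
    using presheaf_from_gr[OF _ K] by (simp add: ShMod_simps from_gr_simps(1))
qed

text \<open>Both functors leave the underlying maps unchanged, and both natural isomorphisms are the identity on
  the underlying sets.\<close>

theorem ShMod_equivalent_right_perp:
  fixes U :: "'m set set"
  assumes U: "size_universe U" and K: "cring K"
    and small: "\<And>x y. x \<in> Obj C \<Longrightarrow> y \<in> Obj C \<Longrightarrow> small U (Hom gr y x)"
  shows "equivalent_categories (ShMod U K C J R) (right_perp (ModCat U gr) (Tors U gr lintop))"
    (is "equivalent_categories ?S ?P")
proof -
  interpret M: preadditive "ModCat U gr" by (rule gr.preadditive_ModCat)
  have catS: "category ?S" by (rule category_ShMod)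
  have catP: "category ?P"
    unfolding right_perp_def by (rule category_full_subcategory[OF M.category_axioms])
  define \<Phi> :: "(('o, 'a, 'k, 'r, 'm) rmodule_data, 'o \<Rightarrow> 'm \<Rightarrow> 'm,
      ('o, 'a \<Rightarrow> 'r, 'm monoid, 'm \<Rightarrow> 'm) cfunctor, 'o \<Rightarrow> 'm \<Rightarrow> 'm) cfunctor"
    where "\<Phi> = \<lparr>FObj = to_gr C, FArr = (\<lambda>M N \<eta>. \<eta>)\<rparr>"
  define \<Psi> :: "(('o, 'a \<Rightarrow> 'r, 'm monoid, 'm \<Rightarrow> 'm) cfunctor, 'o \<Rightarrow> 'm \<Rightarrow> 'm,
      ('o, 'a, 'k, 'r, 'm) rmodule_data, 'o \<Rightarrow> 'm \<Rightarrow> 'm) cfunctor"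
    where "\<Psi> = \<lparr>FObj = from_gr, FArr = (\<lambda>F G \<eta>. \<eta>)\<rparr>"
  have pS: "presheaf_of_modules U K C R M" if "M \<in> Obj ?S" for M
    using that by (simp add: ShMod_simps)
  have PM: "F \<in> Obj (ModCat U gr)" if "F \<in> Obj ?P" for F
    using that Obj_right_perp_iff by blast
  have Pa: "amodule gr F" if "F \<in> Obj ?P" for F
    using PM[OF that] by (simp add: gr.Obj_ModCat_iff)
  note toP = to_gr_in_right_perp[OF U] and fromS = from_gr_in_ShMod[OF U K small]
  note simps = right_perp_simps ModCat_simps(1-3) ShMod_simps(2-4) Gr_simps(1)
    to_gr_simps(1) from_gr_simps(1)
  have \<Phi>: "cfunctor ?S ?P \<Phi>"
  proof (intro cfunctor.intro)
    fix M assume M: "M \<in> Obj ?S"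
    show "FObj \<Phi> M \<in> Obj ?P" using toP[OF M] by (simp add: \<Phi>_def)
    show "FArr \<Phi> M M (ident ?S M) = ident ?P (FObj \<Phi> M)" by (simp add: \<Phi>_def simps)
    fix N \<eta> assume N: "N \<in> Obj ?S" and \<eta>: "\<eta> \<in> Hom ?S M N"
    show "FArr \<Phi> M N \<eta> \<in> Hom ?P (FObj \<Phi> M) (FObj \<Phi> N)"
      using to_gr_map[OF pS[OF M] pS[OF N]] \<eta> by (simp add: \<Phi>_def simps)
    fix L \<theta> assume "L \<in> Obj ?S" "\<theta> \<in> Hom ?S N L"
    show "FArr \<Phi> M L (comp ?S M N L \<theta> \<eta>)
      = comp ?P (FObj \<Phi> M) (FObj \<Phi> N) (FObj \<Phi> L) (FArr \<Phi> N L \<theta>) (FArr \<Phi> M N \<eta>)"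
      by (simp add: \<Phi>_def simps)
  qed
  have \<Psi>: "cfunctor ?P ?S \<Psi>"
  proof (intro cfunctor.intro)
    fix F assume F: "F \<in> Obj ?P"
    show "FObj \<Psi> F \<in> Obj ?S" using fromS F by (simp add: \<Psi>_def)
    show "FArr \<Psi> F F (ident ?P F) = ident ?S (FObj \<Psi> F)" by (simp add: \<Psi>_def simps)
    fix G \<eta> assume G: "G \<in> Obj ?P" and \<eta>: "\<eta> \<in> Hom ?P F G"
    show "FArr \<Psi> F G \<eta> \<in> Hom ?S (FObj \<Psi> F) (FObj \<Psi> G)"
      using from_gr_map[OF Pa[OF F] Pa[OF G]] \<eta> by (simp add: \<Psi>_def simps)
    fix H \<theta> assume "H \<in> Obj ?P" "\<theta> \<in> Hom ?P G H"
    show "FArr \<Psi> F H (comp ?P F G H \<theta> \<eta>)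
      = comp ?S (FObj \<Psi> F) (FObj \<Psi> G) (FObj \<Psi> H) (FArr \<Psi> G H \<theta>) (FArr \<Psi> F G \<eta>)"
      by (simp add: \<Psi>_def simps)
  qed
  have unit: "naturally_isomorphic ?S ?S id_functor (comp_functor \<Psi> \<Phi>)"
  proof -
    define \<iota> where "\<iota> M = (\<lambda>x \<in> Obj C. \<lambda>m \<in> carrier (FObj M x). m)"
      for M :: "('o, 'a, 'k, 'r, 'm) rmodule_data"
    have car: "carrier (FObj (from_gr (to_gr C M)) x) = carrier (FObj M x)"
      for x and M :: "('o, 'a, 'k, 'r, 'm) rmodule_data"
      by (simp add: simps)
    have \<iota>1: "\<iota> M \<in> Hom ?S M (from_gr (to_gr C M))" if M: "M \<in> Obj ?S" for M
      unfolding ShMod_simps \<iota>_def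
      by (rule presheaf_identity_hom[OF pS[OF M]])
        (use from_gr_to_gr[OF pS[OF M]] in \<open>simp_all add: car from_gr_simps(3) to_gr_simps(2)\<close>)
    have \<iota>2: "\<iota> M \<in> Hom ?S (from_gr (to_gr C M)) M" if M: "M \<in> Obj ?S" for M
    proof -
      have p: "presheaf_of_modules U K C R (from_gr (to_gr C M))"
        using pS fromS toP[OF M] by blast
      have "\<iota> M = (\<lambda>x \<in> Obj C. \<lambda>m \<in> carrier (FObj (from_gr (to_gr C M)) x). m)"
        by (simp add: \<iota>_def car)
      then show ?thesis
        unfolding ShMod_simps
        by (simp only:) (rule presheaf_identity_hom[OF p],
          use from_gr_to_gr[OF pS[OF M]] in \<open>simp_all add: car from_gr_simps(3) to_gr_simps(2)\<close>)
    qed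
    have \<iota>\<iota>: "(\<lambda>x \<in> Obj C. compose (carrier (FObj M x)) (\<iota> M x) (\<iota> M x)) = \<iota> M" for M
      by (auto simp: \<iota>_def compose_def fun_eq_iff restrict_def)
    have iso: "is_iso ?S M (from_gr (to_gr C M)) (\<iota> M)" if M: "M \<in> Obj ?S" for M
      unfolding is_iso_def using \<iota>1[OF M] \<iota>2[OF M] \<iota>\<iota>[of M]
      by (intro conjI bexI[of _ "\<iota> M"]) (simp_all add: ShMod_simps(3,4) car, simp_all add: \<iota>_def)
    have nat: "(\<lambda>x \<in> Obj C. compose (carrier (FObj M x)) (\<iota> N x) (\<eta> x))
        = (\<lambda>x \<in> Obj C. compose (carrier (FObj M x)) (\<eta> x) (\<iota> M x))"
      if "\<eta> \<in> Hom ?S M N" for M N \<eta>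
      using presheaf_homD(1)[of \<eta> U M N] that
      by (intro restrict_ext) (auto simp: \<iota>_def compose_def ShMod_simps(2) intro!: restrict_ext)
    have "(\<lambda>M \<in> Obj ?S. \<iota> M) \<in> nat_transformations ?S ?S id_functor (comp_functor \<Psi> \<Phi>)"
      using \<iota>1 nat by (auto simp: nat_transformations_def id_functor_def comp_functor_def \<Phi>_def \<Psi>_def
          ShMod_simps(4))
    then show ?thesis
      unfolding naturally_isomorphic_def
      using iso by (intro bexI[of _ "\<lambda>M \<in> Obj ?S. \<iota> M"])
        (simp_all add: id_functor_def comp_functor_def \<Phi>_def \<Psi>_def)
  qed
  have counit: "naturally_isomorphic ?P ?P (comp_functor \<Phi> \<Psi>) id_functor"
  proof -
    define \<iota> where "\<iota> F = (\<lambda>x \<in> Obj gr. \<lambda>m \<in> carrier (FObj F x). m)"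
      for F :: "('o, 'a \<Rightarrow> 'r, 'm monoid, 'm \<Rightarrow> 'm) cfunctor"
    have car: "carrier (FObj (to_gr C (from_gr F)) x) = carrier (FObj F x)"
      and mult: "m \<otimes>\<^bsub>FObj (to_gr C (from_gr F)) x\<^esub> n = m \<otimes>\<^bsub>FObj F x\<^esub> n"
      for x m n and F :: "('o, 'a \<Rightarrow> 'r, 'm monoid, 'm \<Rightarrow> 'm) cfunctor"
      by (simp_all add: to_gr_simps(1,2) from_gr_simps)
    have closed: "FArr F x y \<phi> m \<in> carrier (FObj F y)"
      if "F \<in> Obj ?P" "x \<in> Obj C" "y \<in> Obj C" "\<phi> \<in> Hom gr y x" "m \<in> carrier (FObj F x)" for F x y \<phi> m
      using amodule.act_closed[OF Pa[OF that(1)], of x y \<phi> m] that by (simp add: Gr_simps(1))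
    have mult_closed: "m \<otimes>\<^bsub>FObj F x\<^esub> n \<in> carrier (FObj F x)"
      if "F \<in> Obj ?P" "x \<in> Obj C" "m \<in> carrier (FObj F x)" "n \<in> carrier (FObj F x)" for F x m n
      using amodule.grp[OF Pa[OF that(1)], of x] that
      by (simp add: Gr_simps(1) group.is_monoid monoid.m_closed)
    have \<iota>1: "\<iota> F \<in> module_maps gr (to_gr C (from_gr F)) F" if F: "F \<in> Obj ?P" for F
      by (rule module_mapsI; (unfold car mult Gr_simps(1))?)
        (use closed[OF F] mult_closed[OF F] to_gr_from_gr[OF PM[OF F] K] in
          \<open>auto simp: \<iota>_def Gr_simps(1)\<close>)
    have \<iota>2: "\<iota> F \<in> module_maps gr F (to_gr C (from_gr F))" if F: "F \<in> Obj ?P" for F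
      by (rule module_mapsI; (unfold car mult Gr_simps(1))?)
        (use closed[OF F] mult_closed[OF F] to_gr_from_gr[OF PM[OF F] K] in
          \<open>auto simp: \<iota>_def Gr_simps(1)\<close>)
    have \<iota>\<iota>: "(\<lambda>x \<in> Obj gr. compose (carrier (FObj F x)) (\<iota> F x) (\<iota> F x)) = \<iota> F" for F
      by (auto simp: \<iota>_def compose_def fun_eq_iff restrict_def)
    have iso: "is_iso ?P (to_gr C (from_gr F)) F (\<iota> F)" if F: "F \<in> Obj ?P" for F
      unfolding is_iso_def using \<iota>1[OF F] \<iota>2[OF F] \<iota>\<iota>[of F]
      by (intro conjI bexI[of _ "\<iota> F"])
        (simp_all add: right_perp_simps ModCat_simps(1-3) car, simp_all add: \<iota>_def)
    have nat: "(\<lambda>x \<in> Obj gr. compose (carrier (FObj F x)) (\<iota> G x) (\<eta> x))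
        = (\<lambda>x \<in> Obj gr. compose (carrier (FObj F x)) (\<eta> x) (\<iota> F x))"
      if "\<eta> \<in> module_maps gr F G" for F G \<eta>
      using module_maps_closed[OF that]
      by (intro restrict_ext) (auto simp: \<iota>_def compose_def intro!: restrict_ext)
    have "(\<lambda>F \<in> Obj ?P. \<iota> F) \<in> nat_transformations ?P ?P (comp_functor \<Phi> \<Psi>) id_functor"
      using \<iota>1 nat by (auto simp: nat_transformations_def id_functor_def comp_functor_def \<Phi>_def \<Psi>_def
          right_perp_simps ModCat_simps(1,3) car)
    then show ?thesis
      unfolding naturally_isomorphic_def
      using iso by (intro bexI[of _ "\<lambda>F \<in> Obj ?P. \<iota> F"])
        (simp_all add: id_functor_def comp_functor_def \<Phi>_def \<Psi>_def)
  qed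
  show ?thesis
    unfolding equivalent_categories_def using catS catP \<Phi> \<Psi> unit counit by blast
qed

end

theorem theoremA:
  fixes K :: "'k ring"
    and C :: "('o, 'a) category"
    and J :: "'o \<Rightarrow> ('o \<Rightarrow> 'a set) set"
    and R :: "('o, 'a, ('k, 'r) module, 'r \<Rightarrow> 'r) cfunctor"
    and U :: "'m set set"
  assumes "size_universe U"
    and "cring K"
    and "small_category U C"
    and "grothendieck_topology C J"
    and "sheaf_of_algebras K C J R"
    and "\<forall>x \<in> Obj C. small U (carrier (FObj R x))"
  shows "\<exists>J'. linear_topology (Gr C R) J' \<and>
    equivalent_categories (ShMod U K C J R)
      (right_perp (ModCat U (Gr C R)) (Tors U (Gr C R) J'))"
proof -
  interpret algebra_site C K R J
    using assms(3-5) by (intro algebra_site.intro algebra_presheaf.intro algebra_presheaf_axioms.intro)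
      (simp_all add: small_category_def sheaf_of_algebras_def)
  have "small U (Hom gr y x)" if "x \<in> Obj C" "y \<in> Obj C" for x y
    unfolding Gr_simps(2,3)
    using assms(3,6) that R_add_group by (intro small_sum_group[OF assms(1)]) (simp_all add: small_category_def)
  then show ?thesis
    using linear_topology_lintop ShMod_equivalent_right_perp[OF assms(1,2)] by blast
qed

end
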